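(* Let $k$ be an algebraically closed field of characteristic zero, $\mathfrak{g}$ a finite-dimensional simple Lie algebra over $k$, $S$ a unital, commutative, associative, reduced $k$-algebra of finite type, and $\Gamma$ a finite group acting on $\mathfrak{g}\otimes_k S$ by $k$-Lie algebra automorphisms. Let $\mathcal{L}=(\mathfrak{g}\otimes_k S)^\Gamma$. Let $M_1,\ldots,M_r\in\mathrm{Max}\,S$ be representatives of distinct $\Gamma$-orbits. Let $(V_i,\phi_i)$ be a finite-dimensional irreducible representation of $\mathfrak{g}^{M_i}$ for $i=1,\ldots,r$, and suppose that $(W,\rho)$ is a (possibly trivial) $1$-dimensional module for the $k$-Lie algebra $\mathcal{L}$. Then $V=W\otimes_k V_1\otimes_k\cdots\otimes_k V_r$ is a finite-dimensional simple module for $\mathcal{L}$ with action $\phi_i\circ\mathrm{ev}_{M_i}$ on each $V_i$.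
   Context: The bracket on $\mathfrak{g}\otimes_k S$ is $[x\otimes r,y\otimes s]=[x,y]\otimes rs$, and $\mathcal{L}=\{z\in\mathfrak{g}\otimes_k S:{}^\gamma z=z\text{ for all }\gamma\in\Gamma\}$. $\mathrm{Max}\,S$ is the set of maximal ideals of $S$; for $s\in S$ and $M\in\mathrm{Max}\,S$, $s(M)\in k$ is the residue class of $s$ in $S/M\cong k$, and for $z=\sum x_i\otimes s_i\in\mathfrak{g}\otimes_k S$, $z(M)=\sum s_i(M)x_i\in\mathfrak{g}$. The action of $\Gamma$ on $\mathfrak{g}\otimes_k S$ induces an action on $\mathrm{Max}\,S$ determined by ${}^\gamma(\mathfrak{g}\otimes_k M)=\mathfrak{g}\otimes_k{}^\gamma M$. For $M\in\mathrm{Max}\,S$, $\Gamma^M=\{\gamma\in\Gamma:{}^\gamma M=M\}$; for $\gamma\in\Gamma$, $\gamma(M):\mathfrak{g}\to\mathfrak{g}$ is the map $\gamma(M)x=({}^\gamma(x\otimes 1))(M)$; and $\mathfrak{g}^M=\{x\in\mathfrak{g}:\gamma(M)x=x\text{ for all }\gamma\in\Gamma^M\}$. The evaluation map $\mathrm{ev}_M:\mathcal{L}\to\mathfrak{g}^M$ is the Lie algebra homomorphism $z\mapsto z(M)$. *)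

theory Defs
  imports
    "Jordan_Normal_Form.Missing_VectorSpace"
    "HOL-Algebra.Group_Action"
    "HOL-Algebra.Algebraic_Closure"
begin

section \<open>Lie algebras and their modules\<close>

text \<open>The record \<open>module\<close> of HOL-Algebra extends \<open>ring\<close>; the locales \<open>module\<close> and \<open>vectorspace\<close>
  do not look at its fields \<open>mult\<close> and \<open>one\<close>, which are left unspecified below.\<close>

record ('k, 'g) lie_alg = "('k, 'g) module" +
  bracket :: "'g \<Rightarrow> 'g \<Rightarrow> 'g"

locale lie_algebra = vectorspace K L
  for K :: "('k, 'd) ring_scheme" and L :: "('k, 'g, 'e) lie_alg_scheme" +
  assumes bracket_closed:
      "\<lbrakk>x \<in> carrier L; y \<in> carrier L\<rbrakk> \<Longrightarrow> bracket L x y \<in> carrier L"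
    and bracket_add_left:
      "\<lbrakk>x \<in> carrier L; y \<in> carrier L; z \<in> carrier L\<rbrakk>
        \<Longrightarrow> bracket L (x \<oplus>\<^bsub>L\<^esub> y) z = bracket L x z \<oplus>\<^bsub>L\<^esub> bracket L y z"
    and bracket_add_right:
      "\<lbrakk>x \<in> carrier L; y \<in> carrier L; z \<in> carrier L\<rbrakk>
        \<Longrightarrow> bracket L x (y \<oplus>\<^bsub>L\<^esub> z) = bracket L x y \<oplus>\<^bsub>L\<^esub> bracket L x z"
    and bracket_smult_left:
      "\<lbrakk>a \<in> carrier K; x \<in> carrier L; y \<in> carrier L\<rbrakk>
        \<Longrightarrow> bracket L (a \<odot>\<^bsub>L\<^esub> x) y = a \<odot>\<^bsub>L\<^esub> bracket L x y"
    and bracket_smult_right: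
      "\<lbrakk>a \<in> carrier K; x \<in> carrier L; y \<in> carrier L\<rbrakk>
        \<Longrightarrow> bracket L x (a \<odot>\<^bsub>L\<^esub> y) = a \<odot>\<^bsub>L\<^esub> bracket L x y"
    and bracket_self:
      "x \<in> carrier L \<Longrightarrow> bracket L x x = \<zero>\<^bsub>L\<^esub>"
    and jacobi:
      "\<lbrakk>x \<in> carrier L; y \<in> carrier L; z \<in> carrier L\<rbrakk>
        \<Longrightarrow> bracket L x (bracket L y z) \<oplus>\<^bsub>L\<^esub> bracket L y (bracket L z x)
              \<oplus>\<^bsub>L\<^esub> bracket L z (bracket L x y) = \<zero>\<^bsub>L\<^esub>"

definition lie_ideal ::
    "('k, 'd) ring_scheme \<Rightarrow> ('k, 'g, 'e) lie_alg_scheme \<Rightarrow> 'g set \<Rightarrow> bool" where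
  "lie_ideal K L I \<longleftrightarrow>
     LinearCombinations.submodule K I L \<and> (\<forall>x\<in>carrier L. \<forall>y\<in>I. bracket L x y \<in> I)"

definition simple_lie_algebra ::
    "('k, 'd) ring_scheme \<Rightarrow> ('k, 'g, 'e) lie_alg_scheme \<Rightarrow> bool" where
  "simple_lie_algebra K L \<longleftrightarrow>
     lie_algebra K L \<and>
     (\<exists>x\<in>carrier L. \<exists>y\<in>carrier L. bracket L x y \<noteq> \<zero>\<^bsub>L\<^esub>) \<and>
     (\<forall>I. lie_ideal K L I \<longrightarrow> I = {\<zero>\<^bsub>L\<^esub>} \<or> I = carrier L)"

definition lie_hom ::
    "('k, 'd) ring_scheme \<Rightarrow> ('k, 'g, 'e) lie_alg_scheme \<Rightarrow> ('k, 'h, 'f) lie_alg_scheme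
      \<Rightarrow> ('g \<Rightarrow> 'h) set" where
  "lie_hom K L L' =
     {f \<in> LinearCombinations.module_hom K L L'.
        \<forall>x\<in>carrier L. \<forall>y\<in>carrier L. f (bracket L x y) = bracket L' (f x) (f y)}"

locale lie_module = lie_algebra K L + rep: vectorspace K V
  for K :: "('k, 'd) ring_scheme" and L :: "('k, 'g, 'e) lie_alg_scheme"
    and V :: "('k, 'v, 'f) module_scheme" +
  fixes \<rho> :: "'g \<Rightarrow> 'v \<Rightarrow> 'v"
  assumes rep_endo:
      "x \<in> carrier L \<Longrightarrow> \<rho> x \<in> LinearCombinations.module_hom K V V"
    and rep_add:
      "\<lbrakk>x \<in> carrier L; y \<in> carrier L; v \<in> carrier V\<rbrakk>
        \<Longrightarrow> \<rho> (x \<oplus>\<^bsub>L\<^esub> y) v = \<rho> x v \<oplus>\<^bsub>V\<^esub> \<rho> y v"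
    and rep_smult:
      "\<lbrakk>a \<in> carrier K; x \<in> carrier L; v \<in> carrier V\<rbrakk>
        \<Longrightarrow> \<rho> (a \<odot>\<^bsub>L\<^esub> x) v = a \<odot>\<^bsub>V\<^esub> \<rho> x v"
    and rep_bracket:
      "\<lbrakk>x \<in> carrier L; y \<in> carrier L; v \<in> carrier V\<rbrakk>
        \<Longrightarrow> \<rho> (bracket L x y) v = \<rho> x (\<rho> y v) \<ominus>\<^bsub>V\<^esub> \<rho> y (\<rho> x v)"

definition simple_lie_module ::
    "('k, 'd) ring_scheme \<Rightarrow> ('k, 'g, 'e) lie_alg_scheme \<Rightarrow> ('k, 'v, 'f) module_scheme
      \<Rightarrow> ('g \<Rightarrow> 'v \<Rightarrow> 'v) \<Rightarrow> bool" where
  "simple_lie_module K L V \<rho> \<longleftrightarrow>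
     lie_module K L V \<rho> \<and>
     carrier V \<noteq> {\<zero>\<^bsub>V\<^esub>} \<and>
     (\<forall>U. LinearCombinations.submodule K U V \<and> (\<forall>x\<in>carrier L. \<rho> x ` U \<subseteq> U)
        \<longrightarrow> U = {\<zero>\<^bsub>V\<^esub>} \<or> U = carrier V)"

section \<open>Reduced algebras of finite type\<close>

definition finite_type_algebra ::
    "('k, 'd) ring_scheme \<Rightarrow> ('k, 's, 'e) module_scheme \<Rightarrow> bool" where
  "finite_type_algebra K S \<longleftrightarrow>
     (\<exists>A. finite A \<and> A \<subseteq> carrier S \<and>
        (\<forall>B. subring B S \<and> LinearCombinations.submodule K B S \<and> A \<subseteq> B \<longrightarrow> B = carrier S))"

definition reduced_ring :: "('s, 'e) ring_scheme \<Rightarrow> bool" where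
  "reduced_ring S \<longleftrightarrow>
     (\<forall>s\<in>carrier S. \<forall>n::nat. s [^]\<^bsub>S\<^esub> n = \<zero>\<^bsub>S\<^esub> \<longrightarrow> s = \<zero>\<^bsub>S\<^esub>)"

section \<open>Tensor products\<close>

text \<open>A tensor product is the quotient of the free module on the tuples of vectors by the
  span of the multilinearity relations, so its elements are cosets of finitely supported
  coefficient functions.\<close>

definition free_module :: "('k, 'd) ring_scheme \<Rightarrow> 'x set \<Rightarrow> ('k, 'x \<Rightarrow> 'k) module" where
  "free_module K Z =
     \<lparr>carrier = {f. f \<in> Z \<rightarrow> carrier K \<and> (\<forall>x. x \<notin> Z \<longrightarrow> f x = \<zero>\<^bsub>K\<^esub>) \<and> finite {x. f x \<noteq> \<zero>\<^bsub>K\<^esub>}},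
      monoid.mult = undefined, one = undefined,
      zero = (\<lambda>x. \<zero>\<^bsub>K\<^esub>),
      add = (\<lambda>f h x. f x \<oplus>\<^bsub>K\<^esub> h x),
      smult = (\<lambda>a f x. a \<otimes>\<^bsub>K\<^esub> f x)\<rparr>"

definition free_gen :: "('k, 'd) ring_scheme \<Rightarrow> 'x \<Rightarrow> 'x \<Rightarrow> 'k" where
  "free_gen K x = (\<lambda>y. if y = x then \<one>\<^bsub>K\<^esub> else \<zero>\<^bsub>K\<^esub>)"

definition quotient_module :: "('k, 'm, 'e) module_scheme \<Rightarrow> 'm set \<Rightarrow> ('k, 'm set) module" where
  "quotient_module M N =
     \<lparr>carrier = a_rcosets\<^bsub>M\<^esub> N,
      monoid.mult = undefined, one = undefined,
      zero = N,
      add = (\<lambda>A B. A <+>\<^bsub>M\<^esub> B),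
      smult = (\<lambda>a A. \<Union>x\<in>A. N +>\<^bsub>M\<^esub> (a \<odot>\<^bsub>M\<^esub> x))\<rparr>"

text \<open>The linear map to \<open>P\<close> that a map \<open>\<beta>\<close> on generators induces on a quotient of a free module.
  It is meaningful only if the linear extension of \<open>\<beta>\<close> kills the relations.\<close>

definition induced_map ::
    "('k, 'd) ring_scheme \<Rightarrow> ('k, 'p, 'e) module_scheme \<Rightarrow> ('x \<Rightarrow> 'p) \<Rightarrow> ('x \<Rightarrow> 'k) set \<Rightarrow> 'p" where
  "induced_map K P \<beta> z =
     the_elem ((\<lambda>f. \<Oplus>\<^bsub>P\<^esub>x\<in>{x. f x \<noteq> \<zero>\<^bsub>K\<^esub>}. f x \<odot>\<^bsub>P\<^esub> \<beta> x) ` z)"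

subsection \<open>Two factors\<close>

definition tensor_relations ::
    "('k, 'd) ring_scheme \<Rightarrow> ('k, 'm, 'e) module_scheme \<Rightarrow> ('k, 'n, 'f) module_scheme
      \<Rightarrow> ('m \<times> 'n \<Rightarrow> 'k) set" where
  "tensor_relations K M N =
     (let F = free_module K (carrier M \<times> carrier N); e = free_gen K in
       LinearCombinations.module.span K F
        ({e (x \<oplus>\<^bsub>M\<^esub> x', y) \<ominus>\<^bsub>F\<^esub> (e (x, y) \<oplus>\<^bsub>F\<^esub> e (x', y)) | x x' y.
            x \<in> carrier M \<and> x' \<in> carrier M \<and> y \<in> carrier N} \<union>
         {e (x, y \<oplus>\<^bsub>N\<^esub> y') \<ominus>\<^bsub>F\<^esub> (e (x, y) \<oplus>\<^bsub>F\<^esub> e (x, y')) | x y y'.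
            x \<in> carrier M \<and> y \<in> carrier N \<and> y' \<in> carrier N} \<union>
         {e (a \<odot>\<^bsub>M\<^esub> x, y) \<ominus>\<^bsub>F\<^esub> a \<odot>\<^bsub>F\<^esub> e (x, y) | a x y.
            a \<in> carrier K \<and> x \<in> carrier M \<and> y \<in> carrier N} \<union>
         {e (x, a \<odot>\<^bsub>N\<^esub> y) \<ominus>\<^bsub>F\<^esub> a \<odot>\<^bsub>F\<^esub> e (x, y) | a x y.
            a \<in> carrier K \<and> x \<in> carrier M \<and> y \<in> carrier N}))"

definition tensor ::
    "('k, 'd) ring_scheme \<Rightarrow> ('k, 'm, 'e) module_scheme \<Rightarrow> ('k, 'n, 'f) module_scheme
      \<Rightarrow> ('k, ('m \<times> 'n \<Rightarrow> 'k) set) module" where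
  "tensor K M N =
     quotient_module (free_module K (carrier M \<times> carrier N)) (tensor_relations K M N)"

definition pure_tensor ::
    "('k, 'd) ring_scheme \<Rightarrow> ('k, 'm, 'e) module_scheme \<Rightarrow> ('k, 'n, 'f) module_scheme
      \<Rightarrow> 'm \<Rightarrow> 'n \<Rightarrow> ('m \<times> 'n \<Rightarrow> 'k) set" where
  "pure_tensor K M N x y =
     tensor_relations K M N +>\<^bsub>free_module K (carrier M \<times> carrier N)\<^esub> free_gen K (x, y)"

subsection \<open>Finite families of factors\<close>

definition multi_tensor_relations ::
    "('k, 'd) ring_scheme \<Rightarrow> 'i set \<Rightarrow> ('i \<Rightarrow> ('k, 'v, 'e) module_scheme)
      \<Rightarrow> (('i \<Rightarrow> 'v) \<Rightarrow> 'k) set" where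
  "multi_tensor_relations K I V =
     (let Z = (\<Pi>\<^sub>E i\<in>I. carrier (V i)); F = free_module K Z; e = free_gen K in
       LinearCombinations.module.span K F
        ({e (t(i := x \<oplus>\<^bsub>V i\<^esub> y)) \<ominus>\<^bsub>F\<^esub> (e (t(i := x)) \<oplus>\<^bsub>F\<^esub> e (t(i := y))) | t i x y.
            t \<in> Z \<and> i \<in> I \<and> x \<in> carrier (V i) \<and> y \<in> carrier (V i)} \<union>
         {e (t(i := a \<odot>\<^bsub>V i\<^esub> x)) \<ominus>\<^bsub>F\<^esub> a \<odot>\<^bsub>F\<^esub> e (t(i := x)) | t i a x.
            t \<in> Z \<and> i \<in> I \<and> a \<in> carrier K \<and> x \<in> carrier (V i)}))"

definition multi_tensor ::
    "('k, 'd) ring_scheme \<Rightarrow> 'i set \<Rightarrow> ('i \<Rightarrow> ('k, 'v, 'e) module_scheme)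
      \<Rightarrow> ('k, (('i \<Rightarrow> 'v) \<Rightarrow> 'k) set) module" where
  "multi_tensor K I V =
     quotient_module (free_module K (\<Pi>\<^sub>E i\<in>I. carrier (V i))) (multi_tensor_relations K I V)"

definition pure_multi_tensor ::
    "('k, 'd) ring_scheme \<Rightarrow> 'i set \<Rightarrow> ('i \<Rightarrow> ('k, 'v, 'e) module_scheme)
      \<Rightarrow> ('i \<Rightarrow> 'v) \<Rightarrow> (('i \<Rightarrow> 'v) \<Rightarrow> 'k) set" where
  "pure_multi_tensor K I V t =
     multi_tensor_relations K I V +>\<^bsub>free_module K (\<Pi>\<^sub>E i\<in>I. carrier (V i))\<^esub> free_gen K t"

text \<open>The tensor product of Lie algebra representations:
  an element \<open>z\<close> acts by the sum over \<open>i\<close> of the operators \<open>id \<otimes> \<dots> \<otimes> \<rho>\<^sub>i(z) \<otimes> \<dots> \<otimes> id\<close>.\<close>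

definition multi_tensor_rep ::
    "('k, 'd) ring_scheme \<Rightarrow> 'i set \<Rightarrow> ('i \<Rightarrow> ('k, 'v, 'e) module_scheme)
      \<Rightarrow> ('i \<Rightarrow> 'z \<Rightarrow> 'v \<Rightarrow> 'v)
      \<Rightarrow> 'z \<Rightarrow> (('i \<Rightarrow> 'v) \<Rightarrow> 'k) set \<Rightarrow> (('i \<Rightarrow> 'v) \<Rightarrow> 'k) set" where
  "multi_tensor_rep K I V \<rho> z =
     induced_map K (multi_tensor K I V)
       (\<lambda>t. \<Oplus>\<^bsub>multi_tensor K I V\<^esub>i\<in>I. pure_multi_tensor K I V (t(i := \<rho> i z (t i))))"

section \<open>Equivariant current algebras\<close>

definition current_algebra ::
    "('k, 'd) ring_scheme \<Rightarrow> ('k, 'g, 'e) lie_alg_scheme \<Rightarrow> ('k, 's, 'f) module_scheme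
      \<Rightarrow> ('k, ('g \<times> 's \<Rightarrow> 'k) set) lie_alg" where
  "current_algebra K g S =
     (let T = tensor K g S in
       \<lparr>carrier = carrier T, monoid.mult = undefined, one = undefined, zero = zero T, add = add T,
        smult = smult T,
        bracket = (\<lambda>z w.
          induced_map K T (\<lambda>(x, r).
            induced_map K T (\<lambda>(y, s).
              pure_tensor K g S (bracket g x y) (r \<otimes>\<^bsub>S\<^esub> s)) w) z)\<rparr>)"

definition equivariant_algebra ::
    "('k, 'd) ring_scheme \<Rightarrow> ('k, 'g, 'e) lie_alg_scheme \<Rightarrow> ('k, 's, 'f) module_scheme
      \<Rightarrow> ('c, 'h) monoid_scheme \<Rightarrow> ('c \<Rightarrow> ('g \<times> 's \<Rightarrow> 'k) set \<Rightarrow> ('g \<times> 's \<Rightarrow> 'k) set)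
      \<Rightarrow> ('k, ('g \<times> 's \<Rightarrow> 'k) set) lie_alg" where
  "equivariant_algebra K g S \<Gamma> act =
     (current_algebra K g S)
       \<lparr>carrier := {z \<in> carrier (current_algebra K g S). \<forall>\<gamma>\<in>carrier \<Gamma>. act \<gamma> z = z}\<rparr>"

text \<open>\<open>s(M)\<close>: the scalar in the residue class of \<open>s\<close>, via the isomorphism \<open>k \<rightarrow> S/M\<close>.\<close>

definition residue_at ::
    "('k, 'd) ring_scheme \<Rightarrow> ('k, 's, 'f) module_scheme \<Rightarrow> 's set \<Rightarrow> 's \<Rightarrow> 'k" where
  "residue_at K S M s =
     (THE c. c \<in> carrier K \<and> M +>\<^bsub>S\<^esub> s = M +>\<^bsub>S\<^esub> (c \<odot>\<^bsub>S\<^esub> \<one>\<^bsub>S\<^esub>))"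

definition eval_at ::
    "('k, 'd) ring_scheme \<Rightarrow> ('k, 'g, 'e) lie_alg_scheme \<Rightarrow> ('k, 's, 'f) module_scheme
      \<Rightarrow> 's set \<Rightarrow> ('g \<times> 's \<Rightarrow> 'k) set \<Rightarrow> 'g" where
  "eval_at K g S M = induced_map K g (\<lambda>(x, s). residue_at K S M s \<odot>\<^bsub>g\<^esub> x)"

text \<open>\<open>g \<otimes> I\<close> as a subspace of \<open>g \<otimes> S\<close>.\<close>

definition tensor_ideal ::
    "('k, 'd) ring_scheme \<Rightarrow> ('k, 'g, 'e) lie_alg_scheme \<Rightarrow> ('k, 's, 'f) module_scheme
      \<Rightarrow> 's set \<Rightarrow> ('g \<times> 's \<Rightarrow> 'k) set set" where
  "tensor_ideal K g S I =
     LinearCombinations.module.span K (tensor K g S)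
       {pure_tensor K g S x s | x s. x \<in> carrier g \<and> s \<in> I}"

text \<open>The action on maximal ideals is determined by \<open>\<gamma>(g \<otimes> M) = g \<otimes> \<gamma>M\<close>.\<close>

definition max_action ::
    "('k, 'd) ring_scheme \<Rightarrow> ('k, 'g, 'e) lie_alg_scheme \<Rightarrow> ('k, 's, 'f) module_scheme
      \<Rightarrow> ('c \<Rightarrow> ('g \<times> 's \<Rightarrow> 'k) set \<Rightarrow> ('g \<times> 's \<Rightarrow> 'k) set) \<Rightarrow> 'c \<Rightarrow> 's set \<Rightarrow> 's set" where
  "max_action K g S act \<gamma> M =
     (THE N. maximalideal N S \<and> act \<gamma> ` tensor_ideal K g S M = tensor_ideal K g S N)"

definition twist_at ::
    "('k, 'd) ring_scheme \<Rightarrow> ('k, 'g, 'e) lie_alg_scheme \<Rightarrow> ('k, 's, 'f) module_scheme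
      \<Rightarrow> ('c \<Rightarrow> ('g \<times> 's \<Rightarrow> 'k) set \<Rightarrow> ('g \<times> 's \<Rightarrow> 'k) set) \<Rightarrow> 'c \<Rightarrow> 's set \<Rightarrow> 'g \<Rightarrow> 'g" where
  "twist_at K g S act \<gamma> M x = eval_at K g S M (act \<gamma> (pure_tensor K g S x \<one>\<^bsub>S\<^esub>))"

definition fixed_algebra_at ::
    "('k, 'd) ring_scheme \<Rightarrow> ('k, 'g) lie_alg \<Rightarrow> ('k, 's, 'f) module_scheme
      \<Rightarrow> ('c, 'h) monoid_scheme \<Rightarrow> ('c \<Rightarrow> ('g \<times> 's \<Rightarrow> 'k) set \<Rightarrow> ('g \<times> 's \<Rightarrow> 'k) set)
      \<Rightarrow> 's set \<Rightarrow> ('k, 'g) lie_alg" where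
  "fixed_algebra_at K g S \<Gamma> act M =
     g\<lparr>carrier := {x \<in> carrier g.
         \<forall>\<gamma>\<in>stabilizer \<Gamma> (max_action K g S act) M. twist_at K g S act \<gamma> M x = x}\<rparr>"

end

theory Submission
  imports Defs
begin

text \<open>
Let \<open>L\<close> be the algebra of \<open>\<Gamma>\<close>-invariants. The \<open>L\<close>-invariant subspaces of the tensor product are
controlled by two facts, one about \<open>L\<close> and one about tensor products of vector spaces.

The first is interpolation (\<open>invariant_interpolation\<close>): for a point \<open>M\<^sub>i\<close> and a vector \<open>x\<close> in the
fixed algebra at \<open>M\<^sub>i\<close> there is an element of \<open>L\<close> with value \<open>x\<close> at \<open>M\<^sub>i\<close> and value zero at the other
points. It is a multiple of the average \<open>\<Sum>\<^sub>\<gamma> \<gamma>(x \<otimes> s)\<close>, where the function \<open>s\<close> vanishes at all points of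
the orbits involved except \<open>M\<^sub>i\<close>. At \<open>M\<^sub>i\<close> only the \<open>\<gamma>\<close> in the stabilizer contribute, and each contributes
the same multiple of \<open>x\<close>; the number of these \<open>\<gamma>\<close> is invertible because the characteristic is zero.
That this makes sense needs two things. By Zariski's lemma (\<open>residue_field_is_ground_field\<close>) the residue
field at a maximal ideal is the ground field \<open>K\<close>, so that evaluation at a point is defined. And a Lie
automorphism of \<open>g \<otimes> S\<close> carries each \<open>g \<otimes> M\<close> to some \<open>g \<otimes> N\<close>, so that \<open>\<Gamma>\<close> acts on the points:
an evaluation composed with an automorphism is again an evaluation followed by a linear bijection of \<open>g\<close>,
since \<open>g\<close> is simple (\<open>pulled_character\<close>, \<open>pullback_of_kernel\<close>).

Such an element acts on the tensor product by the operator of \<open>x\<close> on \<open>V\<^sub>i\<close> plus a scalar, which is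
its action on the one-dimensional factor \<open>W\<close>. Hence an invariant subspace \<open>U\<close> is stable under the operators of
each fixed algebra acting in a single tensor factor.

The second fact (\<open>irreducible_tensor\<close>) says that a subspace \<open>U\<close> of a tensor product is zero or
everything if, for each factor, the operators on this factor alone that preserve \<open>U\<close> act irreducibly
on it. The operators on \<open>V\<^sub>i\<close> that preserve \<open>U\<close> form an algebra, and by the density theorem
(\<open>annihilator_separates\<close>) it contains all operators of rank one. With these one moves from a nonzero
element of \<open>U\<close> to a tensor of basis vectors and from there to every pure tensor.
\<close>

section \<open>Linear algebra over a field\<close>

abbreviation Hom ::
    "('k, 'd) ring_scheme \<Rightarrow> ('k, 'v, 'e) module_scheme \<Rightarrow> ('k, 'w, 'f) module_scheme \<Rightarrow> ('v \<Rightarrow> 'w) set" where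
  "Hom \<equiv> LinearCombinations.module_hom"

abbreviation submod ::
    "('k, 'd) ring_scheme \<Rightarrow> 'v set \<Rightarrow> ('k, 'v, 'e) module_scheme \<Rightarrow> bool" where
  "submod \<equiv> LinearCombinations.submodule"

abbreviation spn ::
    "('k, 'd) ring_scheme \<Rightarrow> ('k, 'v, 'e) module_scheme \<Rightarrow> 'v set \<Rightarrow> 'v set" where
  "spn \<equiv> LinearCombinations.module.span"

subsection \<open>Linear maps and subspaces\<close>

lemma vs_module: "vectorspace K V \<Longrightarrow> Module.module K V"
  by (simp add: vectorspace_def)

lemma homI:
  assumes "\<And>x. x \<in> carrier V \<Longrightarrow> f x \<in> carrier W"
    and "\<And>x y. \<lbrakk>x \<in> carrier V; y \<in> carrier V\<rbrakk> \<Longrightarrow> f (x \<oplus>\<^bsub>V\<^esub> y) = f x \<oplus>\<^bsub>W\<^esub> f y"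
    and "\<And>a x. \<lbrakk>a \<in> carrier K; x \<in> carrier V\<rbrakk> \<Longrightarrow> f (a \<odot>\<^bsub>V\<^esub> x) = a \<odot>\<^bsub>W\<^esub> f x"
  shows "f \<in> Hom K V W"
  using assms by (auto simp: LinearCombinations.module_hom_def)

lemma hom_closed: "\<lbrakk>f \<in> Hom K V W; x \<in> carrier V\<rbrakk> \<Longrightarrow> f x \<in> carrier W"
  by (auto simp: LinearCombinations.module_hom_def)

lemma hom_add:
  "\<lbrakk>f \<in> Hom K V W; x \<in> carrier V; y \<in> carrier V\<rbrakk> \<Longrightarrow> f (x \<oplus>\<^bsub>V\<^esub> y) = f x \<oplus>\<^bsub>W\<^esub> f y"
  by (auto simp: LinearCombinations.module_hom_def)

lemma hom_smult:
  "\<lbrakk>f \<in> Hom K V W; a \<in> carrier K; x \<in> carrier V\<rbrakk> \<Longrightarrow> f (a \<odot>\<^bsub>V\<^esub> x) = a \<odot>\<^bsub>W\<^esub> f x"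
  by (auto simp: LinearCombinations.module_hom_def)

lemma hom_zero:
  assumes "Module.module K V" "Module.module K W" "f \<in> Hom K V W"
  shows "f \<zero>\<^bsub>V\<^esub> = \<zero>\<^bsub>W\<^esub>"
proof -
  interpret V: Module.module K V by fact
  interpret W: Module.module K W by fact
  interpret mod_hom K V W f by unfold_locales fact
  show ?thesis by simp
qed

lemma hom_minus:
  assumes "Module.module K V" "Module.module K W" "f \<in> Hom K V W" "x \<in> carrier V" "y \<in> carrier V"
  shows "f (x \<ominus>\<^bsub>V\<^esub> y) = f x \<ominus>\<^bsub>W\<^esub> f y"
proof -
  interpret V: Module.module K V by fact
  interpret W: Module.module K W by fact
  interpret mod_hom K V W f by unfold_locales fact
  show ?thesis using assms by simp
qed

lemma hom_finsum:
  assumes "Module.module K V" "Module.module K W" "f \<in> Hom K V W"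
    and "\<And>i. i \<in> I \<Longrightarrow> h i \<in> carrier V"
  shows "f (\<Oplus>\<^bsub>V\<^esub>i\<in>I. h i) = (\<Oplus>\<^bsub>W\<^esub>i\<in>I. f (h i))"
proof -
  interpret V: Module.module K V by fact
  interpret W: Module.module K W by fact
  show ?thesis using assms(4)
  proof (induction I rule: infinite_finite_induct)
    case (infinite A)
    then show ?case by (simp add: hom_zero[OF assms(1-3)])
  next
    case empty
    then show ?case by (simp add: hom_zero[OF assms(1-3)])
  next
    case (insert x F)
    have "f (\<Oplus>\<^bsub>V\<^esub>i\<in>insert x F. h i) = f (h x \<oplus>\<^bsub>V\<^esub> (\<Oplus>\<^bsub>V\<^esub>i\<in>F. h i))"
      using insert by (subst V.finsum_insert) auto
    also have "\<dots> = f (h x) \<oplus>\<^bsub>W\<^esub> (\<Oplus>\<^bsub>W\<^esub>i\<in>F. f (h i))"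
      using insert by (subst hom_add[OF assms(3)]) auto
    also have "\<dots> = (\<Oplus>\<^bsub>W\<^esub>i\<in>insert x F. f (h i))"
      using insert by (subst W.finsum_insert) (auto intro!: hom_closed[OF assms(3)])
    finally show ?case .
  qed
qed

lemma hom_compose:
  assumes "f \<in> Hom K V W" "h \<in> Hom K U V"
  shows "(\<lambda>x. f (h x)) \<in> Hom K U W"
  using assms by (intro homI) (auto simp: hom_closed hom_add hom_smult)

lemma hom_plus:
  assumes "Module.module K W" "f \<in> Hom K V W" "h \<in> Hom K V W"
  shows "(\<lambda>x. f x \<oplus>\<^bsub>W\<^esub> h x) \<in> Hom K V W"
proof -
  interpret W: Module.module K W by fact
  show ?thesis
    by (intro homI)
       (auto simp: hom_closed[OF assms(2)] hom_closed[OF assms(3)] hom_add[OF assms(2)] hom_add[OF assms(3)]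
          hom_smult[OF assms(2)] hom_smult[OF assms(3)] W.smult_r_distr W.a_ac)
qed

lemma hom_scale:
  assumes "Module.module K W" "f \<in> Hom K V W" "a \<in> carrier K"
  shows "(\<lambda>x. a \<odot>\<^bsub>W\<^esub> f x) \<in> Hom K V W"
proof -
  interpret W: Module.module K W by fact
  show ?thesis using assms(3)
    by (intro homI)
       (auto simp: hom_closed[OF assms(2)] hom_add[OF assms(2)] W.R.m_comm
          hom_smult[OF assms(2)] W.smult_r_distr simp flip: W.smult_assoc1)
qed

definition regular_module :: "('k, 'd) ring_scheme \<Rightarrow> ('k, 'k) module" where
  "regular_module K =
     \<lparr>carrier = carrier K, monoid.mult = monoid.mult K, one = one K, zero = zero K, add = add K,
      smult = monoid.mult K\<rparr>"

lemma regular_module_simps [simp]: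
  "carrier (regular_module K) = carrier K" "zero (regular_module K) = zero K"
  "add (regular_module K) = add K" "smult (regular_module K) = monoid.mult K"
  by (simp_all add: regular_module_def)

lemma module_regular_module:
  assumes "cring K"
  shows "Module.module K (regular_module K)"
proof -
  interpret K: cring K by fact
  show ?thesis
    by (rule module_criteria)
       (auto simp: K.a_ac K.m_assoc K.l_distr K.r_distr K.cring_axioms intro: K.r_neg)
qed

lemma hom_rank_one:
  assumes "Module.module K W" "f \<in> Hom K V (regular_module K)" "w \<in> carrier W"
  shows "(\<lambda>v. f v \<odot>\<^bsub>W\<^esub> w) \<in> Hom K V W"
proof -
  interpret W: Module.module K W by fact
  have f: "f v \<in> carrier K" if "v \<in> carrier V" for v using hom_closed[OF assms(2) that] by simp
  show ?thesis
    using assms(3) by (intro homI)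
      (auto simp: f hom_add[OF assms(2)] hom_smult[OF assms(2)] W.smult_l_distr W.smult_assoc1)
qed

lemma hom_id: "(\<lambda>x. x) \<in> Hom K V V"
  by (intro homI) auto

lemma hom_zero_map:
  assumes "Module.module K W"
  shows "(\<lambda>x. \<zero>\<^bsub>W\<^esub>) \<in> Hom K V W"
proof -
  interpret W: Module.module K W by fact
  show ?thesis by (intro homI) auto
qed

lemma hom_cong:
  assumes "Module.module K V" "f \<in> Hom K V W" "\<And>x. x \<in> carrier V \<Longrightarrow> h x = f x"
  shows "h \<in> Hom K V W"
proof -
  interpret V: Module.module K V by fact
  show ?thesis using assms(3) by (intro homI) (auto simp: hom_closed[OF assms(2)] hom_add[OF assms(2)] hom_smult[OF assms(2)])
qed

lemma hom_finsum_map: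
  assumes "Module.module K V" "Module.module K W" "\<And>i. i \<in> I \<Longrightarrow> f i \<in> Hom K V W"
  shows "(\<lambda>x. \<Oplus>\<^bsub>W\<^esub>i\<in>I. f i x) \<in> Hom K V W"
proof -
  interpret W: Module.module K W by fact
  show ?thesis using assms(3)
  proof (induction I rule: infinite_finite_induct)
    case (insert x F)
    have "(\<lambda>v. f x v \<oplus>\<^bsub>W\<^esub> (\<Oplus>\<^bsub>W\<^esub>i\<in>F. f i v)) \<in> Hom K V W"
      using insert by (intro hom_plus assms(2)) auto
    moreover have "(\<Oplus>\<^bsub>W\<^esub>i\<in>insert x F. f i v) = f x v \<oplus>\<^bsub>W\<^esub> (\<Oplus>\<^bsub>W\<^esub>i\<in>F. f i v)" if "v \<in> carrier V" for v
      using insert.hyps that by (subst W.finsum_insert) (auto simp: Pi_iff intro: hom_closed[OF insert.prems])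
    ultimately show ?case by (rule hom_cong[OF assms(1)])
  qed (auto intro: hom_zero_map assms)
qed

lemma submodI:
  assumes "Module.module K V" "U \<subseteq> carrier V" "\<zero>\<^bsub>V\<^esub> \<in> U"
    and "\<And>x y. \<lbrakk>x \<in> U; y \<in> U\<rbrakk> \<Longrightarrow> x \<oplus>\<^bsub>V\<^esub> y \<in> U"
    and "\<And>a x. \<lbrakk>a \<in> carrier K; x \<in> U\<rbrakk> \<Longrightarrow> a \<odot>\<^bsub>V\<^esub> x \<in> U"
  shows "submod K U V"
  using assms by (auto simp: LinearCombinations.submodule_def)

lemma submodD:
  assumes "submod K U V"
  shows submod_carrier: "x \<in> U \<Longrightarrow> x \<in> carrier V"
    and submod_zero: "\<zero>\<^bsub>V\<^esub> \<in> U"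
    and submod_add: "\<lbrakk>x \<in> U; y \<in> U\<rbrakk> \<Longrightarrow> x \<oplus>\<^bsub>V\<^esub> y \<in> U"
    and submod_smult: "\<lbrakk>a \<in> carrier K; x \<in> U\<rbrakk> \<Longrightarrow> a \<odot>\<^bsub>V\<^esub> x \<in> U"
    and submod_module: "Module.module K V"
  using assms by (auto simp: LinearCombinations.submodule_def)

lemma submod_self: "Module.module K V \<Longrightarrow> submod K (carrier V) V"
  by (auto intro!: submodI simp: Module.module.smult_closed
      abelian_monoid.a_closed abelian_monoid.zero_closed abelian_group.axioms Module.module.axioms)

lemma submod_uminus:
  assumes "submod K U V" "x \<in> U"
  shows "\<ominus>\<^bsub>V\<^esub> x \<in> U"
proof -
  interpret V: Module.module K V by (rule submod_module[OF assms(1)])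
  have "\<ominus>\<^bsub>V\<^esub> x = (\<ominus>\<^bsub>K\<^esub> \<one>\<^bsub>K\<^esub>) \<odot>\<^bsub>V\<^esub> x"
    using submod_carrier[OF assms] by (simp add: V.smult_l_minus)
  then show ?thesis using submod_smult[OF assms(1) _ assms(2)] by simp
qed

lemma submod_minus:
  assumes "submod K U V" "x \<in> U" "y \<in> U"
  shows "x \<ominus>\<^bsub>V\<^esub> y \<in> U"
  using submod_add[OF assms(1,2) submod_uminus[OF assms(1,3)]] by (simp add: a_minus_def)

lemma submod_finsum:
  assumes "submod K U V" "\<And>i. i \<in> I \<Longrightarrow> f i \<in> U"
  shows "(\<Oplus>\<^bsub>V\<^esub>i\<in>I. f i) \<in> U"
proof -
  interpret V: Module.module K V by (rule submod_module[OF assms(1)])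
  show ?thesis using assms(2)
    by (induction I rule: infinite_finite_induct)
       (auto simp: submod_zero[OF assms(1)] submod_add[OF assms(1)] submod_carrier[OF assms(1)] Pi_def)
qed

lemma submod_equalizer:
  assumes "Module.module K V" "Module.module K W" "f \<in> Hom K V W" "h \<in> Hom K V W"
  shows "submod K {x \<in> carrier V. f x = h x} V"
proof -
  interpret V: Module.module K V by fact
  show ?thesis
    by (rule submodI) (auto simp: assms hom_zero[OF assms(1,2)] hom_add[OF assms(3)] hom_add[OF assms(4)]
        hom_smult[OF assms(3)] hom_smult[OF assms(4)])
qed

lemma submod_kernel:
  assumes "Module.module K V" "Module.module K W" "f \<in> Hom K V W"
  shows "submod K {x \<in> carrier V. f x = \<zero>\<^bsub>W\<^esub>} V"
  using submod_equalizer[OF assms hom_zero_map[OF assms(2)]] .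

lemma submod_vimage:
  assumes "Module.module K V" "f \<in> Hom K V W" "submod K U W"
  shows "submod K {x \<in> carrier V. f x \<in> U} V"
proof -
  interpret V: Module.module K V by fact
  show ?thesis
    using assms by (intro submodI)
      (auto simp: hom_zero[OF assms(1) submod_module[OF assms(3)]] hom_add hom_smult submod_zero
       submod_add submod_smult)
qed

lemma submod_image:
  assumes "Module.module K V" "Module.module K W" "f \<in> Hom K V W" "submod K U V"
  shows "submod K (f ` U) W"
proof (rule submodI)
  show "f ` U \<subseteq> carrier W" using assms by (auto simp: hom_closed submod_carrier)
  show "\<zero>\<^bsub>W\<^esub> \<in> f ` U"
    using hom_zero[OF assms(1-3)] submod_zero[OF assms(4)] by (metis imageI)
  show "x \<oplus>\<^bsub>W\<^esub> y \<in> f ` U" if xy: "x \<in> f ` U" "y \<in> f ` U" for x y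
  proof -
    from xy obtain u v where uv: "u \<in> U" "v \<in> U" "x = f u" "y = f v" by auto
    then have "x \<oplus>\<^bsub>W\<^esub> y = f (u \<oplus>\<^bsub>V\<^esub> v)"
      by (simp add: hom_add[OF assms(3)] submod_carrier[OF assms(4)])
    then show ?thesis using uv submod_add[OF assms(4)] by auto
  qed
  show "a \<odot>\<^bsub>W\<^esub> x \<in> f ` U" if ax: "a \<in> carrier K" "x \<in> f ` U" for a x
  proof -
    from ax obtain u where u: "u \<in> U" "x = f u" by auto
    then have "a \<odot>\<^bsub>W\<^esub> x = f (a \<odot>\<^bsub>V\<^esub> u)"
      using ax by (simp add: hom_smult[OF assms(3)] submod_carrier[OF assms(4)])
    then show ?thesis using u ax submod_smult[OF assms(4)] by auto
  qed
qed fact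

text \<open>The rearrangement in the step of Horner's scheme; the term \<open>y\<close> is added and subtracted.\<close>

lemma (in abelian_group) regroup:
  assumes "a \<in> carrier G" "t \<in> carrier G" "u \<in> carrier G" "c \<in> carrier G" "y \<in> carrier G"
  shows "a \<oplus> (t \<ominus> u \<oplus> c) = c \<oplus> t \<ominus> (y \<oplus> u) \<oplus> (a \<oplus> y)"
proof -
  have "c \<oplus> t \<ominus> (y \<oplus> u) \<oplus> (a \<oplus> y) = (a \<oplus> (t \<ominus> u \<oplus> c)) \<oplus> (y \<oplus> \<ominus> y)"
    unfolding minus_eq using assms by (simp add: minus_add a_ac)
  also have "\<dots> = a \<oplus> (t \<ominus> u \<oplus> c)" using assms by (simp add: r_neg)
  finally show ?thesis by simp
qed

lemma span_least:
  assumes "submod K U V" "Y \<subseteq> U"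
  shows "spn K V Y \<subseteq> U"
  using module.span_is_subset[OF submod_module[OF assms(1)] assms(2,1)] .

lemma span_submod:
  assumes "Module.module K V" "Y \<subseteq> carrier V"
  shows "submod K (spn K V Y) V"
  using module.span_is_submodule[OF assms] .

lemma span_superset:
  assumes "Module.module K V" "Y \<subseteq> carrier V"
  shows "Y \<subseteq> spn K V Y"
  using module.in_own_span[OF assms] .

subsection \<open>Finite-dimensional spaces\<close>

lemma linear_dual_closed:
  "\<lbrakk>f \<in> Hom K V (regular_module K); v \<in> carrier V\<rbrakk> \<Longrightarrow> f v \<in> carrier K"
  using hom_closed by fastforce

text \<open>The functional \<open>c b\<close> is the coordinate at the basis vector \<open>b\<close>.\<close>

definition dual_basis ::
    "('k, 'd) ring_scheme \<Rightarrow> ('k, 'v, 'e) module_scheme \<Rightarrow> 'v set \<Rightarrow> ('v \<Rightarrow> 'v \<Rightarrow> 'k) \<Rightarrow> bool" where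
  "dual_basis K V B c \<longleftrightarrow>
     finite B \<and> B \<subseteq> carrier V \<and> (\<forall>b\<in>B. c b \<in> Hom K V (regular_module K)) \<and>
     (\<forall>b\<in>B. \<forall>b'\<in>B. c b b' = (if b = b' then \<one>\<^bsub>K\<^esub> else \<zero>\<^bsub>K\<^esub>)) \<and>
     (\<forall>v\<in>carrier V. v = (\<Oplus>\<^bsub>V\<^esub>b\<in>B. c b v \<odot>\<^bsub>V\<^esub> b))"

lemma dual_basisD:
  assumes "dual_basis K V B c"
  shows dual_basis_finite: "finite B"
    and dual_basis_closed: "b \<in> B \<Longrightarrow> b \<in> carrier V"
    and dual_basis_Hom: "b \<in> B \<Longrightarrow> c b \<in> Hom K V (regular_module K)"
    and dual_basis_dual: "\<lbrakk>b \<in> B; b' \<in> B\<rbrakk> \<Longrightarrow> c b b' = (if b = b' then \<one>\<^bsub>K\<^esub> else \<zero>\<^bsub>K\<^esub>)"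
    and dual_basis_expand: "v \<in> carrier V \<Longrightarrow> v = (\<Oplus>\<^bsub>V\<^esub>b\<in>B. c b v \<odot>\<^bsub>V\<^esub> b)"
  using assms unfolding dual_basis_def by blast+

lemma dual_basis_coeff:
  assumes "dual_basis K V B c" "b \<in> B" "v \<in> carrier V"
  shows "c b v \<in> carrier K"
  by (rule linear_dual_closed[OF dual_basis_Hom[OF assms(1,2)] assms(3)])

lemma dual_basis_exists:
  assumes "vectorspace K V" "vectorspace.fin_dim K V"
  shows "\<exists>B c. dual_basis K V B c"
proof -
  interpret V: vectorspace K V by fact
  obtain B where B: "finite B" "V.basis B" using V.finite_basis_exists assms(2) by blast
  have BV: "B \<subseteq> carrier V" using B by (simp add: V.basis_def)
  have ex1: "\<exists>!a. a \<in> B \<rightarrow>\<^sub>E carrier K \<and> V.lincomb a B = v" if "v \<in> carrier V" for v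
    using V.basis_criterion[OF B(1) BV] B(2) that by blast
  define a where "a v = (THE a. a \<in> B \<rightarrow>\<^sub>E carrier K \<and> V.lincomb a B = v)" for v
  have a: "a v \<in> B \<rightarrow>\<^sub>E carrier K" "V.lincomb (a v) B = v" if "v \<in> carrier V" for v
    using theI'[OF ex1[OF that]] unfolding a_def by auto
  have a_unique: "h b = a v b" if "v \<in> carrier V" "h \<in> B \<rightarrow> carrier K" "V.lincomb h B = v" "b \<in> B" for h v b
  proof -
    have "V.lincomb (restrict h B) B = V.lincomb h B"
      using that BV by (intro V.lincomb_cong) auto
    then have "a v = restrict h B"
      unfolding a_def using that by (intro the1_equality[OF ex1[OF that(1)]]) auto
    then show ?thesis using that(4) by simp
  qed
  have aK: "a v b \<in> carrier K" if "v \<in> carrier V" "b \<in> B" for v b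
    using a(1)[OF that(1)] that(2) by auto
  define c where "c b v = a v b" for b v
  show ?thesis
    unfolding dual_basis_def
  proof (intro exI[of _ B] exI[of _ c] conjI ballI)
    show "finite B" "B \<subseteq> carrier V" by fact+
    show "c b \<in> Hom K V (regular_module K)" if b: "b \<in> B" for b
    proof (rule homI)
      show "c b x \<in> carrier (regular_module K)" if "x \<in> carrier V" for x
        using aK that b by (simp add: c_def)
      show "c b (x \<oplus>\<^bsub>V\<^esub> y) = c b x \<oplus>\<^bsub>regular_module K\<^esub> c b y"
        if xy: "x \<in> carrier V" "y \<in> carrier V" for x y
      proof -
        have "V.lincomb (\<lambda>b. a x b \<oplus>\<^bsub>K\<^esub> a y b) B = V.lincomb (a x) B \<oplus>\<^bsub>V\<^esub> V.lincomb (a y) B"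
          using a(1)[OF xy(1)] a(1)[OF xy(2)] by (intro V.lincomb_sum B BV) (auto simp: PiE_iff)
        then have "V.lincomb (\<lambda>b. a x b \<oplus>\<^bsub>K\<^esub> a y b) B = x \<oplus>\<^bsub>V\<^esub> y"
          using a(2) xy by simp
        then have "a x b \<oplus>\<^bsub>K\<^esub> a y b = a (x \<oplus>\<^bsub>V\<^esub> y) b"
          using xy aK by (intro a_unique b) auto
        then show ?thesis by (simp add: c_def)
      qed
      show "c b (r \<odot>\<^bsub>V\<^esub> x) = r \<odot>\<^bsub>regular_module K\<^esub> c b x" if xr: "r \<in> carrier K" "x \<in> carrier V" for r x
      proof -
        have "V.lincomb (\<lambda>b. r \<otimes>\<^bsub>K\<^esub> a x b) B = r \<odot>\<^bsub>V\<^esub> V.lincomb (a x) B"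
          using a(1)[OF xr(2)] by (intro V.lincomb_smult B BV xr) (auto simp: PiE_iff)
        then have "V.lincomb (\<lambda>b. r \<otimes>\<^bsub>K\<^esub> a x b) B = r \<odot>\<^bsub>V\<^esub> x"
          using a(2) xr by simp
        then have "r \<otimes>\<^bsub>K\<^esub> a x b = a (r \<odot>\<^bsub>V\<^esub> x) b"
          using xr aK by (intro a_unique b) auto
        then show ?thesis by (simp add: c_def)
      qed
    qed
    show "c b b' = (if b = b' then \<one>\<^bsub>K\<^esub> else \<zero>\<^bsub>K\<^esub>)" if b: "b \<in> B" "b' \<in> B" for b b'
    proof -
      let ?d = "\<lambda>x. if x = b' then \<one>\<^bsub>K\<^esub> else \<zero>\<^bsub>K\<^esub>"
      have "V.lincomb ?d B = (\<Oplus>\<^bsub>V\<^esub>x\<in>B. if b' = x then x else \<zero>\<^bsub>V\<^esub>)"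
        unfolding V.lincomb_def using BV by (intro V.M.finsum_cong') (auto)
      also have "\<dots> = b'" using V.M.finsum_singleton[OF b(2) B(1), of "\<lambda>x. x"] BV by auto
      finally have "?d b = a b' b" using b BV by (intro a_unique) auto
      then show ?thesis by (simp add: c_def)
    qed
    show "v = (\<Oplus>\<^bsub>V\<^esub>b\<in>B. c b v \<odot>\<^bsub>V\<^esub> b)" if "v \<in> carrier V" for v
      using a(2)[OF that] unfolding V.lincomb_def c_def by simp
  qed
qed

text \<open>The image of a basis is independent and has as many elements as the basis.\<close>

lemma inj_endo_surj:
  assumes "vectorspace K V" "vectorspace.fin_dim K V" "f \<in> Hom K V V" "inj_on f (carrier V)"
  shows "f ` carrier V = carrier V"
proof -
  interpret V: vectorspace K V by fact
  obtain B where B: "finite B" "V.basis B" using V.finite_basis_exists assms(2) by blast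
  have BV: "B \<subseteq> carrier V" and li: "V.lin_indpt B" and gen: "V.span B = carrier V"
    using B by (auto simp: V.basis_def)
  interpret linear_map K V V f by unfold_locales fact
  have fB: "f ` B \<subseteq> carrier V" using BV by (auto intro: hom_closed[OF assms(3)])
  have "V.lin_indpt (f ` B)"
  proof (rule V.finite_lin_indpt2[OF _ fB])
    fix a assume a: "a \<in> f ` B \<rightarrow> carrier K" "V.lincomb a (f ` B) = \<zero>\<^bsub>V\<^esub>"
    have "f (V.lincomb (a \<circ> f) B) = f \<zero>\<^bsub>V\<^esub>"
      using lincomb_linear_image[OF assms(4) BV a(1) B(1)] a(2)
        hom_zero[OF V.module_axioms V.module_axioms assms(3)] by metis
    then have "V.lincomb (a \<circ> f) B = \<zero>\<^bsub>V\<^esub>"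
      by (rule inj_onD[OF assms(4)]) (use a(1) BV in \<open>auto intro!: V.lincomb_closed\<close>)
    then have "(a \<circ> f) \<in> B \<rightarrow> {\<zero>\<^bsub>K\<^esub>}"
      using a(1) by (intro V.not_lindepD[OF li B(1)]) auto
    then show "\<forall>v\<in>f ` B. a v = \<zero>\<^bsub>K\<^esub>" by auto
  qed (use B in simp)
  moreover have "card (f ` B) = card B"
    using assms(4) BV by (meson card_image inj_on_subset)
  moreover have "V.dim = card B" using V.dim_basis B by simp
  ultimately have "V.basis (f ` B)"
    using V.dim_li_is_basis[OF assms(2) _ fB] B(1) by simp
  then have "carrier V = V.span (f ` B)" by (simp add: V.basis_def)
  also have "\<dots> \<subseteq> f ` carrier V"
    using BV by (intro span_least submod_image[OF _ _ assms(3)] submod_self) (auto simp: V.module_axioms)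
  finally show ?thesis using hom_closed[OF assms(3)] by auto
qed

subsection \<open>Roots of polynomials and eigenvectors\<close>

text \<open>Coefficient lists start with the constant term, so that Horner's scheme is structural recursion.
  The function \<open>ring.eval\<close> reads them in the opposite order.\<close>

primrec poly_at :: "('k, 'd) ring_scheme \<Rightarrow> 'k list \<Rightarrow> 'k \<Rightarrow> 'k" where
  "poly_at K [] x = \<zero>\<^bsub>K\<^esub>"
| "poly_at K (a # p) x = a \<oplus>\<^bsub>K\<^esub> x \<otimes>\<^bsub>K\<^esub> poly_at K p x"

primrec poly_op :: "('k, 'v, 'e) module_scheme \<Rightarrow> ('v \<Rightarrow> 'v) \<Rightarrow> 'k list \<Rightarrow> 'v \<Rightarrow> 'v" where
  "poly_op V T [] v = \<zero>\<^bsub>V\<^esub>"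
| "poly_op V T (a # p) v = a \<odot>\<^bsub>V\<^esub> v \<oplus>\<^bsub>V\<^esub> T (poly_op V T p v)"

lemma poly_at_closed:
  assumes "cring K" "set p \<subseteq> carrier K" "x \<in> carrier K"
  shows "poly_at K p x \<in> carrier K"
proof -
  interpret K: cring K by fact
  show ?thesis using assms(2,3) by (induction p) auto
qed

lemma poly_at_eq_eval:
  assumes "cring K" "set p \<subseteq> carrier K" "x \<in> carrier K"
  shows "poly_at K p x = ring.eval K (rev p) x"
proof -
  interpret K: cring K by fact
  show ?thesis using assms(2)
  proof (induction p)
    case (Cons a p)
    have "K.eval (rev p @ [a]) x = K.eval (rev p) x \<otimes>\<^bsub>K\<^esub> x \<oplus>\<^bsub>K\<^esub> a"
      using Cons assms(3) by (intro K.eval_append_aux) auto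
    moreover have "K.eval (rev p) x \<in> carrier K"
      using Cons assms(3) by (intro K.eval_in_carrier) auto
    ultimately show ?case using Cons assms(3) by (simp add: K.a_comm K.m_comm)
  qed simp
qed

lemma root_exists:
  assumes "algebraically_closed K" "set p \<subseteq> carrier K" "length p \<ge> 2" "last p \<noteq> \<zero>\<^bsub>K\<^esub>"
  shows "\<exists>x\<in>carrier K. poly_at K p x = \<zero>\<^bsub>K\<^esub>"
proof -
  interpret K: algebraically_closed K by fact
  have "p \<noteq> []" using assms(3) by auto
  then have P: "rev p \<in> carrier (poly_ring K)"
    using assms(2,4) by (auto simp: univ_poly_carrier[symmetric] polynomial_def hd_rev)
  have "size (K.roots (rev p)) = length p - 1"
    using K.roots_over_carrier[OF P] by (simp add: K.splitted_def)
  then have "K.roots (rev p) \<noteq> {#}" using assms(3) by auto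
  then obtain x where "x \<in># K.roots (rev p)" by blast
  then have "K.is_root (rev p) x" using K.roots_mem_iff_is_root[OF P] by simp
  then have "x \<in> carrier K" "K.eval (rev p) x = \<zero>\<^bsub>K\<^esub>" by (auto simp: K.is_root_def)
  then show ?thesis using poly_at_eq_eval[OF K.cring_axioms assms(2)] by auto
qed

context
  fixes K :: "('k, 'd) ring_scheme" and V :: "('k, 'v, 'e) module_scheme" and T :: "'v \<Rightarrow> 'v"
  assumes V: "Module.module K V" and T: "T \<in> Hom K V V"
begin

interpretation V: Module.module K V by (rule V)

lemma poly_op_closed:
  "\<lbrakk>set p \<subseteq> carrier K; v \<in> carrier V\<rbrakk> \<Longrightarrow> poly_op V T p v \<in> carrier V"
  by (induction p) (auto simp: hom_closed[OF T])

lemma poly_op_add: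
  assumes "length p = length q" "set p \<subseteq> carrier K" "set q \<subseteq> carrier K" "v \<in> carrier V"
  shows "poly_op V T (map2 (add K) p q) v = poly_op V T p v \<oplus>\<^bsub>V\<^esub> poly_op V T q v"
  using assms
proof (induction p q rule: list_induct2)
  case (Cons a p b q)
  then show ?case
    by (auto simp: poly_op_closed hom_add[OF T] V.smult_l_distr V.a_ac hom_closed[OF T])
qed simp

lemma poly_op_smult:
  assumes "set p \<subseteq> carrier K" "r \<in> carrier K" "v \<in> carrier V"
  shows "poly_op V T (map (monoid.mult K r) p) v = r \<odot>\<^bsub>V\<^esub> poly_op V T p v"
  using assms(1)
proof (induction p)
  case (Cons a p)
  then show ?case
    using assms by (simp add: poly_op_closed hom_smult[OF T] V.smult_r_distr V.smult_assoc1 hom_closed[OF T])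
qed (use assms in simp)

lemma poly_op_shift:
  assumes "set p \<subseteq> carrier K" "v \<in> carrier V"
  shows "poly_op V T (replicate i \<zero>\<^bsub>K\<^esub> @ p) v = (T ^^ i) (poly_op V T p v)"
proof (induction i)
  case (Suc i)
  have "(T ^^ i) w \<in> carrier V" if "w \<in> carrier V" for w
    using that by (induction i) (auto simp: hom_closed[OF T])
  then show ?case using assms Suc by (simp add: hom_closed[OF T] poly_op_closed)
qed simp

lemma poly_op_replicate_zero:
  assumes "v \<in> carrier V"
  shows "poly_op V T (replicate n \<zero>\<^bsub>K\<^esub>) v = \<zero>\<^bsub>V\<^esub>"
  using assms by (induction n) (auto simp: hom_zero[OF V V T])

lemma poly_op_append:
  assumes "set p \<subseteq> carrier K" "set q \<subseteq> carrier K" "v \<in> carrier V"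
  shows "poly_op V T (p @ q) v = poly_op V T p v \<oplus>\<^bsub>V\<^esub> (T ^^ length p) (poly_op V T q v)"
  using assms
proof (induction p)
  case (Cons a p)
  have "(T ^^ i) w \<in> carrier V" if "w \<in> carrier V" for w i
    using that by (induction i) (auto simp: hom_closed[OF T])
  then show ?case
    using Cons by (simp add: poly_op_closed hom_add[OF T] V.a_assoc hom_closed[OF T])
qed (simp add: poly_op_closed)

text \<open>Horner's scheme divides \<open>p\<close> by \<open>t - x\<close>, with remainder the value of \<open>p\<close> at \<open>x\<close>.\<close>

lemma poly_op_divide_linear:
  assumes "set p \<subseteq> carrier K" "p \<noteq> []" "x \<in> carrier K" "v \<in> carrier V"
  obtains q where "set q \<subseteq> carrier K" "length p = Suc (length q)" "q \<noteq> [] \<Longrightarrow> last q = last p"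
    "poly_op V T p v =
      T (poly_op V T q v) \<ominus>\<^bsub>V\<^esub> x \<odot>\<^bsub>V\<^esub> poly_op V T q v \<oplus>\<^bsub>V\<^esub> poly_at K p x \<odot>\<^bsub>V\<^esub> v"
  using assms(1,2)
proof (induction p arbitrary: thesis)
  case (Cons a p)
  show ?case
  proof (cases "p = []")
    case True
    show ?thesis
      by (rule Cons.prems(1)[of "[]"])
         (use True Cons.prems assms in \<open>auto simp: hom_zero[OF V V T] V.minus_eq\<close>)
  next
    case False
    from Cons.IH[OF _ _ False] Cons.prems obtain q where
      q: "set q \<subseteq> carrier K" "length p = Suc (length q)" "q \<noteq> [] \<Longrightarrow> last q = last p"
      "poly_op V T p v = T (poly_op V T q v) \<ominus>\<^bsub>V\<^esub> x \<odot>\<^bsub>V\<^esub> poly_op V T q v \<oplus>\<^bsub>V\<^esub> poly_at K p x \<odot>\<^bsub>V\<^esub> v"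
      by auto
    define c where "c = poly_at K p x"
    define w where "w = poly_op V T q v"
    have c: "c \<in> carrier K" using Cons.prems assms unfolding c_def by (intro poly_at_closed) (auto simp: V.is_cring)
    have w: "w \<in> carrier V" using q assms by (simp add: w_def poly_op_closed)
    have Tw: "T w \<in> carrier V" "T (T w) \<in> carrier V" "T v \<in> carrier V"
      using w assms by (auto simp: hom_closed[OF T])
    have a: "a \<in> carrier K" using Cons.prems by simp
    show ?thesis
    proof (rule Cons.prems(1)[of "c # q"])
      have p: "poly_op V T p v = T w \<ominus>\<^bsub>V\<^esub> x \<odot>\<^bsub>V\<^esub> w \<oplus>\<^bsub>V\<^esub> c \<odot>\<^bsub>V\<^esub> v"
        using q(4) by (simp add: c_def w_def)
      have Tp: "T (poly_op V T p v) = T (T w) \<ominus>\<^bsub>V\<^esub> x \<odot>\<^bsub>V\<^esub> T w \<oplus>\<^bsub>V\<^esub> c \<odot>\<^bsub>V\<^esub> T v"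
        unfolding p using w Tw c assms by (simp add: hom_add[OF T] hom_minus[OF V V T] hom_smult[OF T])
      have "poly_op V T (a # p) v = a \<odot>\<^bsub>V\<^esub> v \<oplus>\<^bsub>V\<^esub> (T (T w) \<ominus>\<^bsub>V\<^esub> x \<odot>\<^bsub>V\<^esub> T w \<oplus>\<^bsub>V\<^esub> c \<odot>\<^bsub>V\<^esub> T v)"
        by (simp add: Tp)
      also have "\<dots> = T (c \<odot>\<^bsub>V\<^esub> v \<oplus>\<^bsub>V\<^esub> T w) \<ominus>\<^bsub>V\<^esub> x \<odot>\<^bsub>V\<^esub> (c \<odot>\<^bsub>V\<^esub> v \<oplus>\<^bsub>V\<^esub> T w) \<oplus>\<^bsub>V\<^esub> (a \<oplus>\<^bsub>K\<^esub> x \<otimes>\<^bsub>K\<^esub> c) \<odot>\<^bsub>V\<^esub> v"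
        using w Tw c a assms
        by (subst V.M.regroup[where y = "x \<odot>\<^bsub>V\<^esub> (c \<odot>\<^bsub>V\<^esub> v)"])
           (auto simp: hom_add[OF T] hom_smult[OF T] V.smult_r_distr V.smult_l_distr V.smult_assoc1)
      finally show "poly_op V T (a # p) v =
        T (poly_op V T (c # q) v) \<ominus>\<^bsub>V\<^esub> x \<odot>\<^bsub>V\<^esub> poly_op V T (c # q) v \<oplus>\<^bsub>V\<^esub> poly_at K (a # p) x \<odot>\<^bsub>V\<^esub> v"
        by (simp add: w_def c_def)
      show "last (c # q) = last (a # p)"
      proof (cases q)
        case Nil
        then obtain b where "p = [b]" using q(2) by (metis Suc_length_conv length_0_conv)
        then show ?thesis using Nil Cons.prems assms by (simp add: c_def)
      qed (use q False in auto)
    qed (use q c in auto)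
  qed
qed simp

end

text \<open>If no monic polynomial in \<open>T\<close> kills \<open>v\<close>, then no power \<open>T\<^sup>n v\<close> lies in the span of the lower ones, and
  the powers form independent families of every size.\<close>

lemma vanishing_polynomial_exists:
  assumes "vectorspace K V" "vectorspace.fin_dim K V" "T \<in> Hom K V V" "v \<in> carrier V"
  shows "\<exists>p. set p \<subseteq> carrier K \<and> p \<noteq> [] \<and> last p = \<one>\<^bsub>K\<^esub> \<and> poly_op V T p v = \<zero>\<^bsub>V\<^esub>"
proof (rule ccontr)
  assume contr: "\<not> ?thesis"
  interpret V: vectorspace K V by fact
  note VM = vs_module[OF assms(1)]
  note poly_op = poly_op_closed[OF VM assms(3)] poly_op_append[OF VM assms(3)]
  (* S n is the span of E n, the first n powers, written with coefficient lists of length n *)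
  let ?S = "\<lambda>n. {poly_op V T p v | p. set p \<subseteq> carrier K \<and> length p = n}"
  let ?E = "\<lambda>n. (\<lambda>i. (T ^^ i) v) ` {..<n}"
  have pow: "(T ^^ i) v \<in> carrier V" for i
    by (induction i) (auto simp: assms(4) hom_closed[OF assms(3)])
  have sub: "submod K (?S n) V" for n
  proof (rule submodI[OF VM])
    show "?S n \<subseteq> carrier V" using poly_op assms(4) by auto
    show "\<zero>\<^bsub>V\<^esub> \<in> ?S n"
      by (intro CollectI exI[of _ "replicate n \<zero>\<^bsub>K\<^esub>"])
         (auto simp: poly_op_replicate_zero[OF VM assms(3,4)])
    show "x \<oplus>\<^bsub>V\<^esub> y \<in> ?S n" if xy: "x \<in> ?S n" "y \<in> ?S n" for x y
    proof -
      from xy obtain p q where pq: "set p \<subseteq> carrier K" "set q \<subseteq> carrier K" "length p = n" "length q = n"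
        "x = poly_op V T p v" "y = poly_op V T q v" by auto
      then have "x \<oplus>\<^bsub>V\<^esub> y = poly_op V T (map2 (add K) p q) v"
        using poly_op_add[OF VM assms(3)] assms(4) by simp
      moreover have "set (map2 (add K) p q) \<subseteq> carrier K"
      proof -
        have "a \<oplus>\<^bsub>K\<^esub> b \<in> carrier K" if "(a, b) \<in> set (zip p q)" for a b
          using set_zip_leftD[OF that] set_zip_rightD[OF that] pq by (intro V.R.a_closed) auto
        then show ?thesis by auto
      qed
      ultimately show ?thesis using pq by (intro CollectI exI[of _ "map2 (add K) p q"]) auto
    qed
    show "r \<odot>\<^bsub>V\<^esub> x \<in> ?S n" if rx: "r \<in> carrier K" "x \<in> ?S n" for r x
    proof -
      from rx obtain p where p: "set p \<subseteq> carrier K" "length p = n" "x = poly_op V T p v" by auto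
      then show ?thesis
        using rx by (intro CollectI exI[of _ "map (monoid.mult K r) p"])
          (auto simp: poly_op_smult[OF VM assms(3) _ _ assms(4)])
    qed
  qed
  have ES: "?E n \<subseteq> ?S n" for n
  proof safe
    fix i assume i: "i < n"
    let ?p = "(replicate i \<zero>\<^bsub>K\<^esub> @ [\<one>\<^bsub>K\<^esub>]) @ replicate (n - Suc i) \<zero>\<^bsub>K\<^esub>"
    have "poly_op V T ?p v = (T ^^ i) v"
    proof -
      have z: "(T ^^ j) \<zero>\<^bsub>V\<^esub> = \<zero>\<^bsub>V\<^esub>" for j
        by (induction j) (auto simp: hom_zero[OF VM VM assms(3)])
      show ?thesis
        using poly_op_append[OF VM assms(3), of "replicate i \<zero>\<^bsub>K\<^esub> @ [\<one>\<^bsub>K\<^esub>]" "replicate (n - Suc i) \<zero>\<^bsub>K\<^esub>" v]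
          poly_op_shift[OF VM assms(3), of "[\<one>\<^bsub>K\<^esub>]" v i] poly_op_replicate_zero[OF VM assms(3,4)]
          assms(4) pow z
        by (simp add: hom_zero[OF VM VM assms(3)] hom_closed[OF assms(3)] set_replicate_conv_if)
    qed
    then show "\<exists>p. (T ^^ i) v = poly_op V T p v \<and> set p \<subseteq> carrier K \<and> length p = n"
      using i by (intro exI[of _ ?p]) auto
  qed
  have notin: "(T ^^ n) v \<notin> ?S n" for n
  proof
    assume "(T ^^ n) v \<in> ?S n"
    then obtain p where p: "set p \<subseteq> carrier K" "length p = n" "(T ^^ n) v = poly_op V T p v" by auto
    let ?m = "map (monoid.mult K (\<ominus>\<^bsub>K\<^esub> \<one>\<^bsub>K\<^esub>)) p"
    have "poly_op V T (?m @ [\<one>\<^bsub>K\<^esub>]) v = \<ominus>\<^bsub>V\<^esub> poly_op V T p v \<oplus>\<^bsub>V\<^esub> (T ^^ n) v"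
      using p assms(4) poly_op pow
      by (subst poly_op_append[OF VM assms(3)])
         (auto simp: poly_op_smult[OF VM assms(3)] V.smult_l_minus hom_zero[OF VM VM assms(3)])
    also have "\<dots> = \<zero>\<^bsub>V\<^esub>" using p pow[of n] by (simp add: V.M.l_neg)
    finally have "poly_op V T (?m @ [\<one>\<^bsub>K\<^esub>]) v = \<zero>\<^bsub>V\<^esub>" .
    moreover have "set (?m @ [\<one>\<^bsub>K\<^esub>]) \<subseteq> carrier K"
      using p(1) by (auto simp: subset_iff intro!: V.R.m_closed V.R.a_inv_closed)
    ultimately show False using contr by (metis last_snoc snoc_eq_iff_butlast)
  qed
  have "V.lin_indpt (?E n) \<and> card (?E n) = n" for n
  proof (induction n)
    case 0
    show ?case by (simp add: V.lin_dep_def)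
  next
    case (Suc n)
    have EV: "?E n \<subseteq> carrier V" using pow by auto
    have "V.span (?E n) \<subseteq> ?S n" using span_least[OF sub ES] .
    then have ns: "(T ^^ n) v \<notin> V.span (?E n)" using notin by blast
    then have nE: "(T ^^ n) v \<notin> ?E n" using span_superset[OF VM EV] by blast
    have "V.lin_indpt (?E n \<union> {(T ^^ n) v})"
      using V.lin_dep_iff_in_span[OF EV _ pow nE] Suc ns by blast
    moreover have "?E (Suc n) = ?E n \<union> {(T ^^ n) v}" by (auto simp: lessThan_Suc)
    ultimately show ?case using Suc nE by simp
  qed
  from this[of "Suc V.dim"] show False
    using V.li_le_dim(2)[OF assms(2), of "?E (Suc V.dim)"] pow by (auto simp del: lessThan_Suc)
qed

text \<open>A polynomial of least degree that kills a given nonzero vector has a root, and dividing by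
  the corresponding linear factor leaves an eigenvector.\<close>

lemma eigenvector_exists:
  assumes "algebraically_closed K" "vectorspace K V" "vectorspace.fin_dim K V"
    and "carrier V \<noteq> {\<zero>\<^bsub>V\<^esub>}" "T \<in> Hom K V V"
  shows "\<exists>c\<in>carrier K. \<exists>v\<in>carrier V. v \<noteq> \<zero>\<^bsub>V\<^esub> \<and> T v = c \<odot>\<^bsub>V\<^esub> v"
proof -
  interpret V: vectorspace K V by fact
  note VM = vs_module[OF assms(2)]
  obtain v where v: "v \<in> carrier V" "v \<noteq> \<zero>\<^bsub>V\<^esub>" using assms(4) V.M.zero_closed by blast
  define P where "P p \<longleftrightarrow> set p \<subseteq> carrier K \<and> p \<noteq> [] \<and> last p = \<one>\<^bsub>K\<^esub> \<and> poly_op V T p v = \<zero>\<^bsub>V\<^esub>" for p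
  have "\<exists>p. P p" using vanishing_polynomial_exists[OF assms(2,3,5) v(1)] by (auto simp: P_def)
  then obtain p where p: "P p" and least: "\<And>q. P q \<Longrightarrow> length p \<le> length q"
    by (metis arg_min_natI arg_min_nat_le)
  have pK: "set p \<subseteq> carrier K" "p \<noteq> []" "last p = \<one>\<^bsub>K\<^esub>" and p0: "poly_op V T p v = \<zero>\<^bsub>V\<^esub>"
    using p by (auto simp: P_def)
  have "length p \<ge> 2"
  proof (rule ccontr)
    assume "\<not> length p \<ge> 2"
    moreover have "length p > 0" using pK(2) by simp
    ultimately have "length p = 1" by linarith
    then obtain a where "p = [a]" by (metis One_nat_def Suc_length_conv length_0_conv)
    then show False using p0 pK v by (simp add: hom_zero[OF VM VM assms(5)])
  qed
  then obtain x where x: "x \<in> carrier K" "poly_at K p x = \<zero>\<^bsub>K\<^esub>"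
    using root_exists[OF assms(1) pK(1)] pK(3) by auto
  obtain q where q: "set q \<subseteq> carrier K" "length p = Suc (length q)" "q \<noteq> [] \<Longrightarrow> last q = last p"
    "poly_op V T p v =
      T (poly_op V T q v) \<ominus>\<^bsub>V\<^esub> x \<odot>\<^bsub>V\<^esub> poly_op V T q v \<oplus>\<^bsub>V\<^esub> poly_at K p x \<odot>\<^bsub>V\<^esub> v"
    using poly_op_divide_linear[OF VM assms(5) pK(1,2) x(1) v(1)] by metis
  let ?w = "poly_op V T q v"
  have w: "?w \<in> carrier V" using poly_op_closed[OF VM assms(5) q(1) v(1)] .
  have "q \<noteq> []" using q(2) \<open>length p \<ge> 2\<close> by auto
  then have "\<not> P q" using least[of q] q(2) by auto
  then have "?w \<noteq> \<zero>\<^bsub>V\<^esub>" using q pK \<open>q \<noteq> []\<close> by (auto simp: P_def)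
  moreover have "T ?w = x \<odot>\<^bsub>V\<^esub> ?w"
  proof -
    have "T ?w \<ominus>\<^bsub>V\<^esub> x \<odot>\<^bsub>V\<^esub> ?w = \<zero>\<^bsub>V\<^esub>"
      using q(4) p0 x v w by (simp add: hom_closed[OF assms(5)])
    then show ?thesis using w x by (simp add: hom_closed[OF assms(5)])
  qed
  ultimately show ?thesis using x w by blast
qed

text \<open>In finite dimension \<open>h\<close> is invertible, and an eigenvector of \<open>h\<^sup>-\<^sup>1 f\<close> will do.\<close>

lemma generalized_eigenvector_exists:
  assumes "algebraically_closed K" "vectorspace K V" "vectorspace.fin_dim K V"
    and "carrier V \<noteq> {\<zero>\<^bsub>V\<^esub>}" "f \<in> Hom K V V" "h \<in> Hom K V V" "inj_on h (carrier V)"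
  shows "\<exists>c\<in>carrier K. \<exists>v\<in>carrier V. v \<noteq> \<zero>\<^bsub>V\<^esub> \<and> f v = c \<odot>\<^bsub>V\<^esub> h v"
proof -
  interpret V: vectorspace K V by fact
  note surj = inj_endo_surj[OF assms(2,3,6,7)]
  let ?g = "inv_into (carrier V) h"
  have g: "?g y \<in> carrier V" "h (?g y) = y" if "y \<in> carrier V" for y
    using that surj by (auto simp: inv_into_into f_inv_into_f)
  have gI: "?g y = x" if "x \<in> carrier V" "h x = y" for x y
    using that assms(7) by (simp add: inv_into_f_eq)
  have "?g \<in> Hom K V V"
    by (rule homI) (auto simp: g hom_add[OF assms(6)] hom_smult[OF assms(6)] intro!: gI)
  then have "(\<lambda>x. ?g (f x)) \<in> Hom K V V" using hom_compose assms(5) by blast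
  then obtain c v where cv: "c \<in> carrier K" "v \<in> carrier V" "v \<noteq> \<zero>\<^bsub>V\<^esub>" "?g (f v) = c \<odot>\<^bsub>V\<^esub> v"
    using eigenvector_exists[OF assms(1-4)] by blast
  have "f v = h (?g (f v))" using g hom_closed[OF assms(5) cv(2)] by simp
  also have "\<dots> = c \<odot>\<^bsub>V\<^esub> h v" using cv by (simp add: hom_smult[OF assms(6)])
  finally show ?thesis using cv by blast
qed

subsection \<open>Density\<close>

text \<open>An operator is a function on the whole type, and membership in \<open>A\<close> may depend on its values outside
  \<open>carrier V\<close>. Hence \<open>rank_one_in_A\<close> asserts only that \<open>A\<close> contains an operator that agrees with the
  given one on \<open>carrier V\<close>.\<close>

locale irreducible_operators =
  fixes K :: "('k, 'd) ring_scheme" and V :: "('k, 'v, 'e) module_scheme" and A :: "('v \<Rightarrow> 'v) set"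
  assumes alg_closed: "algebraically_closed K"
    and V_vs: "vectorspace K V"
    and V_fin_dim: "vectorspace.fin_dim K V"
    and A_Hom: "a \<in> A \<Longrightarrow> a \<in> Hom K V V"
    and A_id: "(\<lambda>x. x) \<in> A"
    and A_add: "\<lbrakk>a \<in> A; b \<in> A\<rbrakk> \<Longrightarrow> (\<lambda>x. a x \<oplus>\<^bsub>V\<^esub> b x) \<in> A"
    and A_smult: "\<lbrakk>r \<in> carrier K; a \<in> A\<rbrakk> \<Longrightarrow> (\<lambda>x. r \<odot>\<^bsub>V\<^esub> a x) \<in> A"
    and A_comp: "\<lbrakk>a \<in> A; b \<in> A\<rbrakk> \<Longrightarrow> (\<lambda>x. a (b x)) \<in> A"
    and irreducible:
      "\<lbrakk>submod K U V; \<And>a. a \<in> A \<Longrightarrow> a ` U \<subseteq> U\<rbrakk> \<Longrightarrow> U = {\<zero>\<^bsub>V\<^esub>} \<or> U = carrier V"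
begin

sublocale V: vectorspace K V by (rule V_vs)

lemma V_module: "Module.module K V" by (rule vs_module[OF V_vs])

lemma A_closed: "\<lbrakk>a \<in> A; v \<in> carrier V\<rbrakk> \<Longrightarrow> a v \<in> carrier V"
  using hom_closed[OF A_Hom] .

lemma A_zero: "a \<in> A \<Longrightarrow> a \<zero>\<^bsub>V\<^esub> = \<zero>\<^bsub>V\<^esub>"
  using hom_zero[OF V_module V_module A_Hom] .

text \<open>The orbit of \<open>w\<close> under a left ideal of \<open>A\<close> is an invariant subspace. The element \<open>a0\<close> witnesses that
  it is not zero.\<close>

lemma left_ideal_orbit:
  assumes "J \<subseteq> A" "a0 \<in> J" "w \<in> carrier V" "a0 w \<noteq> \<zero>\<^bsub>V\<^esub>"
    and add: "\<And>a b. \<lbrakk>a \<in> J; b \<in> J\<rbrakk> \<Longrightarrow> (\<lambda>x. a x \<oplus>\<^bsub>V\<^esub> b x) \<in> J"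
    and smult: "\<And>r a. \<lbrakk>r \<in> carrier K; a \<in> J\<rbrakk> \<Longrightarrow> (\<lambda>x. r \<odot>\<^bsub>V\<^esub> a x) \<in> J"
    and comp: "\<And>a b. \<lbrakk>a \<in> A; b \<in> J\<rbrakk> \<Longrightarrow> (\<lambda>x. a (b x)) \<in> J"
  shows "(\<lambda>a. a w) ` J = carrier V"
proof -
  let ?U = "(\<lambda>a. a w) ` J"
  have "submod K ?U V"
  proof (rule submodI[OF V_module])
    show "?U \<subseteq> carrier V" using assms A_closed by auto
    have "\<zero>\<^bsub>V\<^esub> = (\<lambda>x. \<zero>\<^bsub>K\<^esub> \<odot>\<^bsub>V\<^esub> a0 x) w" using assms A_closed by auto
    then show "\<zero>\<^bsub>V\<^esub> \<in> ?U" using smult[OF V.R.zero_closed assms(2)] by (rule image_eqI)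
    show "x \<oplus>\<^bsub>V\<^esub> y \<in> ?U" if "x \<in> ?U" "y \<in> ?U" for x y
      using that add by (auto intro!: image_eqI[of _ _ "\<lambda>x. _ x \<oplus>\<^bsub>V\<^esub> _ x"])
    show "r \<odot>\<^bsub>V\<^esub> x \<in> ?U" if "r \<in> carrier K" "x \<in> ?U" for r x
      using that smult by (auto intro!: image_eqI[of _ _ "\<lambda>x. _ \<odot>\<^bsub>V\<^esub> _ x"])
  qed
  moreover have "a ` ?U \<subseteq> ?U" if "a \<in> A" for a
    using comp[OF that] by (auto intro!: image_eqI[of _ _ "\<lambda>x. a (_ x)"])
  ultimately have "?U = {\<zero>\<^bsub>V\<^esub>} \<or> ?U = carrier V" by (rule irreducible)
  moreover have "a0 w \<in> ?U" using assms by blast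
  ultimately show ?thesis using assms(4) by blast
qed

lemma orbit_full:
  assumes "w \<in> carrier V" "w \<noteq> \<zero>\<^bsub>V\<^esub>"
  shows "(\<lambda>a. a w) ` A = carrier V"
  by (rule left_ideal_orbit[of A "\<lambda>x. x"]) (use assms in \<open>auto simp: A_id A_add A_smult A_comp\<close>)

text \<open>Schur's lemma: an eigenspace of \<open>T\<close> is invariant under \<open>A\<close>.\<close>

lemma commuting_is_scalar:
  assumes "T \<in> Hom K V V" "carrier V \<noteq> {\<zero>\<^bsub>V\<^esub>}"
    and comm: "\<And>a v. \<lbrakk>a \<in> A; v \<in> carrier V\<rbrakk> \<Longrightarrow> T (a v) = a (T v)"
  obtains c where "c \<in> carrier K" "\<And>v. v \<in> carrier V \<Longrightarrow> T v = c \<odot>\<^bsub>V\<^esub> v"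
proof -
  obtain c v where cv: "c \<in> carrier K" "v \<in> carrier V" "v \<noteq> \<zero>\<^bsub>V\<^esub>" "T v = c \<odot>\<^bsub>V\<^esub> v"
    using eigenvector_exists[OF alg_closed V_vs V_fin_dim assms(2,1)] by blast
  let ?U = "{v \<in> carrier V. T v = c \<odot>\<^bsub>V\<^esub> v}"
  have "submod K ?U V"
    using submod_equalizer[OF V_module V_module assms(1) hom_scale[OF V_module hom_id cv(1)]] .
  moreover have "a ` ?U \<subseteq> ?U" if "a \<in> A" for a
    using that cv(1) by (auto simp: comm A_closed hom_smult[OF A_Hom])
  ultimately have "?U = {\<zero>\<^bsub>V\<^esub>} \<or> ?U = carrier V" by (rule irreducible)
  then have "?U = carrier V" using cv by blast
  then show ?thesis using that cv(1) by blast
qed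

text \<open>The density theorem. Suppose that the claim holds for \<open>F\<close> and fails for \<open>insert w F\<close>, and let \<open>J\<close> be the
  annihilator of \<open>F\<close> in \<open>A\<close>. Then \<open>a w \<mapsto> a v\<close>, for \<open>a\<close> in \<open>J\<close>, is a well-defined operator on the whole
  space that commutes with \<open>A\<close>, hence a scalar \<open>c\<close>, and \<open>J\<close> kills \<open>v - c w\<close>. So \<open>v - c w\<close> is in the
  span of \<open>F\<close>, which puts \<open>v\<close> in the span of \<open>insert w F\<close>.\<close>

lemma annihilator_separates:
  assumes "finite F" "F \<subseteq> carrier V" "v \<in> carrier V" "v \<notin> V.span F"
  shows "\<exists>a\<in>A. (\<forall>w\<in>F. a w = \<zero>\<^bsub>V\<^esub>) \<and> a v \<noteq> \<zero>\<^bsub>V\<^esub>"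
  using assms
proof (induction F arbitrary: v rule: finite_induct)
  case empty
  then have "v \<noteq> \<zero>\<^bsub>V\<^esub>" by (auto simp: V.span_empty)
  then show ?case using A_id by auto
next
  case (insert w F)
  have F: "F \<subseteq> carrier V" and w: "w \<in> carrier V" using insert.prems by auto
  have sub: "submod K (V.span F) V" "submod K (V.span (insert w F)) V"
    using span_submod[OF V_module] insert.prems(1) by auto
  have mono: "V.span F \<subseteq> V.span (insert w F)" by (rule V.span_is_monotone) auto
  define J where "J = {a \<in> A. \<forall>u\<in>F. a u = \<zero>\<^bsub>V\<^esub>}"
  have J_A: "a \<in> A" if "a \<in> J" for a using that by (simp add: J_def)
  show ?case
  proof (rule ccontr)
    assume contr: "\<not> ?case"
    have kill: "a v = \<zero>\<^bsub>V\<^esub>" if "a \<in> J" "a w = \<zero>\<^bsub>V\<^esub>" for a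
      using that contr by (auto simp: J_def)
    have J_add: "(\<lambda>x. a x \<oplus>\<^bsub>V\<^esub> b x) \<in> J" if "a \<in> J" "b \<in> J" for a b
      using that by (auto simp: J_def A_add)
    have J_smult: "(\<lambda>x. r \<odot>\<^bsub>V\<^esub> a x) \<in> J" if "r \<in> carrier K" "a \<in> J" for r a
      using that by (auto simp: J_def A_smult)
    have J_comp: "(\<lambda>x. a (b x)) \<in> J" if "a \<in> A" "b \<in> J" for a b
      using that by (auto simp: J_def A_comp A_zero)
    (* otherwise J kills w, and the induction hypothesis separates v from F already *)
    have "w \<notin> V.span F"
    proof
      assume wF: "w \<in> V.span F"
      have "V.span (insert w F) \<subseteq> V.span F"
        using span_superset[OF V_module F] wF by (intro span_least[OF sub(1)]) auto
      then have "v \<notin> V.span F" using insert.prems mono by blast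
      then obtain a where a: "a \<in> J" "a v \<noteq> \<zero>\<^bsub>V\<^esub>"
        using insert.IH[OF F insert.prems(2)] by (auto simp: J_def)
      have "V.span F \<subseteq> {x \<in> carrier V. a x = \<zero>\<^bsub>V\<^esub>}"
        using a F by (intro span_least submod_kernel[OF V_module V_module] A_Hom) (auto simp: J_def)
      then show False using kill[OF a(1)] a(2) wF by blast
    qed
    then obtain a0 where a0: "a0 \<in> J" "a0 w \<noteq> \<zero>\<^bsub>V\<^esub>"
      using insert.IH[OF F w] by (auto simp: J_def)
    have Jw: "(\<lambda>a. a w) ` J = carrier V"
      by (rule left_ideal_orbit[of J a0]) (use a0 w J_A J_add J_smult J_comp in auto)
    define T where "T u = (SOME a. a \<in> J \<and> a w = u) v" for u
    have T: "T (a w) = a v" if a: "a \<in> J" for a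
    proof -
      define b where "b = (SOME b. b \<in> J \<and> b w = a w)"
      have "b \<in> J \<and> b w = a w" unfolding b_def by (rule someI[of _ a]) (simp add: a)
      then have b: "b \<in> J" "b w = a w" by auto
      have "b v \<oplus>\<^bsub>V\<^esub> (\<ominus>\<^bsub>K\<^esub> \<one>\<^bsub>K\<^esub>) \<odot>\<^bsub>V\<^esub> a v = \<zero>\<^bsub>V\<^esub>"
        using b w A_closed[OF J_A[OF a] w]
        by (intro kill[OF J_add[OF b(1) J_smult[OF _ a]]]) (auto simp: V.smult_l_minus V.M.r_neg)
      then have "b v = a v"
        using A_closed[OF J_A[OF a] insert.prems(2)] A_closed[OF J_A[OF b(1)] insert.prems(2)]
        by (simp add: V.smult_l_minus flip: V.minus_eq)
      then show ?thesis by (simp add: T_def b_def)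
    qed
    have T_Hom: "T \<in> Hom K V V"
    proof (rule homI)
      show "T x \<in> carrier V" if "x \<in> carrier V" for x
        using that T A_closed[OF J_A] insert.prems(2) unfolding Jw[symmetric] by auto
      show "T (x \<oplus>\<^bsub>V\<^esub> y) = T x \<oplus>\<^bsub>V\<^esub> T y" if "x \<in> carrier V" "y \<in> carrier V" for x y
        using that T T[OF J_add] unfolding Jw[symmetric] by auto
      show "T (r \<odot>\<^bsub>V\<^esub> x) = r \<odot>\<^bsub>V\<^esub> T x" if "r \<in> carrier K" "x \<in> carrier V" for r x
        using that(2) T T[OF J_smult[OF that(1)]] unfolding Jw[symmetric] by auto
    qed
    have "T (a x) = a (T x)" if "a \<in> A" "x \<in> carrier V" for a x
      using that(2) T T[OF J_comp[OF that(1)]] unfolding Jw[symmetric] by auto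
    moreover have "carrier V \<noteq> {\<zero>\<^bsub>V\<^esub>}" using a0 A_closed[OF J_A w] by blast
    ultimately obtain c where c: "c \<in> carrier K" "\<And>x. x \<in> carrier V \<Longrightarrow> T x = c \<odot>\<^bsub>V\<^esub> x"
      using commuting_is_scalar[OF T_Hom] by blast
    define u where "u = v \<ominus>\<^bsub>V\<^esub> c \<odot>\<^bsub>V\<^esub> w"
    have u: "u \<in> carrier V" using insert.prems w c by (simp add: u_def)
    have "a u = \<zero>\<^bsub>V\<^esub>" if a: "a \<in> J" for a
    proof -
      have "a v = c \<odot>\<^bsub>V\<^esub> a w" using T[OF a] c(2)[OF A_closed[OF J_A[OF a] w]] by simp
      then show ?thesis
        using insert.prems(2) w c(1) A_closed[OF J_A[OF a]]
        by (simp add: u_def hom_minus[OF V_module V_module A_Hom[OF J_A[OF a]]]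
            hom_smult[OF A_Hom[OF J_A[OF a]]])
    qed
    then have "u \<in> V.span F"
      using insert.IH[OF F u] by (auto simp: J_def)
    then have "u \<oplus>\<^bsub>V\<^esub> c \<odot>\<^bsub>V\<^esub> w \<in> V.span (insert w F)"
      using mono c(1) span_superset[OF V_module insert.prems(1)]
      by (intro submod_add[OF sub(2)] submod_smult[OF sub(2)]) auto
    moreover have "u \<oplus>\<^bsub>V\<^esub> c \<odot>\<^bsub>V\<^esub> w = v"
      using insert.prems(2) w c(1) by (simp add: u_def V.minus_eq V.a_assoc V.M.l_neg)
    ultimately show False using insert.prems(3) by simp
  qed
qed

text \<open>By density, \<open>A\<close> contains an operator that kills all basis vectors but \<open>b\<close>. Since the orbit of a
  nonzero vector is the whole space, another element of \<open>A\<close> moves the image of \<open>b\<close> to \<open>w\<close>.\<close>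

lemma rank_one_in_A:
  assumes B: "dual_basis K V B c" and "b \<in> B" "w \<in> carrier V"
  shows "\<exists>a\<in>A. \<forall>v\<in>carrier V. a v = c b v \<odot>\<^bsub>V\<^esub> w"
proof -
  note c = dual_basis_Hom[OF B] and dual = dual_basis_dual[OF B] and expand = dual_basis_expand[OF B]
  have BV: "B \<subseteq> carrier V" using dual_basis_closed[OF B] by blast
  have b: "b \<in> carrier V" using assms BV by blast
  have reg: "Module.module K (regular_module K)" by (rule module_regular_module[OF V.is_cring])
  have "V.span (B - {b}) \<subseteq> {v \<in> carrier V. c b v = \<zero>\<^bsub>regular_module K\<^esub>}"
    using BV assms(2) dual by (intro span_least submod_kernel[OF V_module reg] c) auto
  then have "b \<notin> V.span (B - {b})" using dual assms(2) by auto
  then obtain a where a: "a \<in> A" "\<And>b'. b' \<in> B - {b} \<Longrightarrow> a b' = \<zero>\<^bsub>V\<^esub>" "a b \<noteq> \<zero>\<^bsub>V\<^esub>"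
    using annihilator_separates[of "B - {b}" b] dual_basis_finite[OF B] BV b by blast
  obtain a' where a': "a' \<in> A" "a' (a b) = w"
    using orbit_full[OF A_closed[OF a(1) b] a(3)] assms(3) by (metis imageE)
  have aa: "(\<lambda>x. a' (a x)) \<in> Hom K V V" using A_Hom[OF A_comp[OF a'(1) a(1)]] .
  have "a' (a v) = c b v \<odot>\<^bsub>V\<^esub> w" if v: "v \<in> carrier V" for v
  proof -
    have cK: "c b' v \<in> carrier K" if "b' \<in> B" for b'
      using linear_dual_closed[OF c[OF that] v] .
    have "a' (a v) = a' (a (\<Oplus>\<^bsub>V\<^esub>b\<in>B. c b v \<odot>\<^bsub>V\<^esub> b))" using expand[OF v] by simp
    also have "\<dots> = (\<Oplus>\<^bsub>V\<^esub>b'\<in>B. a' (a (c b' v \<odot>\<^bsub>V\<^esub> b')))"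
      using cK BV by (intro hom_finsum[OF V_module V_module aa]) auto
    also have "\<dots> = (\<Oplus>\<^bsub>V\<^esub>b'\<in>B. if b = b' then c b' v \<odot>\<^bsub>V\<^esub> w else \<zero>\<^bsub>V\<^esub>)"
      using cK BV assms(3) a(2) a' A_zero[OF a'(1)] hom_smult[OF aa]
      by (intro V.M.finsum_cong') (auto simp: subset_iff)
    also have "\<dots> = c b v \<odot>\<^bsub>V\<^esub> w"
      using V.M.finsum_singleton[OF assms(2) dual_basis_finite[OF B], of "\<lambda>b'. c b' v \<odot>\<^bsub>V\<^esub> w"] cK assms(3) by auto
    finally show ?thesis .
  qed
  then show ?thesis by (intro bexI[OF _ A_comp[OF a'(1) a(1)]]) simp
qed

end

section \<open>Modules presented by generators and relations\<close>

subsection \<open>Quotient modules\<close>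

lemma quotient_module_simps [simp]:
  "carrier (quotient_module M N) = a_rcosets\<^bsub>M\<^esub> N"
  "zero (quotient_module M N) = N"
  "add (quotient_module M N) = (\<lambda>A B. A <+>\<^bsub>M\<^esub> B)"
  "smult (quotient_module M N) = (\<lambda>a A. \<Union>x\<in>A. N +>\<^bsub>M\<^esub> (a \<odot>\<^bsub>M\<^esub> x))"
  by (simp_all add: quotient_module_def)

locale module_with_submodule =
  fixes K :: "('k, 'd) ring_scheme" and M :: "('k, 'm, 'e) module_scheme" and N :: "'m set"
  assumes sub: "submod K N M"
begin

sublocale M: Module.module K M by (rule submod_module[OF sub])

sublocale N: abelian_subgroup N M
proof -
  have "subgroup N (add_monoid M)"
    using submod_carrier[OF sub] submod_add[OF sub] submod_zero[OF sub] submod_uminus[OF sub]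
    by (intro M.add.subgroupI) (auto simp: a_inv_def)
  then show "abelian_subgroup N M"
    by (intro abelian_subgroupI3 additive_subgroup.intro M.abelian_group_axioms)
qed

abbreviation cls :: "'m \<Rightarrow> 'm set" where "cls x \<equiv> N +>\<^bsub>M\<^esub> x"

lemma cls_eq_iff:
  assumes "x \<in> carrier M" "y \<in> carrier M"
  shows "cls x = cls y \<longleftrightarrow> x \<ominus>\<^bsub>M\<^esub> y \<in> N"
proof
  assume "cls x = cls y"
  then have "x \<in> cls y" using N.a_rcos_self[OF assms(1)] by simp
  then obtain n where n: "n \<in> N" "x = n \<oplus>\<^bsub>M\<^esub> y" by (auto simp: a_r_coset_def r_coset_def)
  then show "x \<ominus>\<^bsub>M\<^esub> y \<in> N"
    using assms submod_carrier[OF sub n(1)] by (simp add: M.minus_eq M.a_assoc M.M.r_neg)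
next
  assume "x \<ominus>\<^bsub>M\<^esub> y \<in> N"
  moreover have "x = (x \<ominus>\<^bsub>M\<^esub> y) \<oplus>\<^bsub>M\<^esub> y"
    using assms by (simp add: M.minus_eq M.a_assoc M.M.l_neg)
  ultimately have "x \<in> cls y" by (auto simp: a_r_coset_def r_coset_def)
  then show "cls x = cls y" using N.a_repr_independence'[of x y] assms by auto
qed

lemma carrier_quotient: "carrier (quotient_module M N) = cls ` carrier M"
  by (auto simp: A_RCOSETS_def' )

lemma cls_add:
  "\<lbrakk>x \<in> carrier M; y \<in> carrier M\<rbrakk> \<Longrightarrow> cls x \<oplus>\<^bsub>quotient_module M N\<^esub> cls y = cls (x \<oplus>\<^bsub>M\<^esub> y)"
  using N.a_rcos_sum by simp

lemma cls_smult:
  assumes "a \<in> carrier K" "x \<in> carrier M"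
  shows "a \<odot>\<^bsub>quotient_module M N\<^esub> cls x = cls (a \<odot>\<^bsub>M\<^esub> x)"
proof -
  have "cls (a \<odot>\<^bsub>M\<^esub> y) = cls (a \<odot>\<^bsub>M\<^esub> x)" if y: "y \<in> cls x" for y
  proof -
    obtain n where n: "n \<in> N" "y = n \<oplus>\<^bsub>M\<^esub> x" using y by (auto simp: a_r_coset_def r_coset_def)
    note nM = submod_carrier[OF sub n(1)]
    have "a \<odot>\<^bsub>M\<^esub> y \<ominus>\<^bsub>M\<^esub> a \<odot>\<^bsub>M\<^esub> x = a \<odot>\<^bsub>M\<^esub> n"
      using assms n nM by (simp add: M.smult_r_distr M.minus_eq M.a_assoc M.M.r_neg)
    then show ?thesis
      using assms n nM submod_smult[OF sub assms(1) n(1)] by (subst cls_eq_iff) auto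
  qed
  moreover have "x \<in> cls x" using N.a_rcos_self[OF assms(2)] .
  ultimately have "(\<Union>y\<in>cls x. cls (a \<odot>\<^bsub>M\<^esub> y)) = cls (a \<odot>\<^bsub>M\<^esub> x)" by blast
  then show ?thesis by simp
qed

lemma cls_zero: "cls \<zero>\<^bsub>M\<^esub> = N"
  using M.M.a_coset_add_zero submod_carrier[OF sub] by (simp add: subset_iff)

lemma quotient_is_module: "Module.module K (quotient_module M N)"
proof (rule module_criteria)
  let ?Q = "quotient_module M N"
  note Q = carrier_quotient cls_add cls_smult
  show "cring K" by (rule M.is_cring)
  have z: "zero ?Q = cls \<zero>\<^bsub>M\<^esub>" by (simp add: cls_zero)
  show "zero ?Q \<in> carrier ?Q" unfolding z Q by auto
  show "\<forall>v w. v \<in> carrier ?Q \<and> w \<in> carrier ?Q \<longrightarrow> v \<oplus>\<^bsub>?Q\<^esub> w \<in> carrier ?Q"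
    unfolding carrier_quotient by (auto simp: cls_add simp del: quotient_module_simps)
  show "\<forall>v\<in>carrier ?Q. \<exists>w\<in>carrier ?Q. v \<oplus>\<^bsub>?Q\<^esub> w = \<zero>\<^bsub>?Q\<^esub>"
    unfolding carrier_quotient z
    by (auto simp: cls_add M.M.r_neg simp del: quotient_module_simps intro!: bexI[of _ "\<ominus>\<^bsub>M\<^esub> _"])
  show "\<forall>c v. c \<in> carrier K \<and> v \<in> carrier ?Q \<longrightarrow> c \<odot>\<^bsub>?Q\<^esub> v \<in> carrier ?Q"
    unfolding carrier_quotient by (auto simp: cls_smult simp del: quotient_module_simps)
  show "\<forall>v w. v \<in> carrier ?Q \<and> w \<in> carrier ?Q \<longrightarrow> v \<oplus>\<^bsub>?Q\<^esub> w = w \<oplus>\<^bsub>?Q\<^esub> v"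
    unfolding carrier_quotient by (auto simp: cls_add M.a_comm simp del: quotient_module_simps)
  show "\<forall>v w x. v \<in> carrier ?Q \<and> w \<in> carrier ?Q \<and> x \<in> carrier ?Q \<longrightarrow>
      v \<oplus>\<^bsub>?Q\<^esub> w \<oplus>\<^bsub>?Q\<^esub> x = v \<oplus>\<^bsub>?Q\<^esub> (w \<oplus>\<^bsub>?Q\<^esub> x)"
    unfolding carrier_quotient by (auto simp: cls_add M.a_assoc simp del: quotient_module_simps)
  show "\<forall>v\<in>carrier ?Q. v \<oplus>\<^bsub>?Q\<^esub> \<zero>\<^bsub>?Q\<^esub> = v"
    unfolding carrier_quotient z by (auto simp: cls_add simp del: quotient_module_simps)
  show "\<forall>a b v. a \<in> carrier K \<and> b \<in> carrier K \<and> v \<in> carrier ?Q \<longrightarrow>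
      (a \<otimes>\<^bsub>K\<^esub> b) \<odot>\<^bsub>?Q\<^esub> v = a \<odot>\<^bsub>?Q\<^esub> (b \<odot>\<^bsub>?Q\<^esub> v)"
    unfolding carrier_quotient by (auto simp: cls_smult M.smult_assoc1 simp del: quotient_module_simps)
  show "\<forall>v\<in>carrier ?Q. \<one>\<^bsub>K\<^esub> \<odot>\<^bsub>?Q\<^esub> v = v"
    unfolding carrier_quotient by (auto simp: cls_smult simp del: quotient_module_simps)
  show "\<forall>a b v. a \<in> carrier K \<and> b \<in> carrier K \<and> v \<in> carrier ?Q \<longrightarrow>
      (a \<oplus>\<^bsub>K\<^esub> b) \<odot>\<^bsub>?Q\<^esub> v = a \<odot>\<^bsub>?Q\<^esub> v \<oplus>\<^bsub>?Q\<^esub> b \<odot>\<^bsub>?Q\<^esub> v"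
    unfolding carrier_quotient
    by (auto simp: cls_smult cls_add M.smult_l_distr simp del: quotient_module_simps)
  show "\<forall>a v w. a \<in> carrier K \<and> v \<in> carrier ?Q \<and> w \<in> carrier ?Q \<longrightarrow>
      a \<odot>\<^bsub>?Q\<^esub> (v \<oplus>\<^bsub>?Q\<^esub> w) = a \<odot>\<^bsub>?Q\<^esub> v \<oplus>\<^bsub>?Q\<^esub> a \<odot>\<^bsub>?Q\<^esub> w"
    unfolding carrier_quotient
    by (auto simp: cls_smult cls_add M.smult_r_distr simp del: quotient_module_simps)
qed

lemma cls_Hom: "cls \<in> Hom K M (quotient_module M N)"
  by (rule homI) (auto simp: carrier_quotient cls_add cls_smult simp del: quotient_module_simps)

end

subsection \<open>Free modules\<close>

lemma free_module_simps [simp]: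
  "carrier (free_module K Z) =
     {f. f \<in> Z \<rightarrow> carrier K \<and> (\<forall>x. x \<notin> Z \<longrightarrow> f x = \<zero>\<^bsub>K\<^esub>) \<and> finite {x. f x \<noteq> \<zero>\<^bsub>K\<^esub>}}"
  "zero (free_module K Z) = (\<lambda>x. \<zero>\<^bsub>K\<^esub>)"
  "add (free_module K Z) = (\<lambda>f h x. f x \<oplus>\<^bsub>K\<^esub> h x)"
  "smult (free_module K Z) = (\<lambda>a f x. a \<otimes>\<^bsub>K\<^esub> f x)"
  by (simp_all add: free_module_def)

lemma module_free_module:
  assumes "cring K"
  shows "Module.module K (free_module K Z)"
proof -
  interpret K: cring K by fact
  let ?F = "free_module K Z"
  have val: "f x \<in> carrier K" if "f \<in> carrier ?F" for f x
    using that by (cases "x \<in> Z") auto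
  have sum: "(\<lambda>x. f x \<oplus>\<^bsub>K\<^esub> h x) \<in> carrier ?F" if "f \<in> carrier ?F" "h \<in> carrier ?F" for f h
  proof -
    have "{x. f x \<oplus>\<^bsub>K\<^esub> h x \<noteq> \<zero>\<^bsub>K\<^esub>} \<subseteq> {x. f x \<noteq> \<zero>\<^bsub>K\<^esub>} \<union> {x. h x \<noteq> \<zero>\<^bsub>K\<^esub>}" by auto
    then have "finite {x. f x \<oplus>\<^bsub>K\<^esub> h x \<noteq> \<zero>\<^bsub>K\<^esub>}" using that by (auto elim: finite_subset)
    then show ?thesis using that by auto
  qed
  have scale: "(\<lambda>x. a \<otimes>\<^bsub>K\<^esub> f x) \<in> carrier ?F" if "a \<in> carrier K" "f \<in> carrier ?F" for a f
  proof -
    have "{x. a \<otimes>\<^bsub>K\<^esub> f x \<noteq> \<zero>\<^bsub>K\<^esub>} \<subseteq> {x. f x \<noteq> \<zero>\<^bsub>K\<^esub>}" using that by auto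
    then have "finite {x. a \<otimes>\<^bsub>K\<^esub> f x \<noteq> \<zero>\<^bsub>K\<^esub>}" using that by (auto elim: finite_subset)
    then show ?thesis using that by auto
  qed
  show ?thesis
  proof (rule module_criteria)
    show "cring K" by fact
    show "\<zero>\<^bsub>?F\<^esub> \<in> carrier ?F" by simp
    show "\<forall>v w. v \<in> carrier ?F \<and> w \<in> carrier ?F \<longrightarrow> v \<oplus>\<^bsub>?F\<^esub> w \<in> carrier ?F"
      using sum by (simp del: free_module_simps(1))
    show "\<forall>c v. c \<in> carrier K \<and> v \<in> carrier ?F \<longrightarrow> c \<odot>\<^bsub>?F\<^esub> v \<in> carrier ?F"
      using scale by (simp del: free_module_simps(1))
    show "\<forall>v\<in>carrier ?F. \<exists>w\<in>carrier ?F. v \<oplus>\<^bsub>?F\<^esub> w = \<zero>\<^bsub>?F\<^esub>"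
    proof
      fix v assume v: "v \<in> carrier ?F"
      have "v x \<oplus>\<^bsub>K\<^esub> (\<ominus>\<^bsub>K\<^esub> \<one>\<^bsub>K\<^esub>) \<otimes>\<^bsub>K\<^esub> v x = \<zero>\<^bsub>K\<^esub>" for x
        using val[OF v, of x] by (simp add: K.l_minus K.r_neg)
      then show "\<exists>w\<in>carrier ?F. v \<oplus>\<^bsub>?F\<^esub> w = \<zero>\<^bsub>?F\<^esub>"
        using scale[OF _ v, of "\<ominus>\<^bsub>K\<^esub> \<one>\<^bsub>K\<^esub>"]
        by (intro bexI[of _ "\<lambda>x. (\<ominus>\<^bsub>K\<^esub> \<one>\<^bsub>K\<^esub>) \<otimes>\<^bsub>K\<^esub> v x"]) (simp_all del: free_module_simps(1))
    qed
  qed (use val in \<open>auto simp: K.a_ac K.m_assoc K.l_distr K.r_distr fun_eq_iff simp del: free_module_simps(1)\<close>)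
qed

lemma free_gen_closed:
  assumes "cring K" "x \<in> Z"
  shows "free_gen K x \<in> carrier (free_module K Z)"
proof -
  interpret K: cring K by fact
  have "{y. (if y = x then \<one>\<^bsub>K\<^esub> else \<zero>\<^bsub>K\<^esub>) \<noteq> \<zero>\<^bsub>K\<^esub>} \<subseteq> {x}" by auto
  then show ?thesis using assms(2) by (auto simp: free_gen_def elim: finite_subset)
qed

lemma free_module_val:
  assumes "cring K" "f \<in> carrier (free_module K Z)"
  shows "f x \<in> carrier K"
proof -
  interpret K: cring K by fact
  show ?thesis using assms(2) by (cases "x \<in> Z") auto
qed

definition linear_extension ::
    "('k, 'd) ring_scheme \<Rightarrow> ('k, 'p, 'e) module_scheme \<Rightarrow> ('x \<Rightarrow> 'p) \<Rightarrow> ('x \<Rightarrow> 'k) \<Rightarrow> 'p" where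
  "linear_extension K P \<beta> f = (\<Oplus>\<^bsub>P\<^esub>x\<in>{x. f x \<noteq> \<zero>\<^bsub>K\<^esub>}. f x \<odot>\<^bsub>P\<^esub> \<beta> x)"

context
  fixes K :: "('k, 'd) ring_scheme" and P :: "('k, 'p, 'e) module_scheme"
    and \<beta> :: "'x \<Rightarrow> 'p" and Z :: "'x set"
  assumes P: "Module.module K P" and \<beta>: "\<And>x. x \<in> Z \<Longrightarrow> \<beta> x \<in> carrier P"
begin

interpretation P: Module.module K P by (rule P)

lemma linear_extension_eq:
  assumes "f \<in> carrier (free_module K Z)" "finite Y" "{x. f x \<noteq> \<zero>\<^bsub>K\<^esub>} \<subseteq> Y" "Y \<subseteq> Z"
  shows "linear_extension K P \<beta> f = (\<Oplus>\<^bsub>P\<^esub>x\<in>Y. f x \<odot>\<^bsub>P\<^esub> \<beta> x)"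
  unfolding linear_extension_def
  using assms \<beta> by (intro P.M.add.finprod_mono_neutral_cong_left) (auto simp: subset_iff Pi_iff)

lemma linear_extension_Hom: "linear_extension K P \<beta> \<in> Hom K (free_module K Z) P"
proof (rule homI)
  let ?F = "free_module K Z"
  interpret F: Module.module K ?F by (rule module_free_module[OF P.is_cring])
  let ?supp = "\<lambda>f. {x. f x \<noteq> \<zero>\<^bsub>K\<^esub>}"
  have supp: "finite (?supp f)" "?supp f \<subseteq> Z" if "f \<in> carrier ?F" for f
    using that by auto
  note val = free_module_val[OF P.is_cring]
  show "linear_extension K P \<beta> f \<in> carrier P" if f: "f \<in> carrier ?F" for f
    unfolding linear_extension_def
    using supp[OF f] val[OF f] \<beta> by (intro P.M.finsum_closed) auto
  show "linear_extension K P \<beta> (f \<oplus>\<^bsub>?F\<^esub> h) = linear_extension K P \<beta> f \<oplus>\<^bsub>P\<^esub> linear_extension K P \<beta> h"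
    if f: "f \<in> carrier ?F" and h: "h \<in> carrier ?F" for f h
  proof -
    let ?Y = "?supp f \<union> ?supp h"
    have fh: "f \<oplus>\<^bsub>?F\<^esub> h \<in> carrier ?F" using f h by (rule F.a_closed)
    have Y: "finite ?Y" "?Y \<subseteq> Z" using supp[OF f] supp[OF h] by auto
    have "linear_extension K P \<beta> (f \<oplus>\<^bsub>?F\<^esub> h) = (\<Oplus>\<^bsub>P\<^esub>x\<in>?Y. (f \<oplus>\<^bsub>?F\<^esub> h) x \<odot>\<^bsub>P\<^esub> \<beta> x)"
      using Y by (intro linear_extension_eq[OF fh]) auto
    also have "\<dots> = (\<Oplus>\<^bsub>P\<^esub>x\<in>?Y. f x \<odot>\<^bsub>P\<^esub> \<beta> x \<oplus>\<^bsub>P\<^esub> h x \<odot>\<^bsub>P\<^esub> \<beta> x)"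
      using Y val[OF f] val[OF h] \<beta> by (intro P.M.finsum_cong') (auto simp: P.smult_l_distr subset_iff)
    also have "\<dots> = (\<Oplus>\<^bsub>P\<^esub>x\<in>?Y. f x \<odot>\<^bsub>P\<^esub> \<beta> x) \<oplus>\<^bsub>P\<^esub> (\<Oplus>\<^bsub>P\<^esub>x\<in>?Y. h x \<odot>\<^bsub>P\<^esub> \<beta> x)"
      using Y val[OF f] val[OF h] \<beta> by (intro P.M.finsum_addf) (auto simp: subset_iff)
    also have "\<dots> = linear_extension K P \<beta> f \<oplus>\<^bsub>P\<^esub> linear_extension K P \<beta> h"
      using Y linear_extension_eq[OF f Y(1) _ Y(2)] linear_extension_eq[OF h Y(1) _ Y(2)] by auto
    finally show ?thesis .
  qed
  show "linear_extension K P \<beta> (a \<odot>\<^bsub>?F\<^esub> f) = a \<odot>\<^bsub>P\<^esub> linear_extension K P \<beta> f"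
    if a: "a \<in> carrier K" and f: "f \<in> carrier ?F" for a f
  proof -
    have af: "a \<odot>\<^bsub>?F\<^esub> f \<in> carrier ?F" using a f by (rule F.smult_closed)
    have "linear_extension K P \<beta> (a \<odot>\<^bsub>?F\<^esub> f) = (\<Oplus>\<^bsub>P\<^esub>x\<in>?supp f. (a \<odot>\<^bsub>?F\<^esub> f) x \<odot>\<^bsub>P\<^esub> \<beta> x)"
      using supp[OF f] a by (intro linear_extension_eq[OF af]) auto
    also have "\<dots> = (\<Oplus>\<^bsub>P\<^esub>x\<in>?supp f. a \<odot>\<^bsub>P\<^esub> (f x \<odot>\<^bsub>P\<^esub> \<beta> x))"
      using supp[OF f] val[OF f] a \<beta> by (intro P.M.finsum_cong') (auto simp: P.smult_assoc1 subset_iff)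
    also have "\<dots> = a \<odot>\<^bsub>P\<^esub> linear_extension K P \<beta> f"
      unfolding linear_extension_def using supp[OF f] val[OF f] a \<beta>
      by (intro P.finsum_smult_ldistr[symmetric]) (auto simp: subset_iff)
    finally show ?thesis .
  qed
qed

lemma linear_extension_free_gen:
  assumes "x \<in> Z"
  shows "linear_extension K P \<beta> (free_gen K x) = \<beta> x"
proof -
  have "linear_extension K P \<beta> (free_gen K x) = (\<Oplus>\<^bsub>P\<^esub>y\<in>{x}. free_gen K x y \<odot>\<^bsub>P\<^esub> \<beta> y)"
    using assms by (intro linear_extension_eq[OF free_gen_closed[OF P.is_cring]]) (auto simp: free_gen_def)
  then show ?thesis using assms \<beta> by (simp add: free_gen_def)
qed

end

lemma free_module_generated:
  assumes "cring K" "submod K U (free_module K Z)" "\<And>x. x \<in> Z \<Longrightarrow> free_gen K x \<in> U"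
  shows "U = carrier (free_module K Z)"
proof
  let ?F = "free_module K Z"
  interpret K: cring K by fact
  interpret F: Module.module K ?F by (rule module_free_module) fact
  show "U \<subseteq> carrier ?F" using submod_carrier[OF assms(2)] by blast
  show "carrier ?F \<subseteq> U"
  proof
    fix f assume f: "f \<in> carrier ?F"
    have "f \<in> U" if "finite Y" "{x. f x \<noteq> \<zero>\<^bsub>K\<^esub>} \<subseteq> Y" "f \<in> carrier ?F" for Y f
      using that
    proof (induction Y arbitrary: f rule: finite_induct)
      case empty
      then have "f = \<zero>\<^bsub>?F\<^esub>" by auto
      then show ?case using submod_zero[OF assms(2)] by simp
    next
      case (insert y Y)
      show ?case
      proof (cases "f y = \<zero>\<^bsub>K\<^esub>")
        case True
        then have "{x. f x \<noteq> \<zero>\<^bsub>K\<^esub>} \<subseteq> Y" using insert.prems by auto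
        then show ?thesis using insert by blast
      next
        case False
        then have y: "y \<in> Z" using insert.prems by auto
        note val = free_module_val[OF assms(1) insert.prems(2)]
        define h where "h = f(y := \<zero>\<^bsub>K\<^esub>)"
        have "{x. h x \<noteq> \<zero>\<^bsub>K\<^esub>} \<subseteq> {x. f x \<noteq> \<zero>\<^bsub>K\<^esub>}" by (auto simp: h_def)
        then have "finite {x. h x \<noteq> \<zero>\<^bsub>K\<^esub>}" using insert.prems by (auto elim: finite_subset)
        then have "h \<in> carrier ?F" using insert.prems by (auto simp: h_def)
        then have hU: "h \<in> U" using insert.prems by (intro insert.IH) (auto simp: h_def)
        have "f = h \<oplus>\<^bsub>?F\<^esub> (f y \<odot>\<^bsub>?F\<^esub> free_gen K y)"
          using val by (auto simp: h_def free_gen_def fun_eq_iff)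
        then show ?thesis
          using submod_add[OF assms(2) hU submod_smult[OF assms(2) val assms(3)[OF y]]] by metis
      qed
    qed
    from this[OF _ order.refl f] show "f \<in> U" using f by simp
  qed
qed

subsection \<open>Presentations\<close>

text \<open>The module with generators \<open>Z\<close> and relators \<open>R\<close>. A map on generators that satisfies the
  relations induces a linear map on it.\<close>

locale presented_module =
  fixes K :: "('k, 'd) ring_scheme" and Z :: "'x set" and R :: "('x \<Rightarrow> 'k) set"
  assumes K_cring: "cring K" and R_free: "R \<subseteq> carrier (free_module K Z)"
begin

abbreviation F where "F \<equiv> free_module K Z"
abbreviation N where "N \<equiv> spn K F R"
abbreviation Q where "Q \<equiv> quotient_module F N"

sublocale F: Module.module K F by (rule module_free_module[OF K_cring])

sublocale module_with_submodule K F N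
  by (rule module_with_submodule.intro[OF span_submod[OF F.module_axioms R_free]])

abbreviation gen :: "'x \<Rightarrow> ('x \<Rightarrow> 'k) set" where "gen x \<equiv> cls (free_gen K x)"

lemma Q_module: "Module.module K Q" by (rule quotient_is_module)

lemma gen_closed: "x \<in> Z \<Longrightarrow> gen x \<in> carrier Q"
  using hom_closed[OF cls_Hom free_gen_closed[OF K_cring]] .

lemma Q_generated:
  assumes "submod K U Q" "\<And>x. x \<in> Z \<Longrightarrow> gen x \<in> U"
  shows "U = carrier Q"
proof -
  have "{f \<in> carrier F. cls f \<in> U} = carrier F"
    using assms by (intro free_module_generated[OF K_cring submod_vimage[OF F.module_axioms cls_Hom]])
      (auto simp: free_gen_closed[OF K_cring] simp del: free_module_simps)
  then have "carrier Q \<subseteq> U" unfolding carrier_quotient by blast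
  then show ?thesis using submod_carrier[OF assms(1)] by blast
qed

lemma Q_hom_eqI:
  assumes "Module.module K P" "f \<in> Hom K Q P" "h \<in> Hom K Q P" "\<And>x. x \<in> Z \<Longrightarrow> f (gen x) = h (gen x)"
    "z \<in> carrier Q"
  shows "f z = h z"
  using Q_generated[OF submod_equalizer[OF Q_module assms(1-3)]] assms(4,5) gen_closed by blast

context
  fixes P :: "('k, 'p, 'e) module_scheme" and \<beta> :: "'x \<Rightarrow> 'p"
  assumes P: "Module.module K P" and \<beta>: "\<And>x. x \<in> Z \<Longrightarrow> \<beta> x \<in> carrier P"
    and relations: "\<And>f. f \<in> R \<Longrightarrow> linear_extension K P \<beta> f = \<zero>\<^bsub>P\<^esub>"
begin

interpretation P: Module.module K P by (rule P)

lemma induced_map_cls: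
  assumes f: "f \<in> carrier F"
  shows "induced_map K P \<beta> (cls f) = linear_extension K P \<beta> f"
proof -
  have ext: "linear_extension K P \<beta> \<in> Hom K F P" by (rule linear_extension_Hom[OF P \<beta>])
  have N0: "linear_extension K P \<beta> n = \<zero>\<^bsub>P\<^esub>" if "n \<in> N" for n
    using span_least[OF submod_kernel[OF F.module_axioms P ext], where Y = R]
      relations R_free that by blast
  have "linear_extension K P \<beta> ` cls f = {linear_extension K P \<beta> f}"
  proof -
    have "linear_extension K P \<beta> h = linear_extension K P \<beta> f" if h: "h \<in> cls f" for h
    proof -
      obtain n where n: "n \<in> N" "h = n \<oplus>\<^bsub>F\<^esub> f" using h by (auto simp: a_r_coset_def r_coset_def)
      have "linear_extension K P \<beta> h = \<zero>\<^bsub>P\<^esub> \<oplus>\<^bsub>P\<^esub> linear_extension K P \<beta> f"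
        unfolding n(2) using hom_add[OF ext submod_carrier[OF sub n(1)] f] N0[OF n(1)]
        by simp
      then show ?thesis using hom_closed[OF ext f] by simp
    qed
    then show ?thesis using N.a_rcos_self[OF f] by blast
  qed
  then show ?thesis unfolding induced_map_def linear_extension_def[abs_def] by simp
qed

lemma induced_map_Hom: "induced_map K P \<beta> \<in> Hom K Q P"
proof (rule homI)
  have ext: "linear_extension K P \<beta> \<in> Hom K F P" by (rule linear_extension_Hom[OF P \<beta>])
  show "induced_map K P \<beta> x \<in> carrier P" if "x \<in> carrier Q" for x
    using that hom_closed[OF ext] unfolding carrier_quotient
    by (auto simp: induced_map_cls simp del: free_module_simps)
  show "induced_map K P \<beta> (x \<oplus>\<^bsub>Q\<^esub> y) = induced_map K P \<beta> x \<oplus>\<^bsub>P\<^esub> induced_map K P \<beta> y"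
    if "x \<in> carrier Q" "y \<in> carrier Q" for x y
    using that F.a_closed unfolding carrier_quotient
    by (auto simp: cls_add induced_map_cls hom_add[OF ext] simp del: free_module_simps quotient_module_simps)
  show "induced_map K P \<beta> (a \<odot>\<^bsub>Q\<^esub> x) = a \<odot>\<^bsub>P\<^esub> induced_map K P \<beta> x"
    if "a \<in> carrier K" "x \<in> carrier Q" for a x
    using that F.smult_closed unfolding carrier_quotient
    by (auto simp: cls_smult induced_map_cls hom_smult[OF ext] simp del: free_module_simps quotient_module_simps)
qed

lemma induced_map_gen: "x \<in> Z \<Longrightarrow> induced_map K P \<beta> (gen x) = \<beta> x"
  using induced_map_cls[OF free_gen_closed[OF K_cring]] linear_extension_free_gen[OF P \<beta>] by simp

end

text \<open>A map on generators that comes from a linear map satisfies the relations automatically.\<close>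

lemma induced_map_eq_hom:
  assumes "Module.module K P" "f \<in> Hom K Q P" "\<And>x. x \<in> Z \<Longrightarrow> f (gen x) = \<beta> x" "z \<in> carrier Q"
  shows "induced_map K P \<beta> z = f z"
proof -
  interpret P: Module.module K P by fact
  have \<beta>: "\<beta> x \<in> carrier P" if "x \<in> Z" for x
    using assms(3)[OF that] hom_closed[OF assms(2) gen_closed[OF that]] by simp
  have fc: "(\<lambda>h. f (cls h)) \<in> Hom K F P" by (rule hom_compose[OF assms(2) cls_Hom])
  have ext: "linear_extension K P \<beta> \<in> Hom K F P" by (rule linear_extension_Hom[OF assms(1) \<beta>])
  have eq: "linear_extension K P \<beta> h = f (cls h)" if "h \<in> carrier F" for h
    using free_module_generated[OF K_cring submod_equalizer[OF F.module_axioms assms(1) ext fc]] that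
    by (auto simp: linear_extension_free_gen[OF assms(1) \<beta>] assms(3) free_gen_closed[OF K_cring]
        simp del: free_module_simps)
  have rel: "linear_extension K P \<beta> h = \<zero>\<^bsub>P\<^esub>" if h: "h \<in> R" for h
  proof -
    have hF: "h \<in> carrier F" using h R_free by blast
    have hN: "h \<in> N" using span_superset[OF F.module_axioms R_free] h by blast
    have "cls h = cls \<zero>\<^bsub>F\<^esub>"
      using cls_eq_iff[OF hF F.M.zero_closed] submod_minus[OF sub hN submod_zero[OF sub]] by blast
    then have "cls h = \<zero>\<^bsub>Q\<^esub>" by (simp only: cls_zero quotient_module_simps)
    then show ?thesis using eq[OF hF] hom_zero[OF Q_module assms(1,2)] by simp
  qed
  have ind: "induced_map K P \<beta> \<in> Hom K Q P" by (rule induced_map_Hom[OF assms(1) \<beta> rel])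
  have "induced_map K P \<beta> (gen x) = f (gen x)" if "x \<in> Z" for x
    using induced_map_gen[of P \<beta>, OF assms(1) \<beta> rel that] assms(3)[OF that] by simp
  then show ?thesis by (rule Q_hom_eqI[OF assms(1) ind assms(2) _ assms(4)])
qed

end

section \<open>Tensor products of two modules\<close>

definition bilinear_map ::
    "('k, 'd) ring_scheme \<Rightarrow> ('k, 'm, 'e) module_scheme \<Rightarrow> ('k, 'n, 'f) module_scheme
      \<Rightarrow> ('k, 'p, 'g) module_scheme \<Rightarrow> ('m \<Rightarrow> 'n \<Rightarrow> 'p) \<Rightarrow> bool" where
  "bilinear_map K M N P \<beta> \<longleftrightarrow>
     (\<forall>y\<in>carrier N. (\<lambda>x. \<beta> x y) \<in> Hom K M P) \<and> (\<forall>x\<in>carrier M. \<beta> x \<in> Hom K N P)"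

locale tensor_product =
  fixes K :: "('k, 'd) ring_scheme" and M :: "('k, 'm, 'e) module_scheme"
    and N :: "('k, 'n, 'f) module_scheme"
  assumes M_module: "Module.module K M" and N_module: "Module.module K N"
begin

sublocale M: Module.module K M by (rule M_module)
sublocale N: Module.module K N by (rule N_module)

abbreviation F where "F \<equiv> free_module K (carrier M \<times> carrier N)"

text \<open>The generators of \<open>tensor_relations\<close>.\<close>

definition relators :: "('m \<times> 'n \<Rightarrow> 'k) set" where
  "relators =
        ({free_gen K (x \<oplus>\<^bsub>M\<^esub> x', y) \<ominus>\<^bsub>F\<^esub> (free_gen K (x, y) \<oplus>\<^bsub>F\<^esub> free_gen K (x', y)) | x x' y.
            x \<in> carrier M \<and> x' \<in> carrier M \<and> y \<in> carrier N} \<union>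
         {free_gen K (x, y \<oplus>\<^bsub>N\<^esub> y') \<ominus>\<^bsub>F\<^esub> (free_gen K (x, y) \<oplus>\<^bsub>F\<^esub> free_gen K (x, y')) | x y y'.
            x \<in> carrier M \<and> y \<in> carrier N \<and> y' \<in> carrier N} \<union>
         {free_gen K (a \<odot>\<^bsub>M\<^esub> x, y) \<ominus>\<^bsub>F\<^esub> a \<odot>\<^bsub>F\<^esub> free_gen K (x, y) | a x y.
            a \<in> carrier K \<and> x \<in> carrier M \<and> y \<in> carrier N} \<union>
         {free_gen K (x, a \<odot>\<^bsub>N\<^esub> y) \<ominus>\<^bsub>F\<^esub> a \<odot>\<^bsub>F\<^esub> free_gen K (x, y) | a x y.
            a \<in> carrier K \<and> x \<in> carrier M \<and> y \<in> carrier N})"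

lemma F_module: "Module.module K F" by (rule module_free_module[OF M.is_cring])

lemma e_closed: "\<lbrakk>x \<in> carrier M; y \<in> carrier N\<rbrakk> \<Longrightarrow> free_gen K (x, y) \<in> carrier F"
  by (rule free_gen_closed[OF M.is_cring]) simp

lemma relators_closed: "relators \<subseteq> carrier F"
proof -
  interpret F: Module.module K F by (rule F_module)
  show ?thesis
    unfolding relators_def by (auto simp del: free_module_simps intro!: F.minus_closed F.a_closed F.smult_closed e_closed)
qed

sublocale pres: presented_module K "carrier M \<times> carrier N" relators
  by (rule presented_module.intro[OF M.is_cring relators_closed])

abbreviation T where "T \<equiv> tensor K M N"
abbreviation pure where "pure \<equiv> pure_tensor K M N"

lemma relations_eq: "tensor_relations K M N = spn K F relators"
  unfolding tensor_relations_def relators_def Let_def ..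

lemma T_eq: "T = quotient_module F (spn K F relators)"
  unfolding tensor_def relations_eq ..

lemma pure_eq: "pure x y = pres.gen (x, y)"
  unfolding pure_tensor_def relations_eq ..

lemma T_module: "Module.module K T"
  unfolding T_eq by (rule pres.Q_module)

lemma pure_closed: "\<lbrakk>x \<in> carrier M; y \<in> carrier N\<rbrakk> \<Longrightarrow> pure x y \<in> carrier T"
  unfolding T_eq pure_eq by (rule pres.gen_closed) simp

lemma T_generated:
  assumes "submod K U T" "\<And>x y. \<lbrakk>x \<in> carrier M; y \<in> carrier N\<rbrakk> \<Longrightarrow> pure x y \<in> U"
  shows "U = carrier T"
  using assms unfolding T_eq pure_eq by (intro pres.Q_generated) auto

lemma T_hom_eqI:
  assumes "Module.module K P" "f \<in> Hom K T P" "h \<in> Hom K T P"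
    and "\<And>x y. \<lbrakk>x \<in> carrier M; y \<in> carrier N\<rbrakk> \<Longrightarrow> f (pure x y) = h (pure x y)" "z \<in> carrier T"
  shows "f z = h z"
  using T_generated[OF submod_equalizer[OF T_module assms(1-3)]] assms(4,5) pure_closed by blast

lemma cls_relator:
  assumes "u \<in> carrier F" "v \<in> carrier F" "u \<ominus>\<^bsub>F\<^esub> v \<in> relators"
  shows "pres.cls u = pres.cls v"
  using pres.cls_eq_iff[OF assms(1,2)] span_superset[OF F_module relators_closed] assms(3) by blast

lemma pure_add_left:
  assumes "x \<in> carrier M" "x' \<in> carrier M" "y \<in> carrier N"
  shows "pure (x \<oplus>\<^bsub>M\<^esub> x') y = pure x y \<oplus>\<^bsub>T\<^esub> pure x' y"
proof -
  have "pres.cls (free_gen K (x \<oplus>\<^bsub>M\<^esub> x', y)) = pres.cls (free_gen K (x, y) \<oplus>\<^bsub>F\<^esub> free_gen K (x', y))"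
  proof (rule cls_relator[OF e_closed pres.F.a_closed[OF e_closed e_closed]])
    show "free_gen K (x \<oplus>\<^bsub>M\<^esub> x', y) \<ominus>\<^bsub>F\<^esub> (free_gen K (x, y) \<oplus>\<^bsub>F\<^esub> free_gen K (x', y)) \<in> relators"
      unfolding relators_def using assms by blast
  qed (use assms in auto)
  then show ?thesis
    unfolding T_eq pure_eq using pres.cls_add[OF e_closed e_closed] assms by metis
qed

lemma pure_add_right:
  assumes "x \<in> carrier M" "y \<in> carrier N" "y' \<in> carrier N"
  shows "pure x (y \<oplus>\<^bsub>N\<^esub> y') = pure x y \<oplus>\<^bsub>T\<^esub> pure x y'"
proof -
  have "pres.cls (free_gen K (x, y \<oplus>\<^bsub>N\<^esub> y')) = pres.cls (free_gen K (x, y) \<oplus>\<^bsub>F\<^esub> free_gen K (x, y'))"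
  proof (rule cls_relator[OF e_closed pres.F.a_closed[OF e_closed e_closed]])
    show "free_gen K (x, y \<oplus>\<^bsub>N\<^esub> y') \<ominus>\<^bsub>F\<^esub> (free_gen K (x, y) \<oplus>\<^bsub>F\<^esub> free_gen K (x, y')) \<in> relators"
      unfolding relators_def using assms by blast
  qed (use assms in auto)
  then show ?thesis
    unfolding T_eq pure_eq using pres.cls_add[OF e_closed e_closed] assms by metis
qed

lemma pure_smult_left:
  assumes "a \<in> carrier K" "x \<in> carrier M" "y \<in> carrier N"
  shows "pure (a \<odot>\<^bsub>M\<^esub> x) y = a \<odot>\<^bsub>T\<^esub> pure x y"
proof -
  have "pres.cls (free_gen K (a \<odot>\<^bsub>M\<^esub> x, y)) = pres.cls (a \<odot>\<^bsub>F\<^esub> free_gen K (x, y))"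
  proof (rule cls_relator[OF e_closed pres.F.smult_closed[OF _ e_closed]])
    show "free_gen K (a \<odot>\<^bsub>M\<^esub> x, y) \<ominus>\<^bsub>F\<^esub> a \<odot>\<^bsub>F\<^esub> free_gen K (x, y) \<in> relators"
      unfolding relators_def using assms by blast
  qed (use assms in auto)
  then show ?thesis
    unfolding T_eq pure_eq using pres.cls_smult[OF _ e_closed] assms by metis
qed

lemma pure_smult_right:
  assumes "a \<in> carrier K" "x \<in> carrier M" "y \<in> carrier N"
  shows "pure x (a \<odot>\<^bsub>N\<^esub> y) = a \<odot>\<^bsub>T\<^esub> pure x y"
proof -
  have "pres.cls (free_gen K (x, a \<odot>\<^bsub>N\<^esub> y)) = pres.cls (a \<odot>\<^bsub>F\<^esub> free_gen K (x, y))"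
  proof (rule cls_relator[OF e_closed pres.F.smult_closed[OF _ e_closed]])
    show "free_gen K (x, a \<odot>\<^bsub>N\<^esub> y) \<ominus>\<^bsub>F\<^esub> a \<odot>\<^bsub>F\<^esub> free_gen K (x, y) \<in> relators"
      unfolding relators_def using assms by blast
  qed (use assms in auto)
  then show ?thesis
    unfolding T_eq pure_eq using pres.cls_smult[OF _ e_closed] assms by metis
qed

lemma pure_bilinear: "bilinear_map K M N T pure"
  unfolding bilinear_map_def
  by (intro conjI ballI homI pure_closed pure_add_left pure_add_right pure_smult_left pure_smult_right)

lemma bilinear_kills_relators:
  assumes P: "Module.module K P" and \<beta>: "bilinear_map K M N P \<beta>" and f: "f \<in> relators"
  shows "linear_extension K P (\<lambda>(x, y). \<beta> x y) f = \<zero>\<^bsub>P\<^esub>"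
proof -
  interpret P: Module.module K P by (rule P)
  have \<beta>1: "(\<lambda>x. \<beta> x y) \<in> Hom K M P" if "y \<in> carrier N" for y
    using \<beta> that by (simp add: bilinear_map_def)
  have \<beta>2: "\<beta> x \<in> Hom K N P" if "x \<in> carrier M" for x
    using \<beta> that by (simp add: bilinear_map_def)
  have val: "\<And>x y. \<lbrakk>x \<in> carrier M; y \<in> carrier N\<rbrakk> \<Longrightarrow> \<beta> x y \<in> carrier P"
    using hom_closed[OF \<beta>2] by blast
  let ?l = "linear_extension K P (\<lambda>(x, y). \<beta> x y)"
  have l: "?l \<in> Hom K F P" by (rule linear_extension_Hom[OF P]) (auto intro: val)
  have le: "?l (free_gen K (x, y)) = \<beta> x y" if "x \<in> carrier M" "y \<in> carrier N" for x y
    using linear_extension_free_gen[OF P, of "carrier M \<times> carrier N" "\<lambda>(x, y). \<beta> x y" "(x, y)"] that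
    by (auto intro: val)
  have diff: "?l (u \<ominus>\<^bsub>F\<^esub> v) = \<zero>\<^bsub>P\<^esub>" if "u \<in> carrier F" "v \<in> carrier F" "?l u = ?l v" for u v
    using hom_minus[OF F_module P l that(1,2)] that(3) hom_closed[OF l that(2)] by (simp add: P.M.r_neg P.minus_eq)
  note ladd = hom_add[OF l e_closed e_closed] and lsm = hom_smult[OF l _ e_closed]
  from f show ?thesis
    unfolding relators_def
  proof (elim UnE CollectE exE conjE)
    fix x x' y
    assume *: "x \<in> carrier M" "x' \<in> carrier M" "y \<in> carrier N"
      and f: "f = free_gen K (x \<oplus>\<^bsub>M\<^esub> x', y) \<ominus>\<^bsub>F\<^esub> (free_gen K (x, y) \<oplus>\<^bsub>F\<^esub> free_gen K (x', y))"
    show "?l f = \<zero>\<^bsub>P\<^esub>" unfolding f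
    proof (rule diff)
      show "?l (free_gen K (x \<oplus>\<^bsub>M\<^esub> x', y)) = ?l (free_gen K (x, y) \<oplus>\<^bsub>F\<^esub> free_gen K (x', y))"
        using * hom_add[OF \<beta>1, of y x x'] by (subst ladd) (auto simp: le)
    qed (use * in \<open>auto intro!: e_closed pres.F.a_closed simp del: free_module_simps\<close>)
  next
    fix x y y'
    assume *: "x \<in> carrier M" "y \<in> carrier N" "y' \<in> carrier N"
      and f: "f = free_gen K (x, y \<oplus>\<^bsub>N\<^esub> y') \<ominus>\<^bsub>F\<^esub> (free_gen K (x, y) \<oplus>\<^bsub>F\<^esub> free_gen K (x, y'))"
    show "?l f = \<zero>\<^bsub>P\<^esub>" unfolding f
    proof (rule diff)
      show "?l (free_gen K (x, y \<oplus>\<^bsub>N\<^esub> y')) = ?l (free_gen K (x, y) \<oplus>\<^bsub>F\<^esub> free_gen K (x, y'))"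
        using * hom_add[OF \<beta>2, of x y y'] by (subst ladd) (auto simp: le)
    qed (use * in \<open>auto intro!: e_closed pres.F.a_closed simp del: free_module_simps\<close>)
  next
    fix a x y
    assume *: "a \<in> carrier K" "x \<in> carrier M" "y \<in> carrier N"
      and f: "f = free_gen K (a \<odot>\<^bsub>M\<^esub> x, y) \<ominus>\<^bsub>F\<^esub> a \<odot>\<^bsub>F\<^esub> free_gen K (x, y)"
    show "?l f = \<zero>\<^bsub>P\<^esub>" unfolding f
    proof (rule diff)
      show "?l (free_gen K (a \<odot>\<^bsub>M\<^esub> x, y)) = ?l (a \<odot>\<^bsub>F\<^esub> free_gen K (x, y))"
        using * hom_smult[OF \<beta>1, of y a x] by (subst lsm) (auto simp: le)
    qed (use * in \<open>auto intro!: e_closed pres.F.smult_closed simp del: free_module_simps\<close>)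
  next
    fix a x y
    assume *: "a \<in> carrier K" "x \<in> carrier M" "y \<in> carrier N"
      and f: "f = free_gen K (x, a \<odot>\<^bsub>N\<^esub> y) \<ominus>\<^bsub>F\<^esub> a \<odot>\<^bsub>F\<^esub> free_gen K (x, y)"
    show "?l f = \<zero>\<^bsub>P\<^esub>" unfolding f
    proof (rule diff)
      show "?l (free_gen K (x, a \<odot>\<^bsub>N\<^esub> y)) = ?l (a \<odot>\<^bsub>F\<^esub> free_gen K (x, y))"
        using * hom_smult[OF \<beta>2, of x a y] by (subst lsm) (auto simp: le)
    qed (use * in \<open>auto intro!: e_closed pres.F.smult_closed simp del: free_module_simps\<close>)
  qed
qed

lemma
  assumes P: "Module.module K P" and \<beta>: "bilinear_map K M N P \<beta>"
  shows tensor_lift_Hom: "induced_map K P (\<lambda>(x, y). \<beta> x y) \<in> Hom K T P"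
    and tensor_lift_pure:
      "\<lbrakk>x \<in> carrier M; y \<in> carrier N\<rbrakk> \<Longrightarrow> induced_map K P (\<lambda>(x, y). \<beta> x y) (pure x y) = \<beta> x y"
proof -
  have val: "(\<lambda>(x, y). \<beta> x y) p \<in> carrier P" if "p \<in> carrier M \<times> carrier N" for p
    using \<beta> that by (auto simp: bilinear_map_def dest: hom_closed)
  note k = bilinear_kills_relators[OF P \<beta>]
  show "induced_map K P (\<lambda>(x, y). \<beta> x y) \<in> Hom K T P"
    unfolding T_eq by (rule pres.induced_map_Hom[OF P val k])
  show "induced_map K P (\<lambda>(x, y). \<beta> x y) (pure x y) = \<beta> x y"
    if "x \<in> carrier M" "y \<in> carrier N"
    using pres.induced_map_gen[of P "\<lambda>(x, y). \<beta> x y" "(x, y)", OF P val k] that unfolding pure_eq by simp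
qed

end

section \<open>Tensor products of finite families\<close>

locale multi_tensor_product =
  fixes K :: "('k, 'd) ring_scheme" and I :: "'i set" and V :: "'i \<Rightarrow> ('k, 'v, 'e) module_scheme"
  assumes K_cring: "cring K" and V_module: "i \<in> I \<Longrightarrow> Module.module K (V i)"
begin

abbreviation Z where "Z \<equiv> (\<Pi>\<^sub>E i\<in>I. carrier (V i))"
abbreviation F where "F \<equiv> free_module K Z"
abbreviation T where "T \<equiv> multi_tensor K I V"
abbreviation pure where "pure \<equiv> pure_multi_tensor K I V"

text \<open>The generators of \<open>multi_tensor_relations\<close>.\<close>

definition relators :: "(('i \<Rightarrow> 'v) \<Rightarrow> 'k) set" where
  "relators =
     {free_gen K (t(i := x \<oplus>\<^bsub>V i\<^esub> y)) \<ominus>\<^bsub>F\<^esub> (free_gen K (t(i := x)) \<oplus>\<^bsub>F\<^esub> free_gen K (t(i := y))) | t i x y.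
            t \<in> Z \<and> i \<in> I \<and> x \<in> carrier (V i) \<and> y \<in> carrier (V i)} \<union>
     {free_gen K (t(i := a \<odot>\<^bsub>V i\<^esub> x)) \<ominus>\<^bsub>F\<^esub> a \<odot>\<^bsub>F\<^esub> free_gen K (t(i := x)) | t i a x.
            t \<in> Z \<and> i \<in> I \<and> a \<in> carrier K \<and> x \<in> carrier (V i)}"

text \<open>Membership of \<open>\<beta> t\<close> in \<open>P\<close> is required separately because it does not follow from the second condition
  when \<open>I\<close> is empty.\<close>

definition multilinear :: "('k, 'p, 'f) module_scheme \<Rightarrow> (('i \<Rightarrow> 'v) \<Rightarrow> 'p) \<Rightarrow> bool" where
  "multilinear P \<beta> \<longleftrightarrow>
     (\<forall>t\<in>Z. \<beta> t \<in> carrier P) \<and> (\<forall>t\<in>Z. \<forall>i\<in>I. (\<lambda>x. \<beta> (t(i := x))) \<in> Hom K (V i) P)"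

lemma Z_upd: "\<lbrakk>t \<in> Z; i \<in> I; x \<in> carrier (V i)\<rbrakk> \<Longrightarrow> t(i := x) \<in> Z"
  by (auto simp: PiE_iff extensional_def)

lemma V_add_closed:
  "\<lbrakk>i \<in> I; x \<in> carrier (V i); y \<in> carrier (V i)\<rbrakk> \<Longrightarrow> x \<oplus>\<^bsub>V i\<^esub> y \<in> carrier (V i)"
  using abelian_monoid.a_closed[OF abelian_group.axioms(1)[OF Module.module.axioms(2)[OF V_module]]] .

lemma V_smult_closed:
  "\<lbrakk>i \<in> I; a \<in> carrier K; x \<in> carrier (V i)\<rbrakk> \<Longrightarrow> a \<odot>\<^bsub>V i\<^esub> x \<in> carrier (V i)"
  using Module.module.smult_closed[OF V_module] .

lemma F_module: "Module.module K F" by (rule module_free_module[OF K_cring])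

lemma e_closed: "t \<in> Z \<Longrightarrow> free_gen K t \<in> carrier F"
  by (rule free_gen_closed[OF K_cring])

lemma relators_closed: "relators \<subseteq> carrier F"
proof -
  interpret F: Module.module K F by (rule F_module)
  show ?thesis
    unfolding relators_def
    by (auto simp del: free_module_simps PiE_iff
        intro!: F.minus_closed F.a_closed F.smult_closed e_closed Z_upd V_add_closed V_smult_closed)
qed

sublocale pres: presented_module K Z relators
  by (rule presented_module.intro[OF K_cring relators_closed])

lemma relations_eq: "multi_tensor_relations K I V = spn K F relators"
  unfolding multi_tensor_relations_def relators_def Let_def ..

lemma T_eq: "T = quotient_module F (spn K F relators)"
  unfolding multi_tensor_def relations_eq ..

lemma pure_eq: "pure t = pres.gen t"
  unfolding pure_multi_tensor_def relations_eq ..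

lemma T_module: "Module.module K T"
  unfolding T_eq by (rule pres.Q_module)

lemma pure_closed: "t \<in> Z \<Longrightarrow> pure t \<in> carrier T"
  unfolding T_eq pure_eq by (rule pres.gen_closed)

lemma T_generated:
  assumes "submod K U T" "\<And>t. t \<in> Z \<Longrightarrow> pure t \<in> U"
  shows "U = carrier T"
  using assms unfolding T_eq pure_eq by (rule pres.Q_generated)

lemma T_hom_eqI:
  assumes "Module.module K P" "f \<in> Hom K T P" "h \<in> Hom K T P"
    and "\<And>t. t \<in> Z \<Longrightarrow> f (pure t) = h (pure t)" "z \<in> carrier T"
  shows "f z = h z"
  using assms unfolding T_eq pure_eq by (rule pres.Q_hom_eqI)

lemma cls_relator:
  assumes "u \<in> carrier F" "v \<in> carrier F" "u \<ominus>\<^bsub>F\<^esub> v \<in> relators"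
  shows "pres.cls u = pres.cls v"
  using pres.cls_eq_iff[OF assms(1,2)] span_superset[OF F_module relators_closed] assms(3) by blast

lemma pure_add:
  assumes "t \<in> Z" "i \<in> I" "x \<in> carrier (V i)" "y \<in> carrier (V i)"
  shows "pure (t(i := x \<oplus>\<^bsub>V i\<^esub> y)) = pure (t(i := x)) \<oplus>\<^bsub>T\<^esub> pure (t(i := y))"
proof -
  have Zs: "t(i := x \<oplus>\<^bsub>V i\<^esub> y) \<in> Z" "t(i := x) \<in> Z" "t(i := y) \<in> Z"
    using assms by (auto intro!: Z_upd V_add_closed simp del: PiE_iff)
  have "pres.cls (free_gen K (t(i := x \<oplus>\<^bsub>V i\<^esub> y))) =
      pres.cls (free_gen K (t(i := x)) \<oplus>\<^bsub>F\<^esub> free_gen K (t(i := y)))"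
  proof (rule cls_relator[OF e_closed pres.F.a_closed[OF e_closed e_closed], OF Zs])
    show "free_gen K (t(i := x \<oplus>\<^bsub>V i\<^esub> y)) \<ominus>\<^bsub>F\<^esub> (free_gen K (t(i := x)) \<oplus>\<^bsub>F\<^esub> free_gen K (t(i := y))) \<in> relators"
      unfolding relators_def using assms by blast
  qed
  then show ?thesis
    unfolding T_eq pure_eq using pres.cls_add[OF e_closed e_closed, OF Zs(2,3)] by metis
qed

lemma pure_smult:
  assumes "t \<in> Z" "i \<in> I" "a \<in> carrier K" "x \<in> carrier (V i)"
  shows "pure (t(i := a \<odot>\<^bsub>V i\<^esub> x)) = a \<odot>\<^bsub>T\<^esub> pure (t(i := x))"
proof -
  have Zs: "t(i := a \<odot>\<^bsub>V i\<^esub> x) \<in> Z" "t(i := x) \<in> Z"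
    using assms by (auto intro!: Z_upd V_smult_closed simp del: PiE_iff)
  have "pres.cls (free_gen K (t(i := a \<odot>\<^bsub>V i\<^esub> x))) = pres.cls (a \<odot>\<^bsub>F\<^esub> free_gen K (t(i := x)))"
  proof (rule cls_relator[OF e_closed[OF Zs(1)] pres.F.smult_closed[OF assms(3) e_closed[OF Zs(2)]]])
    show "free_gen K (t(i := a \<odot>\<^bsub>V i\<^esub> x)) \<ominus>\<^bsub>F\<^esub> a \<odot>\<^bsub>F\<^esub> free_gen K (t(i := x)) \<in> relators"
      unfolding relators_def using assms by blast
  qed
  then show ?thesis
    unfolding T_eq pure_eq using pres.cls_smult[OF assms(3) e_closed[OF Zs(2)]] by metis
qed

lemma pure_Hom: "\<lbrakk>t \<in> Z; i \<in> I\<rbrakk> \<Longrightarrow> (\<lambda>x. pure (t(i := x))) \<in> Hom K (V i) T"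
  by (intro homI pure_closed Z_upd pure_add pure_smult)

lemma multilinear_kills_relators:
  assumes P: "Module.module K P" and \<beta>: "multilinear P \<beta>" and f: "f \<in> relators"
  shows "linear_extension K P \<beta> f = \<zero>\<^bsub>P\<^esub>"
proof -
  interpret P: Module.module K P by (rule P)
  have val: "\<And>t. t \<in> Z \<Longrightarrow> \<beta> t \<in> carrier P" using \<beta> by (auto simp: multilinear_def)
  have \<beta>1: "(\<lambda>x. \<beta> (t(i := x))) \<in> Hom K (V i) P" if "t \<in> Z" "i \<in> I" for t i
    using \<beta> that by (auto simp: multilinear_def)
  let ?l = "linear_extension K P \<beta>"
  have l: "?l \<in> Hom K F P" by (rule linear_extension_Hom[OF P val])
  have le: "?l (free_gen K t) = \<beta> t" if "t \<in> Z" for t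
    by (rule linear_extension_free_gen[OF P val that])
  have diff: "?l (u \<ominus>\<^bsub>F\<^esub> v) = \<zero>\<^bsub>P\<^esub>" if "u \<in> carrier F" "v \<in> carrier F" "?l u = ?l v" for u v
    using hom_minus[OF F_module P l that(1,2)] that(3) hom_closed[OF l that(2)] by (simp add: P.M.r_neg P.minus_eq)
  from f show ?thesis
    unfolding relators_def
  proof (elim UnE CollectE exE conjE)
    fix t i x y
    assume *: "t \<in> Z" "i \<in> I" "x \<in> carrier (V i)" "y \<in> carrier (V i)"
      and f: "f = free_gen K (t(i := x \<oplus>\<^bsub>V i\<^esub> y)) \<ominus>\<^bsub>F\<^esub> (free_gen K (t(i := x)) \<oplus>\<^bsub>F\<^esub> free_gen K (t(i := y)))"
    have Zs: "t(i := x \<oplus>\<^bsub>V i\<^esub> y) \<in> Z" "t(i := x) \<in> Z" "t(i := y) \<in> Z"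
      using * by (auto intro!: Z_upd V_add_closed simp del: PiE_iff)
    show "?l f = \<zero>\<^bsub>P\<^esub>" unfolding f
    proof (rule diff[OF e_closed pres.F.a_closed[OF e_closed e_closed], OF Zs])
      show "?l (free_gen K (t(i := x \<oplus>\<^bsub>V i\<^esub> y))) = ?l (free_gen K (t(i := x)) \<oplus>\<^bsub>F\<^esub> free_gen K (t(i := y)))"
        using hom_add[OF \<beta>1[OF *(1,2)] *(3,4)] le[OF Zs(1)] le[OF Zs(2)] le[OF Zs(3)]
          hom_add[OF l e_closed[OF Zs(2)] e_closed[OF Zs(3)]] by metis
    qed
  next
    fix t i a x
    assume *: "t \<in> Z" "i \<in> I" "a \<in> carrier K" "x \<in> carrier (V i)"
      and f: "f = free_gen K (t(i := a \<odot>\<^bsub>V i\<^esub> x)) \<ominus>\<^bsub>F\<^esub> a \<odot>\<^bsub>F\<^esub> free_gen K (t(i := x))"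
    have Zs: "t(i := a \<odot>\<^bsub>V i\<^esub> x) \<in> Z" "t(i := x) \<in> Z"
      using * by (auto intro!: Z_upd V_smult_closed simp del: PiE_iff)
    show "?l f = \<zero>\<^bsub>P\<^esub>" unfolding f
    proof (rule diff[OF e_closed[OF Zs(1)] pres.F.smult_closed[OF *(3) e_closed[OF Zs(2)]]])
      show "?l (free_gen K (t(i := a \<odot>\<^bsub>V i\<^esub> x))) = ?l (a \<odot>\<^bsub>F\<^esub> free_gen K (t(i := x)))"
        using hom_smult[OF \<beta>1[OF *(1,2)] *(3,4)] le[OF Zs(1)] le[OF Zs(2)]
          hom_smult[OF l *(3) e_closed[OF Zs(2)]] by metis
    qed
  qed
qed

lemma
  assumes P: "Module.module K P" and \<beta>: "multilinear P \<beta>"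
  shows lift_Hom: "induced_map K P \<beta> \<in> Hom K T P"
    and lift_pure: "t \<in> Z \<Longrightarrow> induced_map K P \<beta> (pure t) = \<beta> t"
proof -
  have val: "\<And>t. t \<in> Z \<Longrightarrow> \<beta> t \<in> carrier P" using \<beta> by (auto simp: multilinear_def)
  note k = multilinear_kills_relators[OF P \<beta>]
  show "induced_map K P \<beta> \<in> Hom K T P"
    unfolding T_eq by (rule pres.induced_map_Hom[OF P val k])
  show "induced_map K P \<beta> (pure t) = \<beta> t" if "t \<in> Z"
    unfolding pure_eq by (rule pres.induced_map_gen[OF P val k that])
qed

lemma induced_map_eq_hom:
  assumes "Module.module K P" "f \<in> Hom K T P" "\<And>t. t \<in> Z \<Longrightarrow> f (pure t) = \<beta> t" "z \<in> carrier T"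
  shows "induced_map K P \<beta> z = f z"
  using assms unfolding T_eq pure_eq by (rule pres.induced_map_eq_hom)

end

section \<open>Operators on one tensor factor\<close>

lemma finsum_minus:
  assumes "abelian_group G" "\<And>i. i \<in> I \<Longrightarrow> f i \<in> carrier G" "\<And>i. i \<in> I \<Longrightarrow> h i \<in> carrier G"
  shows "(\<Oplus>\<^bsub>G\<^esub>i\<in>I. f i \<ominus>\<^bsub>G\<^esub> h i) = (\<Oplus>\<^bsub>G\<^esub>i\<in>I. f i) \<ominus>\<^bsub>G\<^esub> (\<Oplus>\<^bsub>G\<^esub>i\<in>I. h i)"
proof -
  interpret G: abelian_group G by fact
  have c: "f \<in> I \<rightarrow> carrier G" "h \<in> I \<rightarrow> carrier G" "(\<lambda>i. f i \<ominus>\<^bsub>G\<^esub> h i) \<in> I \<rightarrow> carrier G"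
    using assms by auto
  have "(\<Oplus>\<^bsub>G\<^esub>i\<in>I. f i) = (\<Oplus>\<^bsub>G\<^esub>i\<in>I. (f i \<ominus>\<^bsub>G\<^esub> h i) \<oplus>\<^bsub>G\<^esub> h i)"
    using assms by (intro G.finsum_cong') (auto simp: G.minus_eq G.a_assoc G.l_neg)
  also have "\<dots> = (\<Oplus>\<^bsub>G\<^esub>i\<in>I. f i \<ominus>\<^bsub>G\<^esub> h i) \<oplus>\<^bsub>G\<^esub> (\<Oplus>\<^bsub>G\<^esub>i\<in>I. h i)"
    by (rule G.finsum_addf[OF c(3,2)])
  finally show ?thesis
    using G.finsum_closed[OF c(3)] G.finsum_closed[OF c(2)] by (simp add: G.minus_eq G.a_assoc G.r_neg)
qed

text \<open>The operator \<open>id \<otimes> \<dots> \<otimes> a \<otimes> \<dots> \<otimes> id\<close> with \<open>a\<close> in position \<open>i\<close>.\<close>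

definition slot_op ::
    "('k, 'd) ring_scheme \<Rightarrow> 'i set \<Rightarrow> ('i \<Rightarrow> ('k, 'v, 'e) module_scheme) \<Rightarrow> 'i \<Rightarrow> ('v \<Rightarrow> 'v)
      \<Rightarrow> (('i \<Rightarrow> 'v) \<Rightarrow> 'k) set \<Rightarrow> (('i \<Rightarrow> 'v) \<Rightarrow> 'k) set" where
  "slot_op K I V i a =
     induced_map K (multi_tensor K I V) (\<lambda>t. pure_multi_tensor K I V (t(i := a (t i))))"

context multi_tensor_product
begin

sublocale T: Module.module K T by (rule T_module)

abbreviation slot where "slot \<equiv> slot_op K I V"
abbreviation End where "End i \<equiv> Hom K (V i) (V i)"

lemma Z_val: "\<lbrakk>t \<in> Z; i \<in> I\<rbrakk> \<Longrightarrow> t i \<in> carrier (V i)"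
  by auto

lemma Z_upd_op:
  assumes "i \<in> I" "a \<in> End i" "t \<in> Z"
  shows "t(i := a (t i)) \<in> Z"
  by (rule Z_upd[OF assms(3,1) hom_closed[OF assms(2) Z_val[OF assms(3,1)]]])

lemma slot_multilinear:
  assumes "i \<in> I" "a \<in> End i"
  shows "multilinear T (\<lambda>t. pure (t(i := a (t i))))"
  unfolding multilinear_def
proof (intro conjI ballI)
  show "pure (t(i := a (t i))) \<in> carrier T" if "t \<in> Z" for t
    by (intro pure_closed Z_upd_op assms that)
  show "(\<lambda>x. pure ((t(j := x))(i := a ((t(j := x)) i)))) \<in> Hom K (V j) T" if t: "t \<in> Z" and j: "j \<in> I" for t j
  proof (cases "j = i")
    case True
    have "(\<lambda>x. pure (t(i := a x))) \<in> Hom K (V i) T"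
      using hom_compose[OF pure_Hom[OF t assms(1)] assms(2)] .
    then show ?thesis using True by simp
  next
    case False
    have "(\<lambda>x. pure ((t(i := a (t i)))(j := x))) \<in> Hom K (V j) T"
      by (intro pure_Hom Z_upd_op assms t j)
    then show ?thesis using False by (simp add: fun_upd_twist)
  qed
qed

lemma slot_Hom: "\<lbrakk>i \<in> I; a \<in> End i\<rbrakk> \<Longrightarrow> slot i a \<in> Hom K T T"
  unfolding slot_op_def by (intro lift_Hom T_module slot_multilinear)

lemma slot_closed: "\<lbrakk>i \<in> I; a \<in> End i; z \<in> carrier T\<rbrakk> \<Longrightarrow> slot i a z \<in> carrier T"
  using hom_closed[OF slot_Hom] .

lemma slot_pure: "\<lbrakk>i \<in> I; a \<in> End i; t \<in> Z\<rbrakk> \<Longrightarrow> slot i a (pure t) = pure (t(i := a (t i)))"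
  unfolding slot_op_def by (intro lift_pure T_module slot_multilinear)

lemma slot_cong:
  assumes "i \<in> I" "a \<in> End i" "b \<in> End i" "\<And>v. v \<in> carrier (V i) \<Longrightarrow> a v = b v" "z \<in> carrier T"
  shows "slot i a z = slot i b z"
  using assms
  by (intro T_hom_eqI[OF T_module slot_Hom[OF assms(1,2)] slot_Hom[OF assms(1,3)] _ assms(5)])
     (simp add: slot_pure Z_val del: PiE_iff)

lemma slot_id:
  assumes "i \<in> I" "z \<in> carrier T"
  shows "slot i (\<lambda>v. v) z = z"
  by (intro T_hom_eqI[OF T_module slot_Hom[OF assms(1) hom_id] hom_id _ assms(2)])
     (simp add: slot_pure[OF assms(1) hom_id])

lemma slot_add:
  assumes "i \<in> I" "a \<in> End i" "b \<in> End i" "z \<in> carrier T"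
  shows "slot i (\<lambda>v. a v \<oplus>\<^bsub>V i\<^esub> b v) z = slot i a z \<oplus>\<^bsub>T\<^esub> slot i b z"
proof -
  note ab = hom_plus[OF V_module[OF assms(1)] assms(2,3)]
  show ?thesis
  proof (rule T_hom_eqI[OF T_module slot_Hom[OF assms(1) ab]
        hom_plus[OF T_module slot_Hom[OF assms(1,2)] slot_Hom[OF assms(1,3)]] _ assms(4)])
    fix t assume t: "t \<in> Z"
    show "slot i (\<lambda>v. a v \<oplus>\<^bsub>V i\<^esub> b v) (pure t) = slot i a (pure t) \<oplus>\<^bsub>T\<^esub> slot i b (pure t)"
      using pure_add[OF t assms(1) hom_closed[OF assms(2) Z_val[OF t assms(1)]] hom_closed[OF assms(3) Z_val[OF t assms(1)]]]
      by (simp only: slot_pure[OF assms(1) ab t] slot_pure[OF assms(1,2) t] slot_pure[OF assms(1,3) t])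
  qed
qed

lemma slot_smult:
  assumes "i \<in> I" "r \<in> carrier K" "a \<in> End i" "z \<in> carrier T"
  shows "slot i (\<lambda>v. r \<odot>\<^bsub>V i\<^esub> a v) z = r \<odot>\<^bsub>T\<^esub> slot i a z"
proof -
  note ra = hom_scale[OF V_module[OF assms(1)] assms(3,2)]
  show ?thesis
  proof (rule T_hom_eqI[OF T_module slot_Hom[OF assms(1) ra]
        hom_scale[OF T_module slot_Hom[OF assms(1,3)] assms(2)] _ assms(4)])
    fix t assume t: "t \<in> Z"
    show "slot i (\<lambda>v. r \<odot>\<^bsub>V i\<^esub> a v) (pure t) = r \<odot>\<^bsub>T\<^esub> slot i a (pure t)"
      using pure_smult[OF t assms(1,2) hom_closed[OF assms(3) Z_val[OF t assms(1)]]]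
      by (simp only: slot_pure[OF assms(1) ra t] slot_pure[OF assms(1,3) t])
  qed
qed

lemma slot_comp:
  assumes "i \<in> I" "a \<in> End i" "b \<in> End i" "z \<in> carrier T"
  shows "slot i (\<lambda>v. a (b v)) z = slot i a (slot i b z)"
proof -
  note ab = hom_compose[OF assms(2,3)]
  show ?thesis
  proof (rule T_hom_eqI[OF T_module slot_Hom[OF assms(1) ab]
        hom_compose[OF slot_Hom[OF assms(1,2)] slot_Hom[OF assms(1,3)]] _ assms(4)])
    fix t assume t: "t \<in> Z"
    show "slot i (\<lambda>v. a (b v)) (pure t) = slot i a (slot i b (pure t))"
      using slot_pure[OF assms(1,2) Z_upd_op[OF assms(1,3) t]]
      by (simp add: slot_pure[OF assms(1) ab t] slot_pure[OF assms(1,3) t] del: PiE_iff)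
  qed
qed

lemma slot_commute:
  assumes "i \<in> I" "j \<in> I" "i \<noteq> j" "a \<in> End i" "b \<in> End j" "z \<in> carrier T"
  shows "slot i a (slot j b z) = slot j b (slot i a z)"
proof (rule T_hom_eqI[OF T_module hom_compose[OF slot_Hom[OF assms(1,4)] slot_Hom[OF assms(2,5)]]
      hom_compose[OF slot_Hom[OF assms(2,5)] slot_Hom[OF assms(1,4)]] _ assms(6)])
  fix t assume t: "t \<in> Z"
  show "slot i a (slot j b (pure t)) = slot j b (slot i a (pure t))"
    using slot_pure[OF assms(1,4) Z_upd_op[OF assms(2,5) t]] slot_pure[OF assms(2,5) Z_upd_op[OF assms(1,4) t]] assms(3)
    by (simp add: slot_pure[OF assms(1,4) t] slot_pure[OF assms(2,5) t] fun_upd_twist del: PiE_iff)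
qed

lemma slot_finsum:
  assumes "i \<in> I" "\<And>j. j \<in> J \<Longrightarrow> a j \<in> End i" "z \<in> carrier T"
  shows "slot i (\<lambda>v. \<Oplus>\<^bsub>V i\<^esub>j\<in>J. a j v) z = (\<Oplus>\<^bsub>T\<^esub>j\<in>J. slot i (a j) z)"
proof -
  note Vi = V_module[OF assms(1)]
  interpret Vi: Module.module K "V i" by (rule Vi)
  have z: "slot i (\<lambda>v. \<zero>\<^bsub>V i\<^esub>) z = \<zero>\<^bsub>T\<^esub>"
  proof -
    have "slot i (\<lambda>v. \<zero>\<^bsub>K\<^esub> \<odot>\<^bsub>V i\<^esub> (\<lambda>v. \<zero>\<^bsub>V i\<^esub>) v) z = \<zero>\<^bsub>K\<^esub> \<odot>\<^bsub>T\<^esub> slot i (\<lambda>v. \<zero>\<^bsub>V i\<^esub>) z"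
      by (rule slot_smult[OF assms(1) _ hom_zero_map[OF Vi] assms(3)]) simp
    then show ?thesis using slot_closed[OF assms(1) hom_zero_map[OF Vi] assms(3)] by simp
  qed
  show ?thesis using assms(2)
  proof (induction J rule: infinite_finite_induct)
    case (insert x J)
    have s: "(\<lambda>v. \<Oplus>\<^bsub>V i\<^esub>j\<in>J. a j v) \<in> End i"
      using insert.prems by (intro hom_finsum_map[OF Vi Vi]) auto
    have ax: "a x \<in> End i" using insert.prems by auto
    have "slot i (\<lambda>v. \<Oplus>\<^bsub>V i\<^esub>j\<in>insert x J. a j v) z = slot i (\<lambda>v. a x v \<oplus>\<^bsub>V i\<^esub> (\<Oplus>\<^bsub>V i\<^esub>j\<in>J. a j v)) z"
    proof (rule slot_cong[OF assms(1) _ hom_plus[OF Vi ax s] _ assms(3)])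
      show "(\<lambda>v. \<Oplus>\<^bsub>V i\<^esub>j\<in>insert x J. a j v) \<in> End i"
        using insert.prems by (intro hom_finsum_map[OF Vi Vi]) auto
      show "(\<Oplus>\<^bsub>V i\<^esub>j\<in>insert x J. a j v) = a x v \<oplus>\<^bsub>V i\<^esub> (\<Oplus>\<^bsub>V i\<^esub>j\<in>J. a j v)" if "v \<in> carrier (V i)" for v
        using insert.hyps that by (subst Vi.M.finsum_insert) (auto simp: Pi_iff intro: hom_closed[OF insert.prems])
    qed
    also have "\<dots> = slot i (a x) z \<oplus>\<^bsub>T\<^esub> (\<Oplus>\<^bsub>T\<^esub>j\<in>J. slot i (a j) z)"
      using slot_add[OF assms(1) ax s assms(3)] insert by simp
    also have "\<dots> = (\<Oplus>\<^bsub>T\<^esub>j\<in>insert x J. slot i (a j) z)"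
      using insert.hyps by (subst T.M.finsum_insert)
        (auto simp: Pi_iff intro: slot_closed[OF assms(1) insert.prems assms(3)])
    finally show ?case .
  qed (simp_all add: z)
qed

subsection \<open>The tensor product representation\<close>

definition total_op :: "('i \<Rightarrow> 'v \<Rightarrow> 'v) \<Rightarrow> (('i \<Rightarrow> 'v) \<Rightarrow> 'k) set \<Rightarrow> (('i \<Rightarrow> 'v) \<Rightarrow> 'k) set" where
  "total_op a v = (\<Oplus>\<^bsub>T\<^esub>i\<in>I. slot i (a i) v)"

lemma total_op_Hom: "(\<And>i. i \<in> I \<Longrightarrow> a i \<in> End i) \<Longrightarrow> total_op a \<in> Hom K T T"
  unfolding total_op_def[abs_def] by (intro hom_finsum_map T_module slot_Hom)

lemma multi_tensor_rep_eq:
  assumes "\<And>i. i \<in> I \<Longrightarrow> \<sigma> i z \<in> End i" "v \<in> carrier T"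
  shows "multi_tensor_rep K I V \<sigma> z v = total_op (\<lambda>i. \<sigma> i z) v"
  unfolding multi_tensor_rep_def
proof (rule induced_map_eq_hom[OF T_module total_op_Hom[OF assms(1)] _ assms(2)])
  fix t assume t: "t \<in> Z"
  show "total_op (\<lambda>i. \<sigma> i z) (pure t) = (\<Oplus>\<^bsub>T\<^esub>i\<in>I. pure (t(i := \<sigma> i z (t i))))"
    unfolding total_op_def using slot_pure[OF _ assms(1) t] pure_closed[OF Z_upd_op[OF _ assms(1) t]]
    by (intro T.M.finsum_cong') (simp_all del: PiE_iff)
qed

text \<open>Operators in different slots commute, so that only the diagonal terms of the commutator remain.\<close>

lemma total_op_commutator:
  assumes fin: "finite I"
    and a: "\<And>i. i \<in> I \<Longrightarrow> a i \<in> End i" and b: "\<And>i. i \<in> I \<Longrightarrow> b i \<in> End i"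
    and c: "\<And>i. i \<in> I \<Longrightarrow> c i \<in> End i"
    and comm: "\<And>i v. \<lbrakk>i \<in> I; v \<in> carrier (V i)\<rbrakk> \<Longrightarrow> c i v = a i (b i v) \<ominus>\<^bsub>V i\<^esub> b i (a i v)"
    and z: "z \<in> carrier T"
  shows "total_op c z = total_op a (total_op b z) \<ominus>\<^bsub>T\<^esub> total_op b (total_op a z)"
proof -
  note sc = slot_closed
  have slot_comm: "slot i (c i) w = slot i (a i) (slot i (b i) w) \<ominus>\<^bsub>T\<^esub> slot i (b i) (slot i (a i) w)"
    if i: "i \<in> I" and w: "w \<in> carrier T" for i w
  proof -
    note Vi = V_module[OF i]
    interpret Vi: Module.module K "V i" by (rule Vi)
    note ab = hom_compose[OF a[OF i] b[OF i]] and ba = hom_compose[OF b[OF i] a[OF i]]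
    note nba = hom_scale[OF Vi ba, of "\<ominus>\<^bsub>K\<^esub> \<one>\<^bsub>K\<^esub>"]
    have m1: "\<ominus>\<^bsub>K\<^esub> \<one>\<^bsub>K\<^esub> \<in> carrier K" by simp
    have "slot i (c i) w = slot i (\<lambda>v. a i (b i v) \<oplus>\<^bsub>V i\<^esub> (\<ominus>\<^bsub>K\<^esub> \<one>\<^bsub>K\<^esub>) \<odot>\<^bsub>V i\<^esub> b i (a i v)) w"
      by (rule slot_cong[OF i c[OF i] hom_plus[OF Vi ab nba[OF m1]] _ w])
         (simp add: comm[OF i] hom_closed[OF ab] hom_closed[OF ba] Vi.smult_l_minus Vi.minus_eq)
    also have "\<dots> = slot i (\<lambda>v. a i (b i v)) w \<oplus>\<^bsub>T\<^esub> (\<ominus>\<^bsub>K\<^esub> \<one>\<^bsub>K\<^esub>) \<odot>\<^bsub>T\<^esub> slot i (\<lambda>v. b i (a i v)) w"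
      using slot_add[OF i ab nba[OF m1] w] slot_smult[OF i m1 ba w] by simp
    also have "\<dots> = slot i (a i) (slot i (b i) w) \<ominus>\<^bsub>T\<^esub> slot i (b i) (slot i (a i) w)"
      using slot_comp[OF i a[OF i] b[OF i] w] slot_comp[OF i b[OF i] a[OF i] w] sc[OF i a[OF i] w] sc[OF i b[OF i]]
      by (simp add: T.smult_l_minus T.minus_eq)
    finally show ?thesis .
  qed
  have one: "slot i (c i) z = slot i (a i) (total_op b z) \<ominus>\<^bsub>T\<^esub> total_op b (slot i (a i) z)" if i: "i \<in> I" for i
  proof -
    have "slot i (a i) (total_op b z) \<ominus>\<^bsub>T\<^esub> total_op b (slot i (a i) z)
        = (\<Oplus>\<^bsub>T\<^esub>j\<in>I. slot i (a i) (slot j (b j) z)) \<ominus>\<^bsub>T\<^esub> (\<Oplus>\<^bsub>T\<^esub>j\<in>I. slot j (b j) (slot i (a i) z))"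
      unfolding total_op_def
      by (subst hom_finsum[OF T_module T_module slot_Hom[OF i a[OF i]]]) (auto intro: sc b z)
    also have "\<dots> = (\<Oplus>\<^bsub>T\<^esub>j\<in>I. slot i (a i) (slot j (b j) z) \<ominus>\<^bsub>T\<^esub> slot j (b j) (slot i (a i) z))"
      by (rule finsum_minus[symmetric, OF T.abelian_group_axioms]) (auto intro: sc a b z i)
    also have "\<dots> = (\<Oplus>\<^bsub>T\<^esub>j\<in>I. if i = j then slot j (c j) z else \<zero>\<^bsub>T\<^esub>)"
    proof (rule T.M.finsum_cong')
      show "slot i (a i) (slot j (b j) z) \<ominus>\<^bsub>T\<^esub> slot j (b j) (slot i (a i) z)
          = (if i = j then slot j (c j) z else \<zero>\<^bsub>T\<^esub>)" if j: "j \<in> I" for j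
      proof (cases "i = j")
        case False
        have "slot j (b j) (slot i (a i) z) \<in> carrier T" by (intro sc a b z i j)
        then show ?thesis
          using False slot_commute[OF i j False a[OF i] b[OF j] z] by (simp add: T.M.r_neg T.minus_eq)
      next
        case True
        then show ?thesis using slot_comm[OF i z] by simp
      qed
    qed (auto intro!: sc c z)
    also have "\<dots> = slot i (c i) z"
      using T.M.finsum_singleton[OF i fin, of "\<lambda>j. slot j (c j) z"] sc[OF _ c z] by auto
    finally show ?thesis by simp
  qed
  have tb: "total_op b w \<in> carrier T" if "w \<in> carrier T" for w
    using hom_closed[OF total_op_Hom[OF b] that] .
  have "total_op c z = (\<Oplus>\<^bsub>T\<^esub>i\<in>I. slot i (a i) (total_op b z) \<ominus>\<^bsub>T\<^esub> total_op b (slot i (a i) z))"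
    unfolding total_op_def[of c] using one
    by (intro T.M.finsum_cong') (auto intro!: sc a tb z T.minus_closed)
  also have "\<dots> = (\<Oplus>\<^bsub>T\<^esub>i\<in>I. slot i (a i) (total_op b z)) \<ominus>\<^bsub>T\<^esub> (\<Oplus>\<^bsub>T\<^esub>i\<in>I. total_op b (slot i (a i) z))"
    by (rule finsum_minus[OF T.abelian_group_axioms]) (auto intro!: sc a tb z)
  also have "(\<Oplus>\<^bsub>T\<^esub>i\<in>I. total_op b (slot i (a i) z)) = total_op b (total_op a z)"
    unfolding total_op_def[of a]
    by (rule hom_finsum[OF T_module T_module total_op_Hom[OF b], symmetric]) (auto intro!: sc a z)
  finally show ?thesis by (simp add: total_op_def[of a])
qed

end

lemma lie_moduleD:
  assumes "lie_module K L V \<sigma>"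
  shows "lie_algebra K L" "vectorspace K V"
    and "x \<in> carrier L \<Longrightarrow> \<sigma> x \<in> Hom K V V"
    and "\<lbrakk>x \<in> carrier L; y \<in> carrier L; v \<in> carrier V\<rbrakk> \<Longrightarrow> \<sigma> (x \<oplus>\<^bsub>L\<^esub> y) v = \<sigma> x v \<oplus>\<^bsub>V\<^esub> \<sigma> y v"
    and "\<lbrakk>a \<in> carrier K; x \<in> carrier L; v \<in> carrier V\<rbrakk> \<Longrightarrow> \<sigma> (a \<odot>\<^bsub>L\<^esub> x) v = a \<odot>\<^bsub>V\<^esub> \<sigma> x v"
    and "\<lbrakk>x \<in> carrier L; y \<in> carrier L; v \<in> carrier V\<rbrakk>
        \<Longrightarrow> \<sigma> (bracket L x y) v = \<sigma> x (\<sigma> y v) \<ominus>\<^bsub>V\<^esub> \<sigma> y (\<sigma> x v)"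
  using assms by (simp_all add: lie_module_def lie_module_axioms_def)

theorem lie_module_multi_tensor:
  assumes "finite I" "lie_algebra K L" "\<And>i. i \<in> I \<Longrightarrow> lie_module K L (V i) (\<sigma> i)"
  shows "lie_module K L (multi_tensor K I V) (multi_tensor_rep K I V \<sigma>)"
proof -
  interpret L: lie_algebra K L by fact
  note D = lie_moduleD[OF assms(3)]
  interpret multi_tensor_product K I V
    by (rule multi_tensor_product.intro[OF L.is_cring vs_module[OF D(2)]])
  note rep = multi_tensor_rep_eq[of \<sigma>, OF D(3)]
  have tc: "total_op (\<lambda>i. \<sigma> i x) v \<in> carrier T" if "x \<in> carrier L" "v \<in> carrier T" for x v
    using hom_closed[OF total_op_Hom[of "\<lambda>i. \<sigma> i x", OF D(3)] that(2)] that(1) by blast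
  show ?thesis
  proof (intro lie_module.intro lie_module_axioms.intro)
    show "lie_algebra K L" by fact
    show "vectorspace K T" by (intro vectorspace.intro T_module L.field_axioms)
    show "multi_tensor_rep K I V \<sigma> x \<in> Hom K T T" if x: "x \<in> carrier L" for x
      by (rule hom_cong[OF T_module total_op_Hom[of "\<lambda>i. \<sigma> i x", OF D(3)] rep]) (use x in auto)
    show "multi_tensor_rep K I V \<sigma> (x \<oplus>\<^bsub>L\<^esub> y) v = multi_tensor_rep K I V \<sigma> x v \<oplus>\<^bsub>T\<^esub> multi_tensor_rep K I V \<sigma> y v"
      if x: "x \<in> carrier L" and y: "y \<in> carrier L" and v: "v \<in> carrier T" for x y v
    proof -
      have xy: "x \<oplus>\<^bsub>L\<^esub> y \<in> carrier L" using x y by simp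
      have "slot i (\<sigma> i (x \<oplus>\<^bsub>L\<^esub> y)) v = slot i (\<sigma> i x) v \<oplus>\<^bsub>T\<^esub> slot i (\<sigma> i y) v" if i: "i \<in> I" for i
        using slot_cong[OF i D(3)[OF i xy] hom_plus[OF V_module[OF i] D(3)[OF i x] D(3)[OF i y]] D(4)[OF i x y] v]
          slot_add[OF i D(3)[OF i x] D(3)[OF i y] v] by simp
      then have "total_op (\<lambda>i. \<sigma> i (x \<oplus>\<^bsub>L\<^esub> y)) v = (\<Oplus>\<^bsub>T\<^esub>i\<in>I. slot i (\<sigma> i x) v \<oplus>\<^bsub>T\<^esub> slot i (\<sigma> i y) v)"
        unfolding total_op_def by (intro T.M.finsum_cong') (auto intro!: slot_closed D(3) x y v)
      also have "\<dots> = total_op (\<lambda>i. \<sigma> i x) v \<oplus>\<^bsub>T\<^esub> total_op (\<lambda>i. \<sigma> i y) v"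
        unfolding total_op_def by (intro T.M.finsum_addf) (auto intro!: slot_closed D(3) x y v)
      finally show ?thesis using rep xy x y v by simp
    qed
    show "multi_tensor_rep K I V \<sigma> (a \<odot>\<^bsub>L\<^esub> x) v = a \<odot>\<^bsub>T\<^esub> multi_tensor_rep K I V \<sigma> x v"
      if a: "a \<in> carrier K" and x: "x \<in> carrier L" and v: "v \<in> carrier T" for a x v
    proof -
      have ax: "a \<odot>\<^bsub>L\<^esub> x \<in> carrier L" using a x by simp
      have "slot i (\<sigma> i (a \<odot>\<^bsub>L\<^esub> x)) v = a \<odot>\<^bsub>T\<^esub> slot i (\<sigma> i x) v" if i: "i \<in> I" for i
        using slot_cong[OF i D(3)[OF i ax] hom_scale[OF V_module[OF i] D(3)[OF i x] a] D(5)[OF i a x] v]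
          slot_smult[OF i a D(3)[OF i x] v] by simp
      then have "total_op (\<lambda>i. \<sigma> i (a \<odot>\<^bsub>L\<^esub> x)) v = (\<Oplus>\<^bsub>T\<^esub>i\<in>I. a \<odot>\<^bsub>T\<^esub> slot i (\<sigma> i x) v)"
        unfolding total_op_def by (intro T.M.finsum_cong') (auto intro!: slot_closed D(3) x a v)
      also have "\<dots> = a \<odot>\<^bsub>T\<^esub> total_op (\<lambda>i. \<sigma> i x) v"
        unfolding total_op_def
        by (intro T.finsum_smult_ldistr[symmetric] assms(1) a) (auto intro!: slot_closed D(3) x v)
      finally show ?thesis using rep ax x v by simp
    qed
    show "multi_tensor_rep K I V \<sigma> (bracket L x y) v =
        multi_tensor_rep K I V \<sigma> x (multi_tensor_rep K I V \<sigma> y v) \<ominus>\<^bsub>T\<^esub>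
        multi_tensor_rep K I V \<sigma> y (multi_tensor_rep K I V \<sigma> x v)"
      if x: "x \<in> carrier L" and y: "y \<in> carrier L" and v: "v \<in> carrier T" for x y v
    proof -
      have xy: "bracket L x y \<in> carrier L" using x y by (rule L.bracket_closed)
      show ?thesis
        using total_op_commutator[of "\<lambda>i. \<sigma> i x" "\<lambda>i. \<sigma> i y" "\<lambda>i. \<sigma> i (bracket L x y)",
            OF assms(1) D(3)[OF _ x] D(3)[OF _ y] D(3)[OF _ xy] D(6)[OF _ x y] v]
          rep xy x y v tc by simp
    qed
  qed
qed

subsection \<open>Dimension and irreducibility of a tensor product\<close>

context multi_tensor_product
begin

lemma pure_expand:
  assumes "dual_basis K (V i) B c" "t \<in> Z" "i \<in> I"
  shows "pure t = (\<Oplus>\<^bsub>T\<^esub>b\<in>B. c b (t i) \<odot>\<^bsub>T\<^esub> pure (t(i := b)))"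
proof -
  note Vi = V_module[OF assms(3)]
  note ti = Z_val[OF assms(2,3)]
  interpret Vi: Module.module K "V i" by (rule Vi)
  have b: "b \<in> carrier (V i)" "c b (t i) \<in> carrier K" if "b \<in> B" for b
    using dual_basis_closed[OF assms(1) that] dual_basis_coeff[OF assms(1) that ti] by auto
  have "pure t = pure (t(i := t i))" by simp
  also have "t i = (\<Oplus>\<^bsub>V i\<^esub>b\<in>B. c b (t i) \<odot>\<^bsub>V i\<^esub> b)" by (rule dual_basis_expand[OF assms(1) ti])
  also have "pure (t(i := (\<Oplus>\<^bsub>V i\<^esub>b\<in>B. c b (t i) \<odot>\<^bsub>V i\<^esub> b)))
      = (\<Oplus>\<^bsub>T\<^esub>b\<in>B. pure (t(i := c b (t i) \<odot>\<^bsub>V i\<^esub> b)))"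
    using b by (intro hom_finsum[OF Vi T_module pure_Hom[OF assms(2,3)]]) auto
  also have "\<dots> = (\<Oplus>\<^bsub>T\<^esub>b\<in>B. c b (t i) \<odot>\<^bsub>T\<^esub> pure (t(i := b)))"
    using pure_smult[OF assms(2,3) b(2,1)] T.smult_closed[OF b(2) pure_closed[OF Z_upd[OF assms(2,3) b(1)]]]
    by (intro T.M.finsum_cong') (simp_all del: fun_upd_apply)
  finally show ?thesis .
qed

text \<open>By induction on the set of positions whose entries are restricted to basis vectors, expanding one
  entry at a time.\<close>

lemma T_generated_by_bases:
  assumes B: "\<And>i. i \<in> I \<Longrightarrow> dual_basis K (V i) (B i) (c i)"
    and U: "submod K U T" and "finite J" "J \<subseteq> I"
    and "\<And>t. \<lbrakk>t \<in> Z; \<And>i. i \<in> J \<Longrightarrow> t i \<in> B i\<rbrakk> \<Longrightarrow> pure t \<in> U"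
  shows "U = carrier T"
  using assms(3-5)
proof (induction J rule: finite_induct)
  case empty
  then show ?case by (intro T_generated[OF U]) auto
next
  case (insert j J)
  have j: "j \<in> I" using insert.prems by auto
  show ?case
  proof (rule insert.IH)
    fix t assume t: "t \<in> Z" "\<And>i. i \<in> J \<Longrightarrow> t i \<in> B i"
    have "pure (t(j := b)) \<in> U" if b: "b \<in> B j" for b
      by (rule insert.prems(2)[OF Z_upd[OF t(1) j dual_basis_closed[OF B[OF j] b]]])
         (use t(2) b insert.hyps in auto)
    then have "(\<Oplus>\<^bsub>T\<^esub>b\<in>B j. c j b (t j) \<odot>\<^bsub>T\<^esub> pure (t(j := b))) \<in> U"
      using dual_basis_coeff[OF B[OF j] _ Z_val[OF t(1) j]]
      by (intro submod_finsum[OF U] submod_smult[OF U])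
    then show "pure t \<in> U" using pure_expand[OF B[OF j] t(1) j] by simp
  qed (use insert.prems in auto)
qed

lemma fin_dim_T:
  assumes "field K" "finite I" and B: "\<And>i. i \<in> I \<Longrightarrow> dual_basis K (V i) (B i) (c i)"
  shows "vectorspace.fin_dim K T"
proof -
  interpret TV: vectorspace K T by (intro vectorspace.intro T_module assms(1))
  let ?A = "pure ` (\<Pi>\<^sub>E i\<in>I. B i)"
  have BZ: "(\<Pi>\<^sub>E i\<in>I. B i) \<subseteq> Z"
    using dual_basis_closed[OF B] by (intro PiE_mono) auto
  have A: "?A \<subseteq> carrier T" using BZ pure_closed by blast
  have "spn K T ?A = carrier T"
  proof (rule T_generated_by_bases[OF B span_submod[OF T_module A] assms(2) order.refl])
    fix t assume t: "t \<in> Z" "\<And>i. i \<in> I \<Longrightarrow> t i \<in> B i"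
    then have "t \<in> (\<Pi>\<^sub>E i\<in>I. B i)" by (auto simp: PiE_iff)
    then show "pure t \<in> spn K T ?A" using span_superset[OF T_module A] by blast
  qed
  moreover have "finite ?A"
    using assms(2) dual_basis_finite[OF B] by (intro finite_imageI finite_PiE)
  ultimately show ?thesis using A unfolding TV.fin_dim_def by blast
qed

text \<open>The product of coordinate functionals is a linear functional on the tensor product that does
  not vanish on the corresponding tensor of basis vectors.\<close>

lemma pure_basis_nonzero:
  assumes "field K" "finite I" and B: "\<And>i. i \<in> I \<Longrightarrow> dual_basis K (V i) (B i) (c i)"
    and b: "b \<in> (\<Pi>\<^sub>E i\<in>I. B i)"
  shows "pure b \<noteq> \<zero>\<^bsub>T\<^esub>"
proof -
  interpret K: field K by fact
  note reg = module_regular_module[OF K_cring]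
  have bB: "b i \<in> B i" if "i \<in> I" for i using b that by auto
  have bZ: "b \<in> Z" using b dual_basis_closed[OF B] by (auto simp: PiE_iff)
  have cK: "c i (b i) v \<in> carrier K" if "i \<in> I" "v \<in> carrier (V i)" for i v
    by (rule dual_basis_coeff[OF B[OF that(1)] bB[OF that(1)] that(2)])
  define \<beta> where "\<beta> t = (\<Otimes>\<^bsub>K\<^esub>i\<in>I. c i (b i) (t i))" for t
  have \<beta>K: "\<beta> t \<in> carrier K" if "t \<in> Z" for t
    unfolding \<beta>_def using cK Z_val[OF that] by (intro pres.F.R.finprod_closed) blast
  have "multilinear (regular_module K) \<beta>"
    unfolding multilinear_def
  proof (intro conjI ballI)
    show "\<beta> t \<in> carrier (regular_module K)" if "t \<in> Z" for t using \<beta>K[OF that] by simp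
    show "(\<lambda>x. \<beta> (t(j := x))) \<in> Hom K (V j) (regular_module K)" if t: "t \<in> Z" and j: "j \<in> I" for t j
    proof -
      let ?P = "\<Otimes>\<^bsub>K\<^esub>i\<in>I - {j}. c i (b i) (t i)"
      have P: "?P \<in> carrier K" using cK Z_val[OF t] by (intro pres.F.R.finprod_closed) blast
      have eq: "\<beta> (t(j := x)) = c j (b j) x \<odot>\<^bsub>regular_module K\<^esub> ?P" if x: "x \<in> carrier (V j)" for x
      proof -
        have "I = insert j (I - {j})" using j by auto
        then have "\<beta> (t(j := x)) = (\<Otimes>\<^bsub>K\<^esub>i\<in>insert j (I - {j}). c i (b i) ((t(j := x)) i))"
          unfolding \<beta>_def by simp
        also have "\<dots> = c j (b j) x \<otimes>\<^bsub>K\<^esub> (\<Otimes>\<^bsub>K\<^esub>i\<in>I - {j}. c i (b i) ((t(j := x)) i))"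
          using cK[OF j x] cK Z_val[OF t] assms(2) by (subst pres.F.R.finprod_insert) (auto simp del: PiE_iff)
        also have "(\<Otimes>\<^bsub>K\<^esub>i\<in>I - {j}. c i (b i) ((t(j := x)) i)) = ?P"
          using cK Z_val[OF t] by (intro pres.F.R.finprod_cong') (auto simp del: PiE_iff)
        finally show ?thesis by (simp only: regular_module_simps)
      qed
      have "(\<lambda>x. c j (b j) x \<odot>\<^bsub>regular_module K\<^esub> ?P) \<in> Hom K (V j) (regular_module K)"
        by (rule hom_rank_one[OF reg dual_basis_Hom[OF B[OF j] bB[OF j]]]) (use P in simp)
      then show ?thesis by (rule hom_cong[OF V_module[OF j] _ eq])
    qed
  qed
  note l = lift_Hom[OF reg this] lift_pure[OF reg this]
  have "\<beta> b = (\<Otimes>\<^bsub>K\<^esub>i\<in>I. \<one>\<^bsub>K\<^esub>)"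
    unfolding \<beta>_def using dual_basis_dual[OF B bB bB] by (intro pres.F.R.finprod_cong') auto
  then have "\<beta> b \<noteq> \<zero>\<^bsub>K\<^esub>" by simp
  then show ?thesis using hom_zero[OF T_module reg l(1)] l(2)[OF bZ] by auto
qed

text \<open>A nonzero subspace that is stable under the rank-one operators \<open>c\<^sub>b \<otimes> w\<close> in every factor is the
  whole tensor product. The identity is the sum of the operators \<open>c\<^sub>b \<otimes> b\<close>, so some of these carry
  a nonzero element of \<open>U\<close> to a nonzero multiple of a tensor of basis vectors, and the operators
  \<open>c\<^sub>b \<otimes> w\<close> carry this to any pure tensor.\<close>

context
  fixes B :: "'i \<Rightarrow> 'v set" and c :: "'i \<Rightarrow> 'v \<Rightarrow> 'v \<Rightarrow> 'k" and U :: "(('i \<Rightarrow> 'v) \<Rightarrow> 'k) set set"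
  assumes B: "i \<in> I \<Longrightarrow> dual_basis K (V i) (B i) (c i)"
    and U: "submod K U T"
    and rank_one_invariant:
      "\<lbrakk>i \<in> I; b \<in> B i; w \<in> carrier (V i); u \<in> U\<rbrakk> \<Longrightarrow> slot i (\<lambda>v. c i b v \<odot>\<^bsub>V i\<^esub> w) u \<in> U"
begin

lemma rank_one_End:
  "\<lbrakk>i \<in> I; b \<in> B i; w \<in> carrier (V i)\<rbrakk> \<Longrightarrow> (\<lambda>v. c i b v \<odot>\<^bsub>V i\<^esub> w) \<in> End i"
  by (intro hom_rank_one V_module dual_basis_Hom[OF B])

lemma slot_rank_one_pure:
  assumes "i \<in> I" "b \<in> B i" "w \<in> carrier (V i)" "t \<in> Z"
  shows "slot i (\<lambda>v. c i b v \<odot>\<^bsub>V i\<^esub> w) (pure t) = c i b (t i) \<odot>\<^bsub>T\<^esub> pure (t(i := w))"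
  using slot_pure[OF assms(1) rank_one_End[OF assms(1-3)] assms(4)]
    pure_smult[OF assms(4,1) dual_basis_coeff[OF B[OF assms(1)] assms(2) Z_val[OF assms(4,1)]] assms(3)]
  by simp

lemma sum_of_rank_ones:
  assumes "i \<in> I" "z \<in> carrier T"
  shows "z = (\<Oplus>\<^bsub>T\<^esub>b\<in>B i. slot i (\<lambda>v. c i b v \<odot>\<^bsub>V i\<^esub> b) z)"
proof -
  note Vi = V_module[OF assms(1)]
  have r: "(\<lambda>v. c i b v \<odot>\<^bsub>V i\<^esub> b) \<in> End i" if "b \<in> B i" for b
    by (rule rank_one_End[OF assms(1) that dual_basis_closed[OF B[OF assms(1)] that]])
  have "z = slot i (\<lambda>v. v) z" using slot_id[OF assms] by simp
  also have "\<dots> = slot i (\<lambda>v. \<Oplus>\<^bsub>V i\<^esub>b\<in>B i. c i b v \<odot>\<^bsub>V i\<^esub> b) z"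
    by (rule slot_cong[OF assms(1) hom_id hom_finsum_map[OF Vi Vi r] dual_basis_expand[OF B[OF assms(1)]] assms(2)])
  also have "\<dots> = (\<Oplus>\<^bsub>T\<^esub>b\<in>B i. slot i (\<lambda>v. c i b v \<odot>\<^bsub>V i\<^esub> b) z)"
    by (rule slot_finsum[OF assms(1) r assms(2)])
  finally show ?thesis .
qed

text \<open>Once an operator \<open>c\<^sub>b \<otimes> b\<close> has been applied in slot \<open>i\<close>, the entry at \<open>i\<close> is \<open>b\<close> in all pure tensors
  involved, and it stays so when the other slots are treated.\<close>

lemma reduce_to_basis_tensor:
  assumes "finite J" "J \<subseteq> I" "u \<in> U" "u \<noteq> \<zero>\<^bsub>T\<^esub>"
  shows "\<exists>u'\<in>U. \<exists>b. u' \<noteq> \<zero>\<^bsub>T\<^esub> \<and> (\<forall>i\<in>J. b i \<in> B i) \<and>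
    u' \<in> spn K T {pure t | t. t \<in> Z \<and> (\<forall>i\<in>J. t i = b i)}"
  using assms(1,2)
proof (induction J rule: finite_induct)
  case empty
  have "spn K T {pure t | t. t \<in> Z} = carrier T"
    by (intro T_generated span_submod T_module) (auto intro!: pure_closed span_superset[OF T_module, THEN subsetD])
  then show ?case using assms(3,4) submod_carrier[OF U] by auto
next
  case (insert j J)
  have j: "j \<in> I" using insert.prems by auto
  define G where "G J b = {pure t | t. t \<in> Z \<and> (\<forall>i\<in>J. t i = b i)}" for J b
  have G: "G J b \<subseteq> carrier T" for J b by (auto simp: G_def intro!: pure_closed simp del: PiE_iff)
  obtain u' b where u': "u' \<in> U" "u' \<noteq> \<zero>\<^bsub>T\<^esub>" "\<And>i. i \<in> J \<Longrightarrow> b i \<in> B i" "u' \<in> spn K T (G J b)"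
    using insert by (auto simp: G_def)
  note u'T = submod_carrier[OF U u'(1)]
  have "\<exists>b'\<in>B j. slot j (\<lambda>v. c j b' v \<odot>\<^bsub>V j\<^esub> b') u' \<noteq> \<zero>\<^bsub>T\<^esub>"
  proof (rule ccontr)
    assume "\<not> ?thesis"
    then have "(\<Oplus>\<^bsub>T\<^esub>b'\<in>B j. slot j (\<lambda>v. c j b' v \<odot>\<^bsub>V j\<^esub> b') u') = (\<Oplus>\<^bsub>T\<^esub>b'\<in>B j. \<zero>\<^bsub>T\<^esub>)"
      by (intro T.M.finsum_cong') auto
    then show False using sum_of_rank_ones[OF j u'T] u'(2) by simp
  qed
  then obtain b' where b': "b' \<in> B j" "slot j (\<lambda>v. c j b' v \<odot>\<^bsub>V j\<^esub> b') u' \<noteq> \<zero>\<^bsub>T\<^esub>" by blast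
  note b'V = dual_basis_closed[OF B[OF j] b'(1)]
  let ?r = "slot j (\<lambda>v. c j b' v \<odot>\<^bsub>V j\<^esub> b')"
  let ?S = "spn K T (G (insert j J) (b(j := b')))"
  have S: "submod K ?S T" by (rule span_submod[OF T_module G])
  have "G J b \<subseteq> {x \<in> carrier T. ?r x \<in> ?S}"
  proof
    fix g assume "g \<in> G J b"
    then obtain t where t: "t \<in> Z" "\<And>i. i \<in> J \<Longrightarrow> t i = b i" "g = pure t" by (auto simp: G_def)
    have "pure (t(j := b')) \<in> G (insert j J) (b(j := b'))"
      using Z_upd[OF t(1) j b'V] t(2) unfolding G_def by (intro CollectI exI[of _ "t(j := b')"]) auto
    then have "?r g \<in> ?S"
      unfolding t(3) slot_rank_one_pure[OF j b'(1) b'V t(1)]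
      using span_superset[OF T_module G] dual_basis_coeff[OF B[OF j] b'(1) Z_val[OF t(1) j]]
      by (intro submod_smult[OF S]) auto
    then show "g \<in> {x \<in> carrier T. ?r x \<in> ?S}" using pure_closed[OF t(1)] t(3) by simp
  qed
  then have "u' \<in> {x \<in> carrier T. ?r x \<in> ?S}"
    using span_least[OF submod_vimage[OF T_module slot_Hom[OF j rank_one_End[OF j b'(1) b'V]] S]] u'(4) by blast
  then have "?r u' \<in> ?S" by blast
  moreover have "?r u' \<in> U" by (rule rank_one_invariant[OF j b'(1) b'V u'(1)])
  moreover have "\<forall>i\<in>insert j J. (b(j := b')) i \<in> B i" using u'(3) b'(1) by auto
  ultimately show ?case using b'(2) unfolding G_def by blast
qed

lemma spread_basis_tensor:
  assumes "finite J" "J \<subseteq> I" "b \<in> Z" "\<And>i. i \<in> I \<Longrightarrow> b i \<in> B i" "pure b \<in> U" "w \<in> Z"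
  shows "pure (\<lambda>i. if i \<in> J then w i else b i) \<in> U"
  using assms(1,2)
proof (induction J rule: finite_induct)
  case empty
  then show ?case using assms by simp
next
  case (insert j J)
  have j: "j \<in> I" using insert.prems by auto
  let ?s = "\<lambda>i. if i \<in> J then w i else b i"
  have s: "?s \<in> Z" using assms(3,6) insert.prems by (auto simp: PiE_iff extensional_def)
  have "slot j (\<lambda>v. c j (b j) v \<odot>\<^bsub>V j\<^esub> w j) (pure ?s) = c j (b j) (?s j) \<odot>\<^bsub>T\<^esub> pure (?s(j := w j))"
    by (rule slot_rank_one_pure[OF j assms(4)[OF j] Z_val[OF assms(6) j] s])
  also have "c j (b j) (?s j) = \<one>\<^bsub>K\<^esub>"
    using insert.hyps dual_basis_dual[OF B[OF j] assms(4)[OF j] assms(4)[OF j]] by simp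
  also have "\<one>\<^bsub>K\<^esub> \<odot>\<^bsub>T\<^esub> pure (?s(j := w j)) = pure (?s(j := w j))"
    by (rule T.smult_one[OF pure_closed[OF Z_upd[OF s j Z_val[OF assms(6) j]]]])
  also have "?s(j := w j) = (\<lambda>i. if i \<in> insert j J then w i else b i)" by auto
  finally show ?case
    using rank_one_invariant[OF j assms(4)[OF j] Z_val[OF assms(6) j] insert.IH] insert.prems by auto
qed

lemma rank_one_invariant_subspace:
  assumes "field K" "finite I" "U \<noteq> {\<zero>\<^bsub>T\<^esub>}"
  shows "U = carrier T"
proof -
  interpret TV: vectorspace K T by (intro vectorspace.intro T_module assms(1))
  obtain u where u: "u \<in> U" "u \<noteq> \<zero>\<^bsub>T\<^esub>" using assms(3) submod_zero[OF U] by blast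
  then obtain u' b where u': "u' \<in> U" "u' \<noteq> \<zero>\<^bsub>T\<^esub>" and b: "\<And>i. i \<in> I \<Longrightarrow> b i \<in> B i"
    and span: "u' \<in> spn K T {pure t | t. t \<in> Z \<and> (\<forall>i\<in>I. t i = b i)}"
    using reduce_to_basis_tensor[OF assms(2) order.refl u] by blast
  (* a tuple in Z is undefined outside I *)
  define b0 where "b0 = restrict b I"
  have b0: "b0 \<in> Z" "\<And>i. i \<in> I \<Longrightarrow> b0 i \<in> B i"
    using b dual_basis_closed[OF B] by (auto simp: b0_def)
  have "{pure t | t. t \<in> Z \<and> (\<forall>i\<in>I. t i = b i)} \<subseteq> {pure b0}"
  proof clarify
    fix t assume "t \<in> Z" "\<forall>i\<in>I. t i = b i"
    then have "t = b0" by (auto simp: b0_def PiE_iff extensional_def restrict_def fun_eq_iff)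
    then show "pure t = pure b0" by simp
  qed
  then have "u' \<in> spn K T {pure b0}" using span T.span_is_monotone by blast
  moreover have "spn K T {pure b0} = {T.lincomb a {pure b0} | a. a \<in> {pure b0} \<rightarrow> carrier K}"
    by (rule T.finite_span) (use pure_closed[OF b0(1)] in simp_all)
  ultimately obtain k where k: "k \<in> carrier K" "u' = k \<odot>\<^bsub>T\<^esub> pure b0"
    using pure_closed[OF b0(1)] by (auto simp: T.lincomb_def)
  then have "k \<noteq> \<zero>\<^bsub>K\<^esub>" using u' pure_closed[OF b0(1)] by auto
  then have "pure b0 = inv\<^bsub>K\<^esub> k \<odot>\<^bsub>T\<^esub> u'" "k \<in> Units K"
    using TV.mult_inverse[OF k(1) pure_closed[OF b0(1)] k(2)[symmetric]] k(1) field.field_Units[OF assms(1)] by auto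
  then have "pure b0 = inv\<^bsub>K\<^esub> k \<odot>\<^bsub>T\<^esub> u'" "inv\<^bsub>K\<^esub> k \<in> carrier K" by auto
  then have "pure b0 \<in> U" using submod_smult[OF U _ u'(1)] by simp
  note spread = spread_basis_tensor[OF assms(2) order.refl b0 this]
  show ?thesis
  proof (rule T_generated[OF U])
    fix w assume w: "w \<in> Z"
    have "(\<lambda>i. if i \<in> I then w i else b0 i) = w"
      using w b0(1) by (auto simp: PiE_iff extensional_def fun_eq_iff)
    then show "pure w \<in> U" using spread[OF _ w] by simp
  qed
qed

end

text \<open>The operators that preserve \<open>U\<close> when they act in slot \<open>i\<close> form an algebra, which acts irreducibly by
  the assumption on \<open>V i\<close>. By density it contains the operators of rank one.\<close>

theorem irreducible_tensor:
  assumes "algebraically_closed K" "finite I"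
    and V: "\<And>i. i \<in> I \<Longrightarrow> vectorspace K (V i)" "\<And>i. i \<in> I \<Longrightarrow> vectorspace.fin_dim K (V i)"
    and U: "submod K U T" "U \<noteq> {\<zero>\<^bsub>T\<^esub>}"
    and irr: "\<And>i W. \<lbrakk>i \<in> I; submod K W (V i);
        \<And>a. \<lbrakk>a \<in> Hom K (V i) (V i); slot_op K I V i a ` U \<subseteq> U\<rbrakk> \<Longrightarrow> a ` W \<subseteq> W\<rbrakk>
        \<Longrightarrow> W = {\<zero>\<^bsub>V i\<^esub>} \<or> W = carrier (V i)"
  shows "U = carrier T"
proof -
  interpret K: algebraically_closed K by fact
  have "\<forall>i\<in>I. \<exists>B c. dual_basis K (V i) B c" using dual_basis_exists V by blast
  then obtain B c where B: "\<And>i. i \<in> I \<Longrightarrow> dual_basis K (V i) (B i) (c i)" by metis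
  show ?thesis
  proof (rule rank_one_invariant_subspace[OF B U(1) _ K.field_axioms assms(2) U(2)])
    fix i b w u assume i: "i \<in> I" and b: "b \<in> B i" and w: "w \<in> carrier (V i)" and u: "u \<in> U"
    note UT = submod_carrier[OF U(1)]
    define A where "A = {a \<in> End i. slot i a ` U \<subseteq> U}"
    have A: "a \<in> End i" "x \<in> U \<Longrightarrow> slot i a x \<in> U" if "a \<in> A" for a x
      using that by (auto simp: A_def)
    have AI: "a \<in> A" if "a \<in> End i" "\<And>x. x \<in> U \<Longrightarrow> slot i a x \<in> U" for a
      using that by (auto simp: A_def)
    interpret irreducible_operators K "V i" A
    proof (rule irreducible_operators.intro)
      show "algebraically_closed K" "vectorspace K (V i)" "vectorspace.fin_dim K (V i)"
        using assms i by auto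
      show "a \<in> End i" if "a \<in> A" for a by (rule A(1)[OF that])
      show "(\<lambda>x. x) \<in> A" by (rule AI[OF hom_id]) (simp add: slot_id[OF i UT])
      show "(\<lambda>x. a x \<oplus>\<^bsub>V i\<^esub> b x) \<in> A" if "a \<in> A" "b \<in> A" for a b
        using A[OF that(1)] A[OF that(2)]
        by (intro AI hom_plus V_module i) (simp_all add: slot_add[OF i _ _ UT] submod_add[OF U(1)])
      show "(\<lambda>x. r \<odot>\<^bsub>V i\<^esub> a x) \<in> A" if "r \<in> carrier K" "a \<in> A" for r a
        using A[OF that(2)] that(1)
        by (intro AI hom_scale V_module i) (simp_all add: slot_smult[OF i _ _ UT] submod_smult[OF U(1)])
      show "(\<lambda>x. a (b x)) \<in> A" if "a \<in> A" "b \<in> A" for a b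
        using A(2)[OF that(1)] A(2)[OF that(2)]
        by (intro AI[OF hom_compose[OF A(1)[OF that(1)] A(1)[OF that(2)]]])
           (simp add: slot_comp[OF i A(1)[OF that(1)] A(1)[OF that(2)] UT])
      show "W = {\<zero>\<^bsub>V i\<^esub>} \<or> W = carrier (V i)" if "submod K W (V i)" "\<And>a. a \<in> A \<Longrightarrow> a ` W \<subseteq> W" for W
        by (rule irr[OF i that(1)]) (use that(2) in \<open>auto simp: A_def\<close>)
    qed
    obtain a where a: "a \<in> A" "\<And>v. v \<in> carrier (V i) \<Longrightarrow> a v = c i b v \<odot>\<^bsub>V i\<^esub> w"
      using rank_one_in_A[OF B[OF i] b w] by blast
    have "slot i (\<lambda>v. c i b v \<odot>\<^bsub>V i\<^esub> w) u = slot i a u"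
      by (rule slot_cong[OF i _ A(1)[OF a(1)] _ UT[OF u]])
         (use a(2) in \<open>auto intro: hom_rank_one[OF V_module dual_basis_Hom[OF B[OF i] b] w]\<close>)
    then show "slot i (\<lambda>v. c i b v \<odot>\<^bsub>V i\<^esub> w) u \<in> U" using A(2)[OF a(1) u] by simp
  qed
qed

end

section \<open>Residue fields at maximal ideals\<close>

lemma poly_at_upt:
  assumes "cring K" "\<And>i. c i \<in> carrier K" "x \<in> carrier K"
  shows "poly_at K (map c [0..<Suc n]) x = (\<Oplus>\<^bsub>K\<^esub>i\<in>{..n}. c i \<otimes>\<^bsub>K\<^esub> x [^]\<^bsub>K\<^esub> i)"
  using assms(2)
proof (induction n arbitrary: c)
  case 0
  interpret K: cring K by fact
  show ?case using 0 assms(3) by simp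
next
  case (Suc n)
  interpret K: cring K by fact
  note c = Suc.prems
  have f: "(\<lambda>i. c i \<otimes>\<^bsub>K\<^esub> x [^]\<^bsub>K\<^esub> i) \<in> {..Suc n} \<rightarrow> carrier K" using c assms(3) by auto
  have "map c [0..<Suc (Suc n)] = c 0 # map (\<lambda>i. c (Suc i)) [0..<Suc n]"
    by (simp add: upt_conv_Cons map_Suc_upt[symmetric] del: upt_Suc)
  then have "poly_at K (map c [0..<Suc (Suc n)]) x
      = c 0 \<oplus>\<^bsub>K\<^esub> x \<otimes>\<^bsub>K\<^esub> (\<Oplus>\<^bsub>K\<^esub>i\<in>{..n}. c (Suc i) \<otimes>\<^bsub>K\<^esub> x [^]\<^bsub>K\<^esub> i)"
    using Suc.IH[of "\<lambda>i. c (Suc i)"] c by (simp del: upt_Suc)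
  also have "x \<otimes>\<^bsub>K\<^esub> (\<Oplus>\<^bsub>K\<^esub>i\<in>{..n}. c (Suc i) \<otimes>\<^bsub>K\<^esub> x [^]\<^bsub>K\<^esub> i)
      = (\<Oplus>\<^bsub>K\<^esub>i\<in>{..n}. c (Suc i) \<otimes>\<^bsub>K\<^esub> x [^]\<^bsub>K\<^esub> Suc i)"
    using c assms(3) by (subst K.finsum_rdistr) (auto simp: K.m_ac intro!: K.finsum_cong')
  also have "c 0 \<oplus>\<^bsub>K\<^esub> \<dots> = (\<Oplus>\<^bsub>K\<^esub>i\<in>{..Suc n}. c i \<otimes>\<^bsub>K\<^esub> x [^]\<^bsub>K\<^esub> i)"
    using K.finsum_Suc2[OF f] c assms(3) by (simp add: K.a_comm)
  finally show ?case .
qed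

lemma polynomial_attains_value:
  fixes n :: nat
  assumes "algebraically_closed K" "\<And>i. c i \<in> carrier K" "n > 0" "c n \<noteq> \<zero>\<^bsub>K\<^esub>" "d \<in> carrier K"
  shows "\<exists>x\<in>carrier K. (\<Oplus>\<^bsub>K\<^esub>i\<in>{..n}. c i \<otimes>\<^bsub>K\<^esub> x [^]\<^bsub>K\<^esub> i) = d"
proof -
  interpret K: algebraically_closed K by fact
  obtain m where m: "n = Suc m" using assms(3) by (cases n) auto
  let ?q = "map (\<lambda>i. c (Suc i)) [0..<n]"
  have p: "map c [0..<Suc n] = c 0 # ?q"
    by (simp add: upt_conv_Cons map_Suc_upt[symmetric] del: upt_Suc)
  have "last ((c 0 \<ominus>\<^bsub>K\<^esub> d) # ?q) = c n" using m by simp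
  then obtain x where x: "x \<in> carrier K" "poly_at K ((c 0 \<ominus>\<^bsub>K\<^esub> d) # ?q) x = \<zero>\<^bsub>K\<^esub>"
    using root_exists[OF assms(1), of "(c 0 \<ominus>\<^bsub>K\<^esub> d) # ?q"] assms m by auto
  have q: "poly_at K ?q x \<in> carrier K"
    by (rule poly_at_closed[OF K.cring_axioms _ x(1)]) (use assms(2) in auto)
  have "(\<Oplus>\<^bsub>K\<^esub>i\<in>{..n}. c i \<otimes>\<^bsub>K\<^esub> x [^]\<^bsub>K\<^esub> i) = c 0 \<oplus>\<^bsub>K\<^esub> x \<otimes>\<^bsub>K\<^esub> poly_at K ?q x"
    using poly_at_upt[where c = c and n = n, OF K.cring_axioms assms(2) x(1)] p by (simp del: upt_Suc)
  also have "\<dots> = ((c 0 \<ominus>\<^bsub>K\<^esub> d) \<oplus>\<^bsub>K\<^esub> x \<otimes>\<^bsub>K\<^esub> poly_at K ?q x) \<oplus>\<^bsub>K\<^esub> d"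
  proof -
    have "((c 0 \<ominus>\<^bsub>K\<^esub> d) \<oplus>\<^bsub>K\<^esub> y) \<oplus>\<^bsub>K\<^esub> d = (c 0 \<oplus>\<^bsub>K\<^esub> y) \<oplus>\<^bsub>K\<^esub> (\<ominus>\<^bsub>K\<^esub> d \<oplus>\<^bsub>K\<^esub> d)" if "y \<in> carrier K" for y
      using assms(2)[of 0] assms(5) that by (simp add: K.minus_eq K.a_ac)
    then show ?thesis using assms(2)[of 0] assms(5) x(1) q by (simp add: K.l_neg)
  qed
  also have "\<dots> = d" using x assms(5) by simp
  finally show ?thesis using x(1) by blast
qed

lemma ring_hom_factor:
  assumes "ring P" "ring F" "ring K" "f \<in> ring_hom P F" "h \<in> ring_hom P K"
    and ker: "\<And>p. \<lbrakk>p \<in> carrier P; f p = \<zero>\<^bsub>F\<^esub>\<rbrakk> \<Longrightarrow> h p = \<zero>\<^bsub>K\<^esub>"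
  shows "\<exists>\<chi>\<in>ring_hom (F\<lparr>carrier := f ` carrier P\<rparr>) K. \<forall>p\<in>carrier P. \<chi> (f p) = h p"
proof -
  interpret f: ring_hom_ring P F f by (rule ring_hom_ringI2) fact+
  interpret h: ring_hom_ring P K h by (rule ring_hom_ringI2) fact+
  define \<chi> where "\<chi> y = h (SOME p. p \<in> carrier P \<and> f p = y)" for y
  have \<chi>: "\<chi> (f p) = h p" if p: "p \<in> carrier P" for p
  proof -
    define q where "q = (SOME q. q \<in> carrier P \<and> f q = f p)"
    have "q \<in> carrier P \<and> f q = f p" unfolding q_def by (rule someI[of _ p]) (simp add: p)
    then have q: "q \<in> carrier P" "f q = f p" by auto
    have "f (q \<ominus>\<^bsub>P\<^esub> p) = \<zero>\<^bsub>F\<^esub>" using p q by (simp add: f.R.minus_eq f.S.r_neg)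
    then have "h (q \<ominus>\<^bsub>P\<^esub> p) = \<zero>\<^bsub>K\<^esub>" using ker p q by simp
    then have "h q = h p" using p q by (simp add: f.R.minus_eq h.S.minus_eq[symmetric])
    then show ?thesis by (simp add: \<chi>_def q_def)
  qed
  have "\<chi> \<in> ring_hom (F\<lparr>carrier := f ` carrier P\<rparr>) K"
  proof (rule ring_hom_memI)
    show "\<chi> y \<in> carrier K" if "y \<in> carrier (F\<lparr>carrier := f ` carrier P\<rparr>)" for y
      using that \<chi> by auto
    show "\<chi> (y \<otimes>\<^bsub>F\<lparr>carrier := f ` carrier P\<rparr>\<^esub> z) = \<chi> y \<otimes>\<^bsub>K\<^esub> \<chi> z"
      if yz: "y \<in> carrier (F\<lparr>carrier := f ` carrier P\<rparr>)" "z \<in> carrier (F\<lparr>carrier := f ` carrier P\<rparr>)" for y z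
    proof -
      obtain p q where pq: "p \<in> carrier P" "q \<in> carrier P" "y = f p" "z = f q" using yz by auto
      then show ?thesis using \<chi>[of "p \<otimes>\<^bsub>P\<^esub> q"] by (simp add: \<chi>)
    qed
    show "\<chi> (y \<oplus>\<^bsub>F\<lparr>carrier := f ` carrier P\<rparr>\<^esub> z) = \<chi> y \<oplus>\<^bsub>K\<^esub> \<chi> z"
      if yz: "y \<in> carrier (F\<lparr>carrier := f ` carrier P\<rparr>)" "z \<in> carrier (F\<lparr>carrier := f ` carrier P\<rparr>)" for y z
    proof -
      obtain p q where pq: "p \<in> carrier P" "q \<in> carrier P" "y = f p" "z = f q" using yz by auto
      then show ?thesis using \<chi>[of "p \<oplus>\<^bsub>P\<^esub> q"] by (simp add: \<chi>)
    qed
    show "\<chi> \<one>\<^bsub>F\<lparr>carrier := f ` carrier P\<rparr>\<^esub> = \<one>\<^bsub>K\<^esub>" using \<chi>[of "\<one>\<^bsub>P\<^esub>"] by simp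
  qed
  then show ?thesis using \<chi> by blast
qed

text \<open>The induction statement for Zariski's lemma: for every nonzero element of the subring \<open>R\<close> there is
  a point of \<open>R\<close> with values in \<open>K\<close> at which it does not vanish. Asking for a point only would not
  survive the adjunction of an element, where leading coefficients have to stay nonzero.\<close>

definition has_points ::
    "('k, 'd) ring_scheme \<Rightarrow> ('a, 'e) ring_scheme \<Rightarrow> ('k \<Rightarrow> 'a) \<Rightarrow> 'a set \<Rightarrow> bool" where
  "has_points K F \<iota> R \<longleftrightarrow> subring R F \<and> \<iota> ` carrier K \<subseteq> R \<and>
     (\<forall>b\<in>R. b \<noteq> \<zero>\<^bsub>F\<^esub> \<longrightarrow>
        (\<exists>\<chi>\<in>ring_hom (F\<lparr>carrier := R\<rparr>) K. (\<forall>c\<in>carrier K. \<chi> (\<iota> c) = c) \<and> \<chi> b \<noteq> \<zero>\<^bsub>K\<^esub>))"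

locale simple_extension =
  fixes K :: "('k, 'd) ring_scheme" and F :: "('a, 'e) ring_scheme" and \<iota> :: "'k \<Rightarrow> 'a"
    and R :: "'a set" and x :: 'a
  assumes K_closed: "algebraically_closed K" and F_field: "field F"
    and points: "has_points K F \<iota> R" and x: "x \<in> carrier F"
begin

abbreviation A where "A \<equiv> F\<lparr>carrier := R\<rparr>"
abbreviation P where "P \<equiv> UP A"

sublocale K: algebraically_closed K by (rule K_closed)
sublocale F: field F by (rule F_field)

lemma R_subring: "subring R F" using points by (simp add: has_points_def)

lemma A_domain: "domain A"
  using F.subring_is_domain[OF R_subring] .

sublocale A: "domain" A by (rule A_domain)
sublocale UP_domain A P by unfold_locales simp
sublocale U: UP_pre_univ_prop A F "\<lambda>y. y" P
proof -
  have "(\<lambda>y. y) \<in> ring_hom A F"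
    using subringE(1)[OF R_subring] by (intro ring_hom_memI) auto
  then show "UP_pre_univ_prop A F (\<lambda>y. y)"
    by unfold_locales
qed

definition ev :: "(nat \<Rightarrow> 'a) \<Rightarrow> 'a" where "ev = UnivPoly.eval A F (\<lambda>y. y) x"

lemma ev_hom: "ev \<in> ring_hom P F"
  unfolding ev_def by (rule U.eval_ring_hom[OF x])

sublocale ev: ring_hom_cring P F ev
  by unfold_locales (rule ev_hom)

lemma ev_const: "r \<in> R \<Longrightarrow> ev (up_ring.monom P r 0) = r"
  unfolding ev_def using U.eval_const[OF x] by simp

lemma ev_smult:
  assumes "r \<in> R" "p \<in> carrier P"
  shows "ev (r \<odot>\<^bsub>P\<^esub> p) = r \<otimes>\<^bsub>F\<^esub> ev p"
  using assms ev_const[OF assms(1)] by (simp add: monom_mult_is_smult[symmetric])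

lemma extend_point:
  assumes \<chi>: "\<chi> \<in> ring_hom A K" "\<And>c. c \<in> carrier K \<Longrightarrow> \<chi> (\<iota> c) = c" and \<xi>: "\<xi> \<in> carrier K"
    and ker: "\<And>p. \<lbrakk>p \<in> carrier P; ev p = \<zero>\<^bsub>F\<^esub>\<rbrakk> \<Longrightarrow> UnivPoly.eval A K \<chi> \<xi> p = \<zero>\<^bsub>K\<^esub>"
  shows "\<exists>\<psi>\<in>ring_hom (F\<lparr>carrier := ev ` carrier P\<rparr>) K. (\<forall>c\<in>carrier K. \<psi> (\<iota> c) = c) \<and>
    (\<forall>p\<in>carrier P. \<psi> (ev p) = UnivPoly.eval A K \<chi> \<xi> p)"
proof -
  interpret V: UP_pre_univ_prop A K \<chi> P
    by unfold_locales (rule \<chi>(1))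
  obtain \<psi> where \<psi>: "\<psi> \<in> ring_hom (F\<lparr>carrier := ev ` carrier P\<rparr>) K"
      "\<And>p. p \<in> carrier P \<Longrightarrow> \<psi> (ev p) = UnivPoly.eval A K \<chi> \<xi> p"
    using ring_hom_factor[OF _ F.ring_axioms K.ring_axioms ev_hom V.eval_ring_hom[OF \<xi>] ker] P.ring_axioms by blast
  have "\<psi> (\<iota> c) = c" if c: "c \<in> carrier K" for c
  proof -
    have "\<iota> c \<in> R" using points c by (auto simp: has_points_def)
    then show ?thesis
      using \<psi>(2)[of "up_ring.monom P (\<iota> c) 0"] ev_const[of "\<iota> c"] V.eval_const[OF \<xi>, of "\<iota> c"] \<chi>(2)[OF c] by simp
  qed
  then show ?thesis using \<psi> by blast
qed

text \<open>Take a point of \<open>R\<close> at which the leading coefficient of \<open>h\<close> does not vanish, and send \<open>x\<close> to a value that is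
  not a root of the resulting polynomial over \<open>K\<close>.\<close>

lemma transcendental_case:
  assumes inj: "\<And>p. \<lbrakk>p \<in> carrier P; ev p = \<zero>\<^bsub>F\<^esub>\<rbrakk> \<Longrightarrow> p = \<zero>\<^bsub>P\<^esub>"
    and h: "h \<in> carrier P" "h \<noteq> \<zero>\<^bsub>P\<^esub>"
  shows "\<exists>\<psi>\<in>ring_hom (F\<lparr>carrier := ev ` carrier P\<rparr>) K. (\<forall>c\<in>carrier K. \<psi> (\<iota> c) = c) \<and> \<psi> (ev h) \<noteq> \<zero>\<^bsub>K\<^esub>"
proof -
  let ?a = "up_ring.coeff P h (deg A h)"
  have "?a \<in> R" "?a \<noteq> \<zero>\<^bsub>F\<^esub>" using lcoeff_nonzero[OF h(2,1)] coeff_closed[OF h(1)] by auto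
  then obtain \<chi> where \<chi>: "\<chi> \<in> ring_hom A K" "\<And>c. c \<in> carrier K \<Longrightarrow> \<chi> (\<iota> c) = c" "\<chi> ?a \<noteq> \<zero>\<^bsub>K\<^esub>"
    using points by (auto simp: has_points_def)
  interpret V: UP_pre_univ_prop A K \<chi> P
    by unfold_locales (rule \<chi>(1))
  let ?c = "\<lambda>i. \<chi> (up_ring.coeff P h i)"
  have c: "?c i \<in> carrier K" for i using coeff_closed[OF h(1)] by simp
  have "\<exists>\<xi>\<in>carrier K. (\<Oplus>\<^bsub>K\<^esub>i\<in>{..deg A h}. ?c i \<otimes>\<^bsub>K\<^esub> \<xi> [^]\<^bsub>K\<^esub> i) \<noteq> \<zero>\<^bsub>K\<^esub>"
  proof (cases "deg A h = 0")
    case True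
    then show ?thesis using \<chi>(3) c[of 0] by (intro bexI[of _ "\<zero>\<^bsub>K\<^esub>"]) auto
  next
    case False
    then obtain \<xi> where "\<xi> \<in> carrier K" "(\<Oplus>\<^bsub>K\<^esub>i\<in>{..deg A h}. ?c i \<otimes>\<^bsub>K\<^esub> \<xi> [^]\<^bsub>K\<^esub> i) = \<one>\<^bsub>K\<^esub>"
      using polynomial_attains_value[where c = ?c and n = "deg A h", OF K_closed c _ \<chi>(3) K.one_closed] by auto
    then show ?thesis by (intro bexI[of _ \<xi>]) simp_all
  qed
  then obtain \<xi> where \<xi>: "\<xi> \<in> carrier K" "UnivPoly.eval A K \<chi> \<xi> h \<noteq> \<zero>\<^bsub>K\<^esub>"
    by (auto simp: eval_on_carrier[OF h(1)])
  have "UnivPoly.eval A K \<chi> \<xi> p = \<zero>\<^bsub>K\<^esub>" if "p \<in> carrier P" "ev p = \<zero>\<^bsub>F\<^esub>" for p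
  proof -
    interpret e: ring_hom_cring P K "UnivPoly.eval A K \<chi> \<xi>"
      by unfold_locales (rule V.eval_ring_hom[OF \<xi>(1)])
    show ?thesis using inj[OF that] by simp
  qed
  from extend_point[OF \<chi>(1,2) \<xi>(1) this]
  obtain \<psi> where \<psi>: "\<psi> \<in> ring_hom (F\<lparr>carrier := ev ` carrier P\<rparr>) K" "\<forall>c\<in>carrier K. \<psi> (\<iota> c) = c"
      "\<forall>p\<in>carrier P. \<psi> (ev p) = UnivPoly.eval A K \<chi> \<xi> p" by blast
  show ?thesis by (intro bexI[OF _ \<psi>(1)] conjI \<psi>(2)) (use \<psi>(3) h(1) \<xi>(2) in simp)
qed

text \<open>Division with remainder after multiplying \<open>p\<close> by a power \<open>l\<close> of the leading coefficient of \<open>g\<close>.\<close>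

lemma pseudo_division:
  assumes "g \<in> carrier P" "g \<noteq> \<zero>\<^bsub>P\<^esub>" "p \<in> carrier P"
  obtains l q r where "l \<in> R" "l \<noteq> \<zero>\<^bsub>F\<^esub>" "\<exists>k::nat. l = up_ring.coeff P g (deg A g) [^]\<^bsub>A\<^esub> k"
    "q \<in> carrier P" "r \<in> carrier P"
    "l \<odot>\<^bsub>P\<^esub> p = g \<otimes>\<^bsub>P\<^esub> q \<oplus>\<^bsub>P\<^esub> r" "r = \<zero>\<^bsub>P\<^esub> \<or> deg A r < deg A g"
proof -
  let ?a = "up_ring.coeff P g (deg A g)"
  obtain q r and k :: nat where *: "q \<in> carrier P" "r \<in> carrier P"
      "?a [^]\<^bsub>A\<^esub> k \<odot>\<^bsub>P\<^esub> p = g \<otimes>\<^bsub>P\<^esub> q \<oplus>\<^bsub>P\<^esub> r" "r = \<zero>\<^bsub>P\<^esub> \<or> deg A r < deg A g"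
    using long_div_theorem[OF assms(1,3,2)] by blast
  have a: "?a \<in> carrier A" "?a \<noteq> \<zero>\<^bsub>A\<^esub>"
    using lcoeff_nonzero[OF assms(2,1)] coeff_closed[OF assms(1)] by auto
  have pow: "?a [^]\<^bsub>A\<^esub> n \<in> carrier A" for n :: nat by (rule A.nat_pow_closed[OF a(1)])
  have "?a [^]\<^bsub>A\<^esub> k \<noteq> \<zero>\<^bsub>A\<^esub>"
  proof (induction k)
    case 0
    show ?case by (simp only: A.nat_pow_0 A.one_not_zero not_False_eq_True)
  next
    case (Suc k)
    then show ?case using A.integral[OF _ pow[of k] a(1)] a(2) by (auto simp only: A.nat_pow_Suc)
  qed
  then show ?thesis using that[of "?a [^]\<^bsub>A\<^esub> k" q r] pow[of k] * by auto
qed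

text \<open>Now \<open>x\<close> is algebraic, and \<open>f\<close> is a relation of least degree. It plays the role of the minimal
  polynomial, with pseudo-division in place of division because \<open>R\<close> is not a field.\<close>

context
  fixes f
  assumes f: "f \<in> carrier P" "f \<noteq> \<zero>\<^bsub>P\<^esub>" "ev f = \<zero>\<^bsub>F\<^esub>"
    and f_least: "\<And>p. \<lbrakk>p \<in> carrier P; ev p = \<zero>\<^bsub>F\<^esub>; p \<noteq> \<zero>\<^bsub>P\<^esub>\<rbrakk> \<Longrightarrow> deg A f \<le> deg A p"
begin

lemma deg_f_pos: "deg A f > 0"
proof (rule ccontr)
  assume "\<not> deg A f > 0"
  then have fm: "f = up_ring.monom P (up_ring.coeff P f 0) 0" using deg_zero_impl_monom[OF f(1)] by simp
  then have "up_ring.coeff P f 0 = \<zero>\<^bsub>F\<^esub>"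
    using ev_const[of "up_ring.coeff P f 0"] coeff_closed[OF f(1), of 0] f(3) by simp
  then have "f = up_ring.monom P \<zero>\<^bsub>A\<^esub> 0" using fm by simp
  also have "\<dots> = \<zero>\<^bsub>P\<^esub>" by (rule monom_zero)
  finally show False using f(2) by simp
qed

text \<open>Let \<open>g\<close> have least degree among the polynomials whose value at \<open>x\<close> is a nonzero multiple of \<open>ev h\<close>.
  Dividing \<open>g\<close> by \<open>f\<close> shows that its degree is less than that of \<open>f\<close>. Dividing \<open>f\<close> by \<open>g\<close> leaves no
  remainder, and unless \<open>g\<close> is constant the quotient is a relation of smaller degree than \<open>f\<close>.\<close>

lemma multiple_in_ground_ring:
  assumes h: "h \<in> carrier P" "ev h \<noteq> \<zero>\<^bsub>F\<^esub>"
  shows "\<exists>q\<in>carrier P. ev h \<otimes>\<^bsub>F\<^esub> ev q \<in> R \<and> ev h \<otimes>\<^bsub>F\<^esub> ev q \<noteq> \<zero>\<^bsub>F\<^esub>"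
proof -
  define G where "G g \<longleftrightarrow> g \<in> carrier P \<and> ev g \<noteq> \<zero>\<^bsub>F\<^esub> \<and> (\<exists>q\<in>carrier P. ev g = ev h \<otimes>\<^bsub>F\<^esub> ev q)" for g
  have "G h" using h by (auto simp: G_def intro!: bexI[of _ "\<one>\<^bsub>P\<^esub>"])
  then obtain g where g: "G g" and least: "\<And>g'. G g' \<Longrightarrow> deg A g \<le> deg A g'"
    by (metis arg_min_natI arg_min_nat_le)
  obtain q0 where q0: "q0 \<in> carrier P" "ev g = ev h \<otimes>\<^bsub>F\<^esub> ev q0" and gP: "g \<in> carrier P" and g0: "ev g \<noteq> \<zero>\<^bsub>F\<^esub>"
    using g by (auto simp: G_def)
  have gz: "g \<noteq> \<zero>\<^bsub>P\<^esub>" using g0 by auto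
  have Rc: "r \<in> carrier F" if "r \<in> R" for r using subringE(1)[OF R_subring] that by blast
  have "deg A g < deg A f"
  proof -
    obtain l q r where lqr: "l \<in> R" "l \<noteq> \<zero>\<^bsub>F\<^esub>" "q \<in> carrier P" "r \<in> carrier P"
        "l \<odot>\<^bsub>P\<^esub> g = f \<otimes>\<^bsub>P\<^esub> q \<oplus>\<^bsub>P\<^esub> r" "r = \<zero>\<^bsub>P\<^esub> \<or> deg A r < deg A f"
      using pseudo_division[OF f(1,2) gP] by metis
    have "ev r = l \<otimes>\<^bsub>F\<^esub> ev g"
      using ev_smult[OF lqr(1) gP] lqr(1-4) f gP unfolding lqr(5) by simp
    then have "ev r \<noteq> \<zero>\<^bsub>F\<^esub>" "ev r = ev h \<otimes>\<^bsub>F\<^esub> ev (l \<odot>\<^bsub>P\<^esub> q0)"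
      using lqr g0 q0 h gP Rc F.integral_iff by (auto simp: ev_smult F.m_lcomm)
    then have "G r" using lqr q0 by (auto simp: G_def intro!: bexI[of _ "l \<odot>\<^bsub>P\<^esub> q0"])
    moreover have "r \<noteq> \<zero>\<^bsub>P\<^esub>" using \<open>ev r \<noteq> \<zero>\<^bsub>F\<^esub>\<close> by auto
    ultimately show ?thesis using least[of r] lqr(6) by auto
  qed
  have "deg A g = 0"
  proof (rule ccontr)
    assume pos: "deg A g \<noteq> 0"
    obtain l q r where lqr: "l \<in> R" "l \<noteq> \<zero>\<^bsub>F\<^esub>" "q \<in> carrier P" "r \<in> carrier P"
        "l \<odot>\<^bsub>P\<^esub> f = g \<otimes>\<^bsub>P\<^esub> q \<oplus>\<^bsub>P\<^esub> r" "r = \<zero>\<^bsub>P\<^esub> \<or> deg A r < deg A g"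
      using pseudo_division[OF gP gz f(1)] by metis
    have sum0: "ev g \<otimes>\<^bsub>F\<^esub> ev q \<oplus>\<^bsub>F\<^esub> ev r = \<zero>\<^bsub>F\<^esub>"
      using ev_smult[OF lqr(1) f(1)] lqr(1-4) f gP Rc unfolding lqr(5) by simp
    have "ev r = \<zero>\<^bsub>F\<^esub>"
    proof (rule ccontr)
      assume r: "ev r \<noteq> \<zero>\<^bsub>F\<^esub>"
      have "ev r = \<ominus>\<^bsub>F\<^esub> (ev g \<otimes>\<^bsub>F\<^esub> ev q)"
        using sum0 lqr gP by (intro F.minus_equality[symmetric]) (simp_all add: F.a_comm)
      also have "\<dots> = ev h \<otimes>\<^bsub>F\<^esub> ev (\<ominus>\<^bsub>P\<^esub> (q0 \<otimes>\<^bsub>P\<^esub> q))"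
        using q0 lqr h by (simp add: F.m_assoc F.r_minus)
      finally have "G r" using r lqr q0 by (auto simp: G_def intro!: bexI[of _ "\<ominus>\<^bsub>P\<^esub> (q0 \<otimes>\<^bsub>P\<^esub> q)"])
      moreover have "r \<noteq> \<zero>\<^bsub>P\<^esub>" using r by auto
      ultimately show False using least[of r] lqr(6) by auto
    qed
    then have "r = \<zero>\<^bsub>P\<^esub>"
      using f_least[OF lqr(4)] lqr(6) \<open>deg A g < deg A f\<close> by fastforce
    then have eq: "l \<odot>\<^bsub>P\<^esub> f = g \<otimes>\<^bsub>P\<^esub> q" using lqr gP by simp
    have "ev q = \<zero>\<^bsub>F\<^esub>"
      using sum0 \<open>ev r = \<zero>\<^bsub>F\<^esub>\<close> g0 gP lqr F.integral_iff by auto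
    moreover have degf: "deg A (l \<odot>\<^bsub>P\<^esub> f) = deg A f" using deg_smult[of l f] lqr(1,2) f(1) by simp
    then have "g \<otimes>\<^bsub>P\<^esub> q \<noteq> \<zero>\<^bsub>P\<^esub>" using eq deg_f_pos by auto
    then have qz: "q \<noteq> \<zero>\<^bsub>P\<^esub>" using gP by auto
    ultimately have "deg A f \<le> deg A q" using f_least[OF lqr(3)] by blast
    moreover have "deg A f = deg A g + deg A q" using eq degf deg_mult[OF gz qz gP lqr(3)] by simp
    ultimately show False using pos by simp
  qed
  then have gm: "g = up_ring.monom P (up_ring.coeff P g 0) 0" using deg_zero_impl_monom[OF gP] by simp
  have gR: "up_ring.coeff P g 0 \<in> R" using coeff_closed[OF gP, of 0] by simp
  have "ev g = up_ring.coeff P g 0" using ev_const[OF gR] gm by simp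
  then have "ev g \<in> R" using gR by simp
  then show ?thesis using q0 g0 by metis
qed

text \<open>Take a point \<open>\<chi>\<close> of \<open>R\<close> at which neither the leading coefficient of \<open>f\<close> nor a nonzero multiple of
  \<open>ev h\<close> in \<open>R\<close> vanishes, and send \<open>x\<close> to a root of the image of \<open>f\<close> over \<open>K\<close>. All relations of \<open>x\<close>
  are respected, as they are multiples of \<open>f\<close> up to a power of its leading coefficient, and \<open>ev h\<close> has
  a nonzero image because its multiple does.\<close>

lemma algebraic_case:
  assumes h: "h \<in> carrier P" "ev h \<noteq> \<zero>\<^bsub>F\<^esub>"
  shows "\<exists>\<psi>\<in>ring_hom (F\<lparr>carrier := ev ` carrier P\<rparr>) K. (\<forall>c\<in>carrier K. \<psi> (\<iota> c) = c) \<and> \<psi> (ev h) \<noteq> \<zero>\<^bsub>K\<^esub>"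
proof -
  let ?c = "up_ring.coeff P f (deg A f)"
  obtain q where q: "q \<in> carrier P" "ev h \<otimes>\<^bsub>F\<^esub> ev q \<in> R" "ev h \<otimes>\<^bsub>F\<^esub> ev q \<noteq> \<zero>\<^bsub>F\<^esub>"
    using multiple_in_ground_ring[OF h] by blast
  define a where "a = ev h \<otimes>\<^bsub>F\<^esub> ev q"
  have a: "a \<in> R" "a \<noteq> \<zero>\<^bsub>F\<^esub>" using q by (auto simp: a_def)
  have c: "?c \<in> R" "?c \<noteq> \<zero>\<^bsub>F\<^esub>" using lcoeff_nonzero[OF f(2,1)] coeff_closed[OF f(1)] by auto
  have "?c \<otimes>\<^bsub>F\<^esub> a \<in> R" "?c \<otimes>\<^bsub>F\<^esub> a \<noteq> \<zero>\<^bsub>F\<^esub>"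
    using A.m_closed[of ?c a] A.integral[of ?c a] a c by auto
  then obtain \<chi> where \<chi>: "\<chi> \<in> ring_hom A K" "\<And>c. c \<in> carrier K \<Longrightarrow> \<chi> (\<iota> c) = c" "\<chi> (?c \<otimes>\<^bsub>F\<^esub> a) \<noteq> \<zero>\<^bsub>K\<^esub>"
    using points by (auto simp: has_points_def)
  interpret V: UP_pre_univ_prop A K \<chi> P
    by unfold_locales (rule \<chi>(1))
  have \<chi>0: "\<chi> ?c \<noteq> \<zero>\<^bsub>K\<^esub>" "\<chi> a \<noteq> \<zero>\<^bsub>K\<^esub>"
    using \<chi>(3) a c V.hom_mult[of ?c a] V.hom_closed[of ?c] V.hom_closed[of a] by auto
  obtain \<xi> where \<xi>: "\<xi> \<in> carrier K"
      "(\<Oplus>\<^bsub>K\<^esub>i\<in>{..deg A f}. \<chi> (up_ring.coeff P f i) \<otimes>\<^bsub>K\<^esub> \<xi> [^]\<^bsub>K\<^esub> i) = \<zero>\<^bsub>K\<^esub>"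
    using polynomial_attains_value[where c = "\<lambda>i. \<chi> (up_ring.coeff P f i)" and n = "deg A f",
        OF K_closed V.hom_closed[OF coeff_closed[OF f(1)]] deg_f_pos \<chi>0(1) K.zero_closed] by auto
  let ?e = "UnivPoly.eval A K \<chi> \<xi>"
  interpret e: ring_hom_cring P K ?e
    by unfold_locales (rule V.eval_ring_hom[OF \<xi>(1)])
  have ef: "?e f = \<zero>\<^bsub>K\<^esub>" using eval_on_carrier[OF f(1), of K \<chi> \<xi>] \<xi>(2) by simp
  have esm: "?e (l \<odot>\<^bsub>P\<^esub> p) = \<chi> l \<otimes>\<^bsub>K\<^esub> ?e p" if "l \<in> R" "p \<in> carrier P" for l p
    using that V.eval_const[OF \<xi>(1), of l] by (simp add: monom_mult_is_smult[symmetric])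
  have ker: "?e p = \<zero>\<^bsub>K\<^esub>" if p: "p \<in> carrier P" "ev p = \<zero>\<^bsub>F\<^esub>" for p
  proof -
    obtain l q r and k :: nat where lqr: "l \<in> R" "l = ?c [^]\<^bsub>A\<^esub> k" "q \<in> carrier P" "r \<in> carrier P"
        "l \<odot>\<^bsub>P\<^esub> p = f \<otimes>\<^bsub>P\<^esub> q \<oplus>\<^bsub>P\<^esub> r" "r = \<zero>\<^bsub>P\<^esub> \<or> deg A r < deg A f"
      using pseudo_division[OF f(1,2) p(1)] by metis
    have "l \<in> carrier F" using subringE(1)[OF R_subring] lqr by blast
    then have "ev r = \<zero>\<^bsub>F\<^esub>"
      using ev_smult[OF lqr(1) p(1)] lqr(1,3,4) f p unfolding lqr(5) by simp
    then have "r = \<zero>\<^bsub>P\<^esub>" using f_least[OF lqr(4)] lqr(6) by fastforce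
    then have "\<chi> l \<otimes>\<^bsub>K\<^esub> ?e p = \<zero>\<^bsub>K\<^esub>"
      using esm[OF lqr(1) p(1)] lqr(1,3,4) f p ef unfolding lqr(5) by simp
    moreover have "\<chi> l \<noteq> \<zero>\<^bsub>K\<^esub>"
    proof -
      have "\<chi> l = \<chi> ?c [^]\<^bsub>K\<^esub> k" unfolding lqr(2) using c by (intro V.hom_pow) simp
      moreover have "\<chi> ?c [^]\<^bsub>K\<^esub> k \<noteq> \<zero>\<^bsub>K\<^esub>"
        using \<chi>0(1) c V.hom_closed[of ?c] K.integral_iff by (induction k) auto
      ultimately show ?thesis by simp
    qed
    ultimately show ?thesis using K.integral_iff[of "\<chi> l" "?e p"] lqr p by auto
  qed
  obtain \<psi> where \<psi>: "\<psi> \<in> ring_hom (F\<lparr>carrier := ev ` carrier P\<rparr>) K" "\<And>c. c \<in> carrier K \<Longrightarrow> \<psi> (\<iota> c) = c"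
      "\<And>p. p \<in> carrier P \<Longrightarrow> \<psi> (ev p) = ?e p"
    using extend_point[OF \<chi>(1,2) \<xi>(1) ker] by blast
  have "ev (up_ring.monom P a 0) = ev (h \<otimes>\<^bsub>P\<^esub> q)" using ev_const[OF a(1)] h q by (simp add: a_def)
  moreover have "up_ring.monom P a 0 \<in> carrier P" using a by simp
  ultimately have "?e (up_ring.monom P a 0) = ?e (h \<otimes>\<^bsub>P\<^esub> q)"
    using \<psi>(3)[of "up_ring.monom P a 0"] \<psi>(3)[of "h \<otimes>\<^bsub>P\<^esub> q"] h q by simp
  then have "\<chi> a = ?e h \<otimes>\<^bsub>K\<^esub> ?e q" using V.eval_const[OF \<xi>(1), of a] a h q by simp
  then have "?e h \<noteq> \<zero>\<^bsub>K\<^esub>" using \<chi>0(2) q by auto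
  then show ?thesis by (intro bexI[OF _ \<psi>(1)] conjI ballI \<psi>(2)) (simp_all add: \<psi>(3)[OF h(1)])
qed

end

lemma simple_extension_has_points: "has_points K F \<iota> (ev ` carrier P)"
  unfolding has_points_def
proof (intro conjI ballI impI)
  show "subring (ev ` carrier P) F"
    by (rule ring_hom_ring.img_is_subring[OF ring_hom_ringI2[OF P.ring_axioms F.ring_axioms ev_hom]
          P.carrier_is_subring])
  show "\<iota> ` carrier K \<subseteq> ev ` carrier P"
  proof clarify
    fix c assume "c \<in> carrier K"
    then have "\<iota> c \<in> R" using points by (auto simp: has_points_def)
    then show "\<iota> c \<in> ev ` carrier P"
      using ev_const[of "\<iota> c"] by (intro image_eqI[of _ _ "up_ring.monom P (\<iota> c) 0"]) auto
  qed
  fix b assume b: "b \<in> ev ` carrier P" "b \<noteq> \<zero>\<^bsub>F\<^esub>"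
  then obtain h where h: "h \<in> carrier P" "b = ev h" "ev h \<noteq> \<zero>\<^bsub>F\<^esub>" by auto
  show "\<exists>\<psi>\<in>ring_hom (F\<lparr>carrier := ev ` carrier P\<rparr>) K. (\<forall>c\<in>carrier K. \<psi> (\<iota> c) = c) \<and> \<psi> b \<noteq> \<zero>\<^bsub>K\<^esub>"
  proof (cases "\<exists>p\<in>carrier P. ev p = \<zero>\<^bsub>F\<^esub> \<and> p \<noteq> \<zero>\<^bsub>P\<^esub>")
    case False
    have "h \<noteq> \<zero>\<^bsub>P\<^esub>" using h(3) by auto
    then show ?thesis using transcendental_case[OF _ h(1)] False h(2) by blast
  next
    case True
    define Q where "Q p \<longleftrightarrow> p \<in> carrier P \<and> ev p = \<zero>\<^bsub>F\<^esub> \<and> p \<noteq> \<zero>\<^bsub>P\<^esub>" for p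
    have "\<exists>p. Q p" using True by (auto simp: Q_def)
    then obtain f where "Q f" "\<And>p. Q p \<Longrightarrow> deg A f \<le> deg A p"
      by (metis arg_min_natI arg_min_nat_le)
    then show ?thesis using algebraic_case[of f h] h by (auto simp: Q_def)
  qed
qed

lemma x_in_extension: "x \<in> ev ` carrier P" "R \<subseteq> ev ` carrier P"
proof -
  have "ev (up_ring.monom P \<one>\<^bsub>A\<^esub> 1) = x" unfolding ev_def by (rule U.eval_monom1[OF x])
  then show "x \<in> ev ` carrier P" by (intro image_eqI[of _ _ "up_ring.monom P \<one>\<^bsub>A\<^esub> 1"] monom_closed A.one_closed) simp
  show "R \<subseteq> ev ` carrier P"
  proof
    fix r assume "r \<in> R"
    then show "r \<in> ev ` carrier P"
      using ev_const[of r] by (intro image_eqI[of _ _ "up_ring.monom P r 0"]) auto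
  qed
qed

end

text \<open>The \<open>K\<close>-points of a \<open>K\<close>-algebra.\<close>

definition character ::
    "('k, 'd) ring_scheme \<Rightarrow> ('k, 's, 'e) module_scheme \<Rightarrow> ('s \<Rightarrow> 'k) \<Rightarrow> bool" where
  "character K S \<chi> \<longleftrightarrow>
     \<chi> \<in> ring_hom S K \<and> (\<forall>a\<in>carrier K. \<forall>s\<in>carrier S. \<chi> (a \<odot>\<^bsub>S\<^esub> s) = a \<otimes>\<^bsub>K\<^esub> \<chi> s)"

lemma characterD:
  assumes "character K S \<chi>"
  shows "s \<in> carrier S \<Longrightarrow> \<chi> s \<in> carrier K"
    and "\<lbrakk>s \<in> carrier S; t \<in> carrier S\<rbrakk> \<Longrightarrow> \<chi> (s \<oplus>\<^bsub>S\<^esub> t) = \<chi> s \<oplus>\<^bsub>K\<^esub> \<chi> t"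
    and "\<lbrakk>s \<in> carrier S; t \<in> carrier S\<rbrakk> \<Longrightarrow> \<chi> (s \<otimes>\<^bsub>S\<^esub> t) = \<chi> s \<otimes>\<^bsub>K\<^esub> \<chi> t"
    and "\<chi> \<one>\<^bsub>S\<^esub> = \<one>\<^bsub>K\<^esub>"
    and "\<lbrakk>a \<in> carrier K; s \<in> carrier S\<rbrakk> \<Longrightarrow> \<chi> (a \<odot>\<^bsub>S\<^esub> s) = a \<otimes>\<^bsub>K\<^esub> \<chi> s"
  using assms by (auto simp: character_def ring_hom_def)

text \<open>Zariski's lemma. Adjoining the residue classes of the generators of \<open>S\<close> one at a time shows that the
  residue field has a point with values in \<open>K\<close>. A homomorphism of fields is injective, so it is the
  inverse of the inclusion of \<open>K\<close>.\<close>

lemma residue_field_is_ground_field: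
  assumes K: "algebraically_closed K" and S: "algebra K S" and ft: "finite_type_algebra K S"
    and M: "maximalideal M S" and s: "s \<in> carrier S"
  shows "\<exists>!c. c \<in> carrier K \<and> M +>\<^bsub>S\<^esub> s = M +>\<^bsub>S\<^esub> (c \<odot>\<^bsub>S\<^esub> \<one>\<^bsub>S\<^esub>)"
proof -
  interpret K: algebraically_closed K by (rule K)
  interpret S: algebra K S by (rule S)
  interpret M: maximalideal M S by (rule M)
  define F where "F = S Quot M"
  interpret F: field F unfolding F_def by (rule M.quotient_is_field[OF S.M_cring])
  define \<pi> where "\<pi> = (+>\<^bsub>S\<^esub>) M"
  have \<pi>: "\<pi> \<in> ring_hom S F" unfolding \<pi>_def F_def by (rule M.rcos_ring_hom)
  interpret \<pi>: ring_hom_ring S F \<pi> by (rule ring_hom_ringI2[OF S.ring_axioms F.ring_axioms \<pi>])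
  have F_carrier: "carrier F = \<pi> ` carrier S"
    by (auto simp: F_def \<pi>_def FactRing_def A_RCOSETS_def')
  define \<iota> where "\<iota> c = \<pi> (c \<odot>\<^bsub>S\<^esub> \<one>\<^bsub>S\<^esub>)" for c
  have \<iota>: "\<iota> \<in> ring_hom K F"
    unfolding \<iota>_def
    by (rule ring_hom_memI)
       (simp_all add: S.smult_l_distr S.smult_assoc1 S.smult_assoc2 flip: \<pi>.hom_mult)
  interpret \<iota>: ring_hom_ring K F \<iota> by (rule ring_hom_ringI2[OF K.ring_axioms F.ring_axioms \<iota>])
  have \<pi>_smult: "\<pi> (c \<odot>\<^bsub>S\<^esub> t) = \<iota> c \<otimes>\<^bsub>F\<^esub> \<pi> t" if "c \<in> carrier K" "t \<in> carrier S" for c t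
    using that by (simp add: \<iota>_def S.smult_assoc2 flip: \<pi>.hom_mult)
  have \<iota>_inj: "c = \<zero>\<^bsub>K\<^esub>" if c: "c \<in> carrier K" "\<iota> c = \<zero>\<^bsub>F\<^esub>" for c
  proof (rule ccontr)
    assume "c \<noteq> \<zero>\<^bsub>K\<^esub>"
    then have u: "c \<in> Units K" using K.field_Units c by auto
    then have "\<iota> (c \<otimes>\<^bsub>K\<^esub> inv\<^bsub>K\<^esub> c) = \<one>\<^bsub>F\<^esub>" by simp
    moreover have "\<iota> (c \<otimes>\<^bsub>K\<^esub> inv\<^bsub>K\<^esub> c) = \<zero>\<^bsub>F\<^esub>"
      using u c by (subst \<iota>.hom_mult) (auto intro: K.Units_inv_closed)
    ultimately show False by simp
  qed
  have base: "has_points K F \<iota> (\<iota> ` carrier K)"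
  proof -
    have "(\<lambda>c. c) \<in> ring_hom K K" by (rule ring_hom_memI) auto
    then obtain \<psi> where \<psi>: "\<psi> \<in> ring_hom (F\<lparr>carrier := \<iota> ` carrier K\<rparr>) K" "\<And>c. c \<in> carrier K \<Longrightarrow> \<psi> (\<iota> c) = c"
      using ring_hom_factor[OF K.ring_axioms F.ring_axioms K.ring_axioms \<iota> _ \<iota>_inj] by blast
    have "\<psi> b \<noteq> \<zero>\<^bsub>K\<^esub>" if "b \<in> \<iota> ` carrier K" "b \<noteq> \<zero>\<^bsub>F\<^esub>" for b
      using that \<psi>(2) \<iota>.hom_zero by auto
    then show ?thesis
      unfolding has_points_def using \<psi> \<iota>.img_is_subring[OF K.carrier_is_subring]
      by (intro conjI ballI impI bexI[of _ \<psi>]) auto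
  qed
  obtain A where A: "finite A" "A \<subseteq> carrier S"
    and gen: "\<And>B. \<lbrakk>subring B S; submod K B S; A \<subseteq> B\<rbrakk> \<Longrightarrow> B = carrier S"
    using ft unfolding finite_type_algebra_def by blast
  have "\<exists>R. has_points K F \<iota> R \<and> \<pi> ` A \<subseteq> R"
    using A
  proof (induction A rule: finite_induct)
    case empty
    then show ?case using base by blast
  next
    case (insert a A)
    then obtain R where R: "has_points K F \<iota> R" "\<pi> ` A \<subseteq> R" by auto
    have "simple_extension K F \<iota> R (\<pi> a)"
      by (rule simple_extension.intro[OF K F.field_axioms R(1)]) (use insert.prems in auto)
    from simple_extension.simple_extension_has_points[OF this] simple_extension.x_in_extension[OF this]
    show ?case using R(2) by blast
  qed
  then obtain R where R: "has_points K F \<iota> R" "\<pi> ` A \<subseteq> R" by blast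
  have R_subring: "subring R F" and \<iota>R: "\<iota> ` carrier K \<subseteq> R"
    and points: "\<And>b. \<lbrakk>b \<in> R; b \<noteq> \<zero>\<^bsub>F\<^esub>\<rbrakk> \<Longrightarrow> \<exists>\<chi>\<in>ring_hom (F\<lparr>carrier := R\<rparr>) K.
      (\<forall>c\<in>carrier K. \<chi> (\<iota> c) = c) \<and> \<chi> b \<noteq> \<zero>\<^bsub>K\<^esub>"
    using R(1) by (simp_all add: has_points_def)
  note sr = subringE[OF R_subring]
  have "{t \<in> carrier S. \<pi> t \<in> R} = carrier S"
  proof (rule gen)
    show "subring {t \<in> carrier S. \<pi> t \<in> R} S"
      by (rule S.subringI) (use sr in auto)
    show "submod K {t \<in> carrier S. \<pi> t \<in> R} S"
      using sr \<iota>R by (intro submodI[OF S.module]) (auto simp: \<pi>_smult)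
    show "A \<subseteq> {t \<in> carrier S. \<pi> t \<in> R}" using A R(2) by auto
  qed
  then have RF: "R = carrier F" using F_carrier sr(1) by auto
  obtain \<chi> where \<chi>: "\<chi> \<in> ring_hom (F\<lparr>carrier := R\<rparr>) K" "\<And>c. c \<in> carrier K \<Longrightarrow> \<chi> (\<iota> c) = c"
    using points[OF sr(3) F.one_not_zero] by blast
  have "\<chi> \<in> ring_hom F K" using \<chi>(1) RF by (auto simp: ring_hom_def)
  then interpret \<chi>: ring_hom_ring F K \<chi> by (rule ring_hom_ringI2[OF F.ring_axioms K.ring_axioms])
  define c where "c = \<chi> (\<pi> s)"
  have c: "c \<in> carrier K" using s by (simp add: c_def)
  define d where "d = \<pi> s \<ominus>\<^bsub>F\<^esub> \<iota> c"
  have d: "d \<in> carrier F" "\<chi> d = \<zero>\<^bsub>K\<^esub>"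
    using s c \<chi>(2) by (auto simp: d_def c_def F.minus_eq K.r_neg)
  have "d = \<zero>\<^bsub>F\<^esub>"
  proof (rule ccontr)
    assume "d \<noteq> \<zero>\<^bsub>F\<^esub>"
    then have u: "d \<in> Units F" using F.field_Units d by auto
    then have "\<chi> (d \<otimes>\<^bsub>F\<^esub> inv\<^bsub>F\<^esub> d) = \<one>\<^bsub>K\<^esub>" by simp
    moreover have "\<chi> (d \<otimes>\<^bsub>F\<^esub> inv\<^bsub>F\<^esub> d) = \<zero>\<^bsub>K\<^esub>"
      using u d by (subst \<chi>.hom_mult) (auto intro: F.Units_inv_closed)
    ultimately show False by simp
  qed
  then have \<pi>s: "\<pi> s = \<iota> c" using s c by (simp add: d_def)
  show ?thesis
  proof (rule ex1I[of _ c])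
    show "c \<in> carrier K \<and> M +>\<^bsub>S\<^esub> s = M +>\<^bsub>S\<^esub> (c \<odot>\<^bsub>S\<^esub> \<one>\<^bsub>S\<^esub>)"
      using c \<pi>s by (simp add: \<pi>_def \<iota>_def)
    fix c' assume "c' \<in> carrier K \<and> M +>\<^bsub>S\<^esub> s = M +>\<^bsub>S\<^esub> (c' \<odot>\<^bsub>S\<^esub> \<one>\<^bsub>S\<^esub>)"
    then have c': "c' \<in> carrier K" "\<iota> c' = \<iota> c" using \<pi>s by (auto simp: \<pi>_def \<iota>_def)
    have "c' = \<chi> (\<iota> c')" using \<chi>(2)[OF c'(1)] by simp
    then show "c' = c" using c'(2) \<chi>(2)[OF c] by simp
  qed
qed

lemma residue_at_character:
  assumes K: "algebraically_closed K" and S: "algebra K S" and ft: "finite_type_algebra K S"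
    and M: "maximalideal M S"
  shows "character K S (residue_at K S M)"
    and "M = {s \<in> carrier S. residue_at K S M s = \<zero>\<^bsub>K\<^esub>}"
proof -
  interpret K: algebraically_closed K by (rule K)
  interpret S: algebra K S by (rule S)
  interpret M: maximalideal M S by (rule M)
  let ?\<chi> = "residue_at K S M"
  note ex1 = residue_field_is_ground_field[OF assms]
  have r: "?\<chi> s \<in> carrier K" "M +>\<^bsub>S\<^esub> s = M +>\<^bsub>S\<^esub> (?\<chi> s \<odot>\<^bsub>S\<^esub> \<one>\<^bsub>S\<^esub>)" if "s \<in> carrier S" for s
    using theI'[OF ex1[OF that]] unfolding residue_at_def by auto
  have eq: "?\<chi> s = c" if "s \<in> carrier S" "c \<in> carrier K" "M +>\<^bsub>S\<^esub> s = M +>\<^bsub>S\<^esub> (c \<odot>\<^bsub>S\<^esub> \<one>\<^bsub>S\<^esub>)" for s c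
    unfolding residue_at_def using that by (intro the1_equality[OF ex1[OF that(1)]]) auto
  interpret \<pi>: ring_hom_ring S "S Quot M" "(+>\<^bsub>S\<^esub>) M" by (rule M.rcos_ring_hom_ring)
  show "character K S ?\<chi>"
    unfolding character_def
  proof (intro conjI ballI ring_hom_memI)
    show "?\<chi> s \<in> carrier K" if "s \<in> carrier S" for s by (rule r(1)[OF that])
    show "?\<chi> (s \<otimes>\<^bsub>S\<^esub> t) = ?\<chi> s \<otimes>\<^bsub>K\<^esub> ?\<chi> t" if s: "s \<in> carrier S" and t: "t \<in> carrier S" for s t
    proof (rule eq)
      have "M +>\<^bsub>S\<^esub> (s \<otimes>\<^bsub>S\<^esub> t) = (M +>\<^bsub>S\<^esub> (?\<chi> s \<odot>\<^bsub>S\<^esub> \<one>\<^bsub>S\<^esub>)) \<otimes>\<^bsub>S Quot M\<^esub> (M +>\<^bsub>S\<^esub> (?\<chi> t \<odot>\<^bsub>S\<^esub> \<one>\<^bsub>S\<^esub>))"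
        using s t r(2)[OF s] r(2)[OF t] by simp
      also have "\<dots> = M +>\<^bsub>S\<^esub> ((?\<chi> s \<odot>\<^bsub>S\<^esub> \<one>\<^bsub>S\<^esub>) \<otimes>\<^bsub>S\<^esub> (?\<chi> t \<odot>\<^bsub>S\<^esub> \<one>\<^bsub>S\<^esub>))"
        using r(1)[OF s] r(1)[OF t] by simp
      finally show "M +>\<^bsub>S\<^esub> (s \<otimes>\<^bsub>S\<^esub> t) = M +>\<^bsub>S\<^esub> ((?\<chi> s \<otimes>\<^bsub>K\<^esub> ?\<chi> t) \<odot>\<^bsub>S\<^esub> \<one>\<^bsub>S\<^esub>)"
        using r(1)[OF s] r(1)[OF t] by (simp add: S.smult_assoc1 S.smult_assoc2)
    qed (use s t r in auto)
    show "?\<chi> (s \<oplus>\<^bsub>S\<^esub> t) = ?\<chi> s \<oplus>\<^bsub>K\<^esub> ?\<chi> t" if s: "s \<in> carrier S" and t: "t \<in> carrier S" for s t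
    proof (rule eq)
      have "M +>\<^bsub>S\<^esub> (s \<oplus>\<^bsub>S\<^esub> t) = (M +>\<^bsub>S\<^esub> (?\<chi> s \<odot>\<^bsub>S\<^esub> \<one>\<^bsub>S\<^esub>)) \<oplus>\<^bsub>S Quot M\<^esub> (M +>\<^bsub>S\<^esub> (?\<chi> t \<odot>\<^bsub>S\<^esub> \<one>\<^bsub>S\<^esub>))"
        using s t r(2)[OF s] r(2)[OF t] by simp
      also have "\<dots> = M +>\<^bsub>S\<^esub> ((?\<chi> s \<odot>\<^bsub>S\<^esub> \<one>\<^bsub>S\<^esub>) \<oplus>\<^bsub>S\<^esub> (?\<chi> t \<odot>\<^bsub>S\<^esub> \<one>\<^bsub>S\<^esub>))"
        using r(1)[OF s] r(1)[OF t] by simp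
      finally show "M +>\<^bsub>S\<^esub> (s \<oplus>\<^bsub>S\<^esub> t) = M +>\<^bsub>S\<^esub> ((?\<chi> s \<oplus>\<^bsub>K\<^esub> ?\<chi> t) \<odot>\<^bsub>S\<^esub> \<one>\<^bsub>S\<^esub>)"
        using r(1)[OF s] r(1)[OF t] by (simp add: S.smult_l_distr)
    qed (use s t r in auto)
    show "?\<chi> \<one>\<^bsub>S\<^esub> = \<one>\<^bsub>K\<^esub>" by (rule eq) simp_all
    show "?\<chi> (a \<odot>\<^bsub>S\<^esub> s) = a \<otimes>\<^bsub>K\<^esub> ?\<chi> s" if a: "a \<in> carrier K" and s: "s \<in> carrier S" for a s
    proof (rule eq)
      have "M +>\<^bsub>S\<^esub> (a \<odot>\<^bsub>S\<^esub> s) = M +>\<^bsub>S\<^esub> ((a \<odot>\<^bsub>S\<^esub> \<one>\<^bsub>S\<^esub>) \<otimes>\<^bsub>S\<^esub> s)"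
        using a s by (simp add: S.smult_assoc2)
      also have "\<dots> = (M +>\<^bsub>S\<^esub> (a \<odot>\<^bsub>S\<^esub> \<one>\<^bsub>S\<^esub>)) \<otimes>\<^bsub>S Quot M\<^esub> (M +>\<^bsub>S\<^esub> (?\<chi> s \<odot>\<^bsub>S\<^esub> \<one>\<^bsub>S\<^esub>))"
        using a s r(2)[OF s] by simp
      also have "\<dots> = M +>\<^bsub>S\<^esub> ((a \<odot>\<^bsub>S\<^esub> \<one>\<^bsub>S\<^esub>) \<otimes>\<^bsub>S\<^esub> (?\<chi> s \<odot>\<^bsub>S\<^esub> \<one>\<^bsub>S\<^esub>))"
        using a r(1)[OF s] by simp
      finally show "M +>\<^bsub>S\<^esub> (a \<odot>\<^bsub>S\<^esub> s) = M +>\<^bsub>S\<^esub> ((a \<otimes>\<^bsub>K\<^esub> ?\<chi> s) \<odot>\<^bsub>S\<^esub> \<one>\<^bsub>S\<^esub>)"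
        using a r(1)[OF s] by (simp add: S.smult_assoc1 S.smult_assoc2)
    qed (use a s r in auto)
  qed
  have zero: "M +>\<^bsub>S\<^esub> (\<zero>\<^bsub>K\<^esub> \<odot>\<^bsub>S\<^esub> \<one>\<^bsub>S\<^esub>) = M"
    using abelian_group.a_coset_add_zero[OF S.abelian_group_axioms M.a_subset] by simp
  have "s \<in> M \<longleftrightarrow> ?\<chi> s = \<zero>\<^bsub>K\<^esub>" if s: "s \<in> carrier S" for s
  proof
    assume "s \<in> M"
    then have "M +>\<^bsub>S\<^esub> s = M" by (rule M.a_rcos_const)
    then show "?\<chi> s = \<zero>\<^bsub>K\<^esub>" by (intro eq[OF s]) (simp_all only: zero K.zero_closed)
  next
    assume "?\<chi> s = \<zero>\<^bsub>K\<^esub>"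
    then have "M +>\<^bsub>S\<^esub> s = M" using r(2)[OF s] zero by simp
    then show "s \<in> M" using M.a_rcos_self[OF s] by simp
  qed
  then show "M = {s \<in> carrier S. ?\<chi> s = \<zero>\<^bsub>K\<^esub>}" using M.a_subset by blast
qed

lemma character_kernel_maximal:
  assumes K: "field K" and S: "algebra K S" and \<chi>: "character K S \<chi>"
  shows "maximalideal {s \<in> carrier S. \<chi> s = \<zero>\<^bsub>K\<^esub>} S"
proof -
  interpret K: field K by (rule K)
  interpret S: algebra K S by (rule S)
  note c = characterD[OF \<chi>]
  let ?N = "{s \<in> carrier S. \<chi> s = \<zero>\<^bsub>K\<^esub>}"
  have "\<chi> \<in> ring_hom S K" using \<chi> unfolding character_def by (rule conjunct1)
  then interpret \<chi>: ring_hom_ring S K \<chi> by (rule ring_hom_ringI2[OF S.ring_axioms K.ring_axioms])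
  show ?thesis
  proof (rule maximalidealI)
    show "ideal ?N S" using \<chi>.kernel_is_ideal by (simp only: a_kernel_def')
    show "carrier S \<noteq> ?N"
    proof
      assume "carrier S = ?N"
      then have "\<chi> \<one>\<^bsub>S\<^esub> = \<zero>\<^bsub>K\<^esub>" using S.one_closed by blast
      then show False using c(4) by simp
    qed
    fix J assume J: "ideal J S" "?N \<subseteq> J" "J \<subseteq> carrier S"
    interpret J: ideal J S by (rule J(1))
    show "J = ?N \<or> J = carrier S"
    proof (rule disjCI)
      assume "J \<noteq> carrier S"
      have "\<chi> s = \<zero>\<^bsub>K\<^esub>" if s: "s \<in> J" for s
      proof (rule ccontr)
        assume nz: "\<chi> s \<noteq> \<zero>\<^bsub>K\<^esub>"
        have sS: "s \<in> carrier S" using s J(3) by blast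
        then have u: "\<chi> s \<in> Units K" using nz c(1) K.field_Units by auto
        define e where "e = inv\<^bsub>K\<^esub> (\<chi> s) \<odot>\<^bsub>S\<^esub> s"
        have e: "e \<in> carrier S" "\<chi> e = \<one>\<^bsub>K\<^esub>" using u sS c(5) K.Units_inv_closed by (auto simp: e_def)
        have "e = (inv\<^bsub>K\<^esub> (\<chi> s) \<odot>\<^bsub>S\<^esub> \<one>\<^bsub>S\<^esub>) \<otimes>\<^bsub>S\<^esub> s"
          using u sS by (simp add: e_def S.smult_assoc2)
        then have eJ: "e \<in> J" using u s J.I_l_closed[of s "inv\<^bsub>K\<^esub> (\<chi> s) \<odot>\<^bsub>S\<^esub> \<one>\<^bsub>S\<^esub>"] by simp
        have "\<one>\<^bsub>S\<^esub> \<ominus>\<^bsub>S\<^esub> e \<in> ?N" using e c(4) by (simp add: S.minus_eq K.r_neg)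
        then have "(\<one>\<^bsub>S\<^esub> \<ominus>\<^bsub>S\<^esub> e) \<oplus>\<^bsub>S\<^esub> e \<in> J" using J(2) eJ by blast
        moreover have "(\<one>\<^bsub>S\<^esub> \<ominus>\<^bsub>S\<^esub> e) \<oplus>\<^bsub>S\<^esub> e = \<one>\<^bsub>S\<^esub>"
          using e by (simp add: S.minus_eq S.a_assoc S.l_neg)
        ultimately have "J = carrier S" using J.one_imp_carrier by simp
        then show False using \<open>J \<noteq> carrier S\<close> by simp
      qed
      then show "J = ?N" using J by auto
    qed
  qed
qed

section \<open>Evaluations of a current algebra\<close>

text \<open>A version of \<open>eval_at\<close> in which the point is given by a character. The points obtained by pulling back
  along an automorphism arise in this form.\<close>

definition evaluation ::
    "('k, 'd) ring_scheme \<Rightarrow> ('k, 'g, 'e) lie_alg_scheme \<Rightarrow> ('s \<Rightarrow> 'k) \<Rightarrow> ('g \<times> 's \<Rightarrow> 'k) set \<Rightarrow> 'g" where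
  "evaluation K g \<chi> = induced_map K g (\<lambda>(x, s). \<chi> s \<odot>\<^bsub>g\<^esub> x)"

lemma eval_at_eq: "eval_at K g S M = evaluation K g (residue_at K S M)"
  by (simp add: eval_at_def evaluation_def)

lemma current_algebra_simps [simp]:
  "carrier (current_algebra K g S) = carrier (tensor K g S)"
  "zero (current_algebra K g S) = zero (tensor K g S)"
  "add (current_algebra K g S) = add (tensor K g S)"
  "smult (current_algebra K g S) = smult (tensor K g S)"
  by (simp_all add: current_algebra_def Let_def)

lemma Hom_current_algebra:
  "Hom K (current_algebra K g S) (current_algebra K g S) = Hom K (tensor K g S) (tensor K g S)"
  by (simp add: LinearCombinations.module_hom_def)

locale current =
  fixes K :: "('k, 'd) ring_scheme" and g :: "('k, 'g, 'e) lie_alg_scheme"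
    and S :: "('k, 's, 'f) module_scheme"
  assumes K_closed: "algebraically_closed K"
    and g_simple: "simple_lie_algebra K g" and g_fin_dim: "vectorspace.fin_dim K g"
    and S_algebra: "algebra K S"
begin

sublocale K: algebraically_closed K by (rule K_closed)
sublocale g: lie_algebra K g using g_simple by (simp add: simple_lie_algebra_def)
sublocale S: algebra K S by (rule S_algebra)

lemma g_vs: "vectorspace K g" by (rule g.vectorspace_axioms)
lemma g_module: "Module.module K g" by (rule vs_module[OF g_vs])
lemma S_module: "Module.module K S" by (rule S.module)

sublocale tensor_product K g S
  by (rule tensor_product.intro[OF g_module S_module])

abbreviation C where "C \<equiv> current_algebra K g S"
abbreviation br where "br \<equiv> bracket C"

sublocale T: Module.module K T by (rule T_module)

lemma g_ideal:
  assumes "submod K I g" "\<And>x y. \<lbrakk>x \<in> carrier g; y \<in> I\<rbrakk> \<Longrightarrow> bracket g x y \<in> I"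
  shows "I = {\<zero>\<^bsub>g\<^esub>} \<or> I = carrier g"
  using g_simple assms by (auto simp: simple_lie_algebra_def lie_ideal_def)

lemma bracket_g_Hom_left: "y \<in> carrier g \<Longrightarrow> (\<lambda>x. bracket g x y) \<in> Hom K g g"
  by (intro homI) (auto simp: g.bracket_closed g.bracket_add_left g.bracket_smult_left)

lemma bracket_g_Hom_right: "x \<in> carrier g \<Longrightarrow> bracket g x \<in> Hom K g g"
  by (intro homI) (auto simp: g.bracket_closed g.bracket_add_right g.bracket_smult_right)

lemma bracket_zero_right: "x \<in> carrier g \<Longrightarrow> bracket g x \<zero>\<^bsub>g\<^esub> = \<zero>\<^bsub>g\<^esub>"
  by (rule hom_zero[OF g_module g_module bracket_g_Hom_right])

lemma g_nonabelian: "\<exists>x\<in>carrier g. \<exists>y\<in>carrier g. bracket g x y \<noteq> \<zero>\<^bsub>g\<^esub>"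
  using g_simple by (simp add: simple_lie_algebra_def)

lemma g_nonzero: "carrier g \<noteq> {\<zero>\<^bsub>g\<^esub>}"
  using g_nonabelian g.bracket_closed by blast

lemma mult_S_Hom_left: "t \<in> carrier S \<Longrightarrow> (\<lambda>s. s \<otimes>\<^bsub>S\<^esub> t) \<in> Hom K S S"
  by (intro homI) (auto simp: S.l_distr S.smult_assoc2)

lemma mult_S_Hom_right: "s \<in> carrier S \<Longrightarrow> (\<lambda>t. s \<otimes>\<^bsub>S\<^esub> t) \<in> Hom K S S"
  by (rule hom_cong[OF S_module mult_S_Hom_left]) (auto simp: S.m_comm)

lemma pure_Hom_left: "s \<in> carrier S \<Longrightarrow> (\<lambda>x. pure x s) \<in> Hom K g T"
  using pure_bilinear by (simp add: bilinear_map_def)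

lemma pure_Hom_right: "x \<in> carrier g \<Longrightarrow> pure x \<in> Hom K S T"
  using pure_bilinear by (simp add: bilinear_map_def)

subsection \<open>The bracket\<close>

definition inner_bracket where
  "inner_bracket x r = induced_map K T (\<lambda>(y, s). pure (bracket g x y) (r \<otimes>\<^bsub>S\<^esub> s))"

lemma br_eq: "br z w = induced_map K T (\<lambda>(x, r). inner_bracket x r w) z"
  by (simp add: current_algebra_def Let_def inner_bracket_def)

lemma inner_bracket_bilinear:
  assumes "x \<in> carrier g" "r \<in> carrier S"
  shows "bilinear_map K g S T (\<lambda>y s. pure (bracket g x y) (r \<otimes>\<^bsub>S\<^esub> s))"
  unfolding bilinear_map_def
proof (intro conjI ballI)
  show "(\<lambda>y. pure (bracket g x y) (r \<otimes>\<^bsub>S\<^esub> s)) \<in> Hom K g T" if "s \<in> carrier S" for s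
    by (rule hom_compose[OF pure_Hom_left bracket_g_Hom_right]) (use that assms in auto)
  show "(\<lambda>s. pure (bracket g x y) (r \<otimes>\<^bsub>S\<^esub> s)) \<in> Hom K S T" if "y \<in> carrier g" for y
    by (rule hom_compose[OF pure_Hom_right mult_S_Hom_right]) (use that assms g.bracket_closed in auto)
qed

lemma
  assumes "x \<in> carrier g" "r \<in> carrier S"
  shows inner_bracket_Hom: "inner_bracket x r \<in> Hom K T T"
    and inner_bracket_pure:
      "\<lbrakk>y \<in> carrier g; s \<in> carrier S\<rbrakk> \<Longrightarrow> inner_bracket x r (pure y s) = pure (bracket g x y) (r \<otimes>\<^bsub>S\<^esub> s)"
  unfolding inner_bracket_def
  using tensor_lift_Hom[OF T_module inner_bracket_bilinear[OF assms]]
    tensor_lift_pure[OF T_module inner_bracket_bilinear[OF assms]] by simp_all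

lemma outer_bracket_bilinear:
  assumes "w \<in> carrier T"
  shows "bilinear_map K g S T (\<lambda>x r. inner_bracket x r w)"
  unfolding bilinear_map_def
proof (intro conjI ballI)
  show "(\<lambda>x. inner_bracket x r w) \<in> Hom K g T" if r: "r \<in> carrier S" for r
  proof (rule homI)
    show "inner_bracket x r w \<in> carrier T" if "x \<in> carrier g" for x
      by (rule hom_closed[OF inner_bracket_Hom[OF that r] assms])
    show "inner_bracket (x \<oplus>\<^bsub>g\<^esub> x') r w = inner_bracket x r w \<oplus>\<^bsub>T\<^esub> inner_bracket x' r w"
      if x: "x \<in> carrier g" "x' \<in> carrier g" for x x'
    proof (rule T_hom_eqI[OF T_module inner_bracket_Hom[OF _ r]
          hom_plus[OF T_module inner_bracket_Hom[OF x(1) r] inner_bracket_Hom[OF x(2) r]] _ assms])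
      fix y s assume ys: "y \<in> carrier g" "s \<in> carrier S"
      show "inner_bracket (x \<oplus>\<^bsub>g\<^esub> x') r (pure y s) =
          inner_bracket x r (pure y s) \<oplus>\<^bsub>T\<^esub> inner_bracket x' r (pure y s)"
        using x r ys by (simp add: inner_bracket_pure g.bracket_add_left pure_add_left g.bracket_closed)
    qed (use x in simp)
    show "inner_bracket (a \<odot>\<^bsub>g\<^esub> x) r w = a \<odot>\<^bsub>T\<^esub> inner_bracket x r w"
      if x: "a \<in> carrier K" "x \<in> carrier g" for a x
    proof (rule T_hom_eqI[OF T_module inner_bracket_Hom[OF _ r]
          hom_scale[OF T_module inner_bracket_Hom[OF x(2) r] x(1)] _ assms])
      fix y s assume ys: "y \<in> carrier g" "s \<in> carrier S"
      show "inner_bracket (a \<odot>\<^bsub>g\<^esub> x) r (pure y s) = a \<odot>\<^bsub>T\<^esub> inner_bracket x r (pure y s)"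
        using x r ys by (simp add: inner_bracket_pure g.bracket_smult_left pure_smult_left g.bracket_closed)
    qed (use x in simp)
  qed
  show "(\<lambda>r. inner_bracket x r w) \<in> Hom K S T" if x: "x \<in> carrier g" for x
  proof (rule homI)
    show "inner_bracket x r w \<in> carrier T" if "r \<in> carrier S" for r
      by (rule hom_closed[OF inner_bracket_Hom[OF x that] assms])
    show "inner_bracket x (r \<oplus>\<^bsub>S\<^esub> r') w = inner_bracket x r w \<oplus>\<^bsub>T\<^esub> inner_bracket x r' w"
      if r: "r \<in> carrier S" "r' \<in> carrier S" for r r'
    proof (rule T_hom_eqI[OF T_module inner_bracket_Hom[OF x]
          hom_plus[OF T_module inner_bracket_Hom[OF x r(1)] inner_bracket_Hom[OF x r(2)]] _ assms])
      fix y s assume ys: "y \<in> carrier g" "s \<in> carrier S"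
      show "inner_bracket x (r \<oplus>\<^bsub>S\<^esub> r') (pure y s) =
          inner_bracket x r (pure y s) \<oplus>\<^bsub>T\<^esub> inner_bracket x r' (pure y s)"
        using x r ys by (simp add: inner_bracket_pure S.l_distr pure_add_right g.bracket_closed)
    qed (use r in simp)
    show "inner_bracket x (a \<odot>\<^bsub>S\<^esub> r) w = a \<odot>\<^bsub>T\<^esub> inner_bracket x r w"
      if r: "a \<in> carrier K" "r \<in> carrier S" for a r
    proof (rule T_hom_eqI[OF T_module inner_bracket_Hom[OF x]
          hom_scale[OF T_module inner_bracket_Hom[OF x r(2)] r(1)] _ assms])
      fix y s assume ys: "y \<in> carrier g" "s \<in> carrier S"
      show "inner_bracket x (a \<odot>\<^bsub>S\<^esub> r) (pure y s) = a \<odot>\<^bsub>T\<^esub> inner_bracket x r (pure y s)"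
        using x r ys by (simp add: inner_bracket_pure S.smult_assoc2 pure_smult_right g.bracket_closed)
    qed (use r in simp)
  qed
qed

lemma br_Hom_left: "w \<in> carrier T \<Longrightarrow> (\<lambda>z. br z w) \<in> Hom K T T"
  unfolding br_eq by (rule tensor_lift_Hom[OF T_module outer_bracket_bilinear])

lemma br_pure_left:
  "\<lbrakk>w \<in> carrier T; x \<in> carrier g; r \<in> carrier S\<rbrakk> \<Longrightarrow> br (pure x r) w = inner_bracket x r w"
  unfolding br_eq by (rule tensor_lift_pure[OF T_module outer_bracket_bilinear])

lemma br_pure:
  "\<lbrakk>x \<in> carrier g; r \<in> carrier S; y \<in> carrier g; s \<in> carrier S\<rbrakk>
    \<Longrightarrow> br (pure x r) (pure y s) = pure (bracket g x y) (r \<otimes>\<^bsub>S\<^esub> s)"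
  by (simp add: br_pure_left pure_closed inner_bracket_pure)

subsection \<open>Evaluation at a character\<close>

abbreviation ev where "ev \<equiv> evaluation K g"
abbreviation TI where "TI \<equiv> tensor_ideal K g S"
abbreviation ker where "ker \<chi> \<equiv> {s \<in> carrier S. \<chi> s = \<zero>\<^bsub>K\<^esub>}"

lemma character_Hom: "character K S \<chi> \<Longrightarrow> \<chi> \<in> Hom K S (regular_module K)"
  by (rule homI) (auto simp: characterD)

lemma ev_bilinear:
  assumes "character K S \<chi>"
  shows "bilinear_map K g S g (\<lambda>x s. \<chi> s \<odot>\<^bsub>g\<^esub> x)"
  unfolding bilinear_map_def
  using characterD(1)[OF assms]
  by (auto intro: hom_scale[OF g_module hom_id] hom_rank_one[OF g_module character_Hom[OF assms]])

lemma ev_Hom: "character K S \<chi> \<Longrightarrow> ev \<chi> \<in> Hom K T g"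
  unfolding evaluation_def by (rule tensor_lift_Hom[OF g_module ev_bilinear])

lemma ev_pure:
  "\<lbrakk>character K S \<chi>; x \<in> carrier g; s \<in> carrier S\<rbrakk> \<Longrightarrow> ev \<chi> (pure x s) = \<chi> s \<odot>\<^bsub>g\<^esub> x"
  unfolding evaluation_def by (rule tensor_lift_pure[OF g_module ev_bilinear])

lemma ev_closed: "\<lbrakk>character K S \<chi>; z \<in> carrier T\<rbrakk> \<Longrightarrow> ev \<chi> z \<in> carrier g"
  by (rule hom_closed[OF ev_Hom])

lemma ev_pure_one: "\<lbrakk>character K S \<chi>; x \<in> carrier g\<rbrakk> \<Longrightarrow> ev \<chi> (pure x \<one>\<^bsub>S\<^esub>) = x"
  by (simp add: ev_pure characterD)

lemma ev_br:
  assumes \<chi>: "character K S \<chi>" and z: "z \<in> carrier T" and w: "w \<in> carrier T"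
  shows "ev \<chi> (br z w) = bracket g (ev \<chi> z) (ev \<chi> w)"
proof (rule T_hom_eqI[OF g_module hom_compose[OF ev_Hom[OF \<chi>] br_Hom_left[OF w]]
      hom_compose[OF bracket_g_Hom_left[OF ev_closed[OF \<chi> w]] ev_Hom[OF \<chi>]] _ z])
  fix x r assume xr: "x \<in> carrier g" "r \<in> carrier S"
  note xrK = characterD(1)[OF \<chi> xr(2)]
  have "ev \<chi> (inner_bracket x r w) = bracket g (\<chi> r \<odot>\<^bsub>g\<^esub> x) (ev \<chi> w)"
  proof (rule T_hom_eqI[OF g_module hom_compose[OF ev_Hom[OF \<chi>] inner_bracket_Hom[OF xr]]
        hom_compose[OF bracket_g_Hom_right ev_Hom[OF \<chi>]] _ w])
    show "\<chi> r \<odot>\<^bsub>g\<^esub> x \<in> carrier g" using xr xrK by simp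
    fix y s assume ys: "y \<in> carrier g" "s \<in> carrier S"
    note ysK = characterD(1)[OF \<chi> ys(2)]
    show "ev \<chi> (inner_bracket x r (pure y s)) = bracket g (\<chi> r \<odot>\<^bsub>g\<^esub> x) (ev \<chi> (pure y s))"
      using xr ys xrK ysK
      by (simp add: inner_bracket_pure ev_pure[OF \<chi>] g.bracket_closed characterD(3)[OF \<chi>]
          g.bracket_smult_left g.bracket_smult_right g.smult_assoc1[symmetric] K.m_comm)
  qed
  then show "ev \<chi> (br (pure x r) w) = bracket g (ev \<chi> (pure x r)) (ev \<chi> w)"
    using xr w by (simp add: br_pure_left ev_pure[OF \<chi>])
qed

lemma TI_submod: "N \<subseteq> carrier S \<Longrightarrow> submod K (TI N) T"
  unfolding tensor_ideal_def by (rule span_submod[OF T_module]) (auto intro!: pure_closed)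

lemma pure_in_TI: "\<lbrakk>N \<subseteq> carrier S; x \<in> carrier g; s \<in> N\<rbrakk> \<Longrightarrow> pure x s \<in> TI N"
  unfolding tensor_ideal_def
  by (rule subsetD[OF span_superset[OF T_module]]) (auto intro!: pure_closed)

text \<open>For \<open>z = x \<otimes> s\<close> the difference is \<open>x \<otimes> (s - \<chi> s)\<close>.\<close>

lemma constant_mod_TI:
  assumes \<chi>: "character K S \<chi>" and z: "z \<in> carrier T"
  shows "z \<ominus>\<^bsub>T\<^esub> pure (ev \<chi> z) \<one>\<^bsub>S\<^esub> \<in> TI (ker \<chi>)"
proof -
  have c: "(\<lambda>z. pure (ev \<chi> z) \<one>\<^bsub>S\<^esub>) \<in> Hom K T T"
    by (rule hom_compose[OF pure_Hom_left ev_Hom[OF \<chi>]]) simp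
  have m1: "\<ominus>\<^bsub>K\<^esub> \<one>\<^bsub>K\<^esub> \<in> carrier K" by simp
  let ?d = "\<lambda>z. z \<oplus>\<^bsub>T\<^esub> (\<ominus>\<^bsub>K\<^esub> \<one>\<^bsub>K\<^esub>) \<odot>\<^bsub>T\<^esub> pure (ev \<chi> z) \<one>\<^bsub>S\<^esub>"
  have d: "?d \<in> Hom K T T" by (rule hom_plus[OF T_module hom_id hom_scale[OF T_module c m1]])
  have d_eq: "?d z = z \<ominus>\<^bsub>T\<^esub> pure (ev \<chi> z) \<one>\<^bsub>S\<^esub>" if "z \<in> carrier T" for z
    using hom_closed[OF c that] by (simp add: T.smult_l_minus T.minus_eq)
  have TI: "submod K (TI (ker \<chi>)) T" by (rule TI_submod) auto
  have "{z \<in> carrier T. ?d z \<in> TI (ker \<chi>)} = carrier T"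
  proof (rule T_generated[OF submod_vimage[OF T_module d TI]])
    fix x s assume xs: "x \<in> carrier g" "s \<in> carrier S"
    note sK = characterD(1)[OF \<chi> xs(2)]
    let ?t = "s \<oplus>\<^bsub>S\<^esub> (\<ominus>\<^bsub>K\<^esub> \<chi> s) \<odot>\<^bsub>S\<^esub> \<one>\<^bsub>S\<^esub>"
    have t: "?t \<in> ker \<chi>"
      using xs sK by (simp add: characterD[OF \<chi>] K.r_neg)
    have "?d (pure x s) = pure x s \<oplus>\<^bsub>T\<^esub> (\<ominus>\<^bsub>K\<^esub> \<one>\<^bsub>K\<^esub>) \<odot>\<^bsub>T\<^esub> (\<chi> s \<odot>\<^bsub>T\<^esub> pure x \<one>\<^bsub>S\<^esub>)"
      using xs sK by (simp add: ev_pure[OF \<chi>] pure_smult_left)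
    also have "\<dots> = pure x s \<oplus>\<^bsub>T\<^esub> (\<ominus>\<^bsub>K\<^esub> \<chi> s) \<odot>\<^bsub>T\<^esub> pure x \<one>\<^bsub>S\<^esub>"
      using sK pure_closed[OF xs(1) S.one_closed] by (simp add: T.smult_assoc1[symmetric] K.l_minus)
    also have "\<dots> = pure x ?t"
      using xs sK by (simp add: pure_add_right pure_smult_right)
    also have "\<dots> \<in> TI (ker \<chi>)" using t by (intro pure_in_TI xs) auto
    finally show "pure x s \<in> {z \<in> carrier T. ?d z \<in> TI (ker \<chi>)}" using pure_closed[OF xs] by simp
  qed
  then have "?d z \<in> TI (ker \<chi>)" using z by blast
  then show ?thesis unfolding d_eq[OF z] .
qed

lemma TI_eq_kernel:
  assumes \<chi>: "character K S \<chi>"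
  shows "TI (ker \<chi>) = {z \<in> carrier T. ev \<chi> z = \<zero>\<^bsub>g\<^esub>}"
proof
  show "TI (ker \<chi>) \<subseteq> {z \<in> carrier T. ev \<chi> z = \<zero>\<^bsub>g\<^esub>}"
    unfolding tensor_ideal_def
    by (rule span_least[OF submod_kernel[OF T_module g_module ev_Hom[OF \<chi>]]])
       (auto simp: ev_pure[OF \<chi>] intro!: pure_closed)
  show "{z \<in> carrier T. ev \<chi> z = \<zero>\<^bsub>g\<^esub>} \<subseteq> TI (ker \<chi>)"
  proof clarify
    fix z assume z: "z \<in> carrier T" "ev \<chi> z = \<zero>\<^bsub>g\<^esub>"
    have "pure \<zero>\<^bsub>g\<^esub> \<one>\<^bsub>S\<^esub> = \<zero>\<^bsub>T\<^esub>" using hom_zero[OF g_module T_module pure_Hom_left] by simp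
    then have "z \<ominus>\<^bsub>T\<^esub> pure (ev \<chi> z) \<one>\<^bsub>S\<^esub> = z \<ominus>\<^bsub>T\<^esub> \<zero>\<^bsub>T\<^esub>" using z(2) by simp
    also have "\<dots> = z"
    proof -
      have m0: "\<ominus>\<^bsub>T\<^esub> \<zero>\<^bsub>T\<^esub> = \<zero>\<^bsub>T\<^esub>"
        using T.smult_l_minus[of "\<one>\<^bsub>K\<^esub>" "\<zero>\<^bsub>T\<^esub>"] T.smult_r_null[of "\<one>\<^bsub>K\<^esub>"]
          T.smult_r_null[of "\<ominus>\<^bsub>K\<^esub> \<one>\<^bsub>K\<^esub>"] by simp
      show ?thesis unfolding a_minus_def m0 by (rule T.M.r_zero[OF z(1)])
    qed
    finally show "z \<in> TI (ker \<chi>)" using constant_mod_TI[OF \<chi> z(1)] by simp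
  qed
qed

subsection \<open>Pulling back an evaluation along an automorphism\<close>

text \<open>Let \<open>\<psi>\<close> be an evaluation composed with a surjective Lie endomorphism \<open>\<sigma>\<close>, and put
  \<open>\<psi>\<^sub>s x = \<psi> (x \<otimes> s)\<close>. Then \<open>[\<psi>\<^sub>r x, \<psi>\<^sub>s y] = \<psi>\<^sub>r\<^sub>s [x, y]\<close>, and therefore the kernels of \<open>\<psi>\<^sub>1\<close> and of
  all \<open>\<psi>\<^sub>s - c \<psi>\<^sub>1\<close> are ideals of the simple algebra \<open>g\<close>. If \<open>\<psi>\<^sub>1\<close> were zero, then every \<open>\<psi>\<^sub>s\<close> would kill
  all brackets, hence all of \<open>g\<close>, but \<open>\<psi>\<close> is surjective. So \<open>\<psi>\<^sub>1\<close> is invertible, and for each \<open>s\<close> there is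
  a \<open>c\<close> for which \<open>\<psi>\<^sub>s - c \<psi>\<^sub>1\<close> is not injective and hence zero. This gives
  \<open>\<psi>\<^sub>s = \<chi>' s \<cdot> \<psi>\<^sub>1\<close> with a function \<open>\<chi>'\<close>, which is a character.\<close>

context
  fixes \<chi> \<sigma>
  assumes \<chi>: "character K S \<chi>" and \<sigma>: "\<sigma> \<in> Hom K T T" and \<sigma>_surj: "\<sigma> ` carrier T = carrier T"
    and \<sigma>_br: "\<And>z w. \<lbrakk>z \<in> carrier T; w \<in> carrier T\<rbrakk> \<Longrightarrow> \<sigma> (br z w) = br (\<sigma> z) (\<sigma> w)"
begin

definition pull where "pull s x = ev \<chi> (\<sigma> (pure x s))"

lemma ev_\<sigma>_Hom: "(\<lambda>z. ev \<chi> (\<sigma> z)) \<in> Hom K T g"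
  by (rule hom_compose[OF ev_Hom[OF \<chi>] \<sigma>])

lemma pull_Hom: "s \<in> carrier S \<Longrightarrow> pull s \<in> Hom K g g"
  unfolding pull_def[abs_def] by (rule hom_compose[OF ev_\<sigma>_Hom pure_Hom_left])

lemma pull_Hom_scalar: "x \<in> carrier g \<Longrightarrow> (\<lambda>s. pull s x) \<in> Hom K S g"
  unfolding pull_def[abs_def] by (rule hom_compose[OF ev_\<sigma>_Hom pure_Hom_right])

lemma pull_closed: "\<lbrakk>s \<in> carrier S; x \<in> carrier g\<rbrakk> \<Longrightarrow> pull s x \<in> carrier g"
  by (rule hom_closed[OF pull_Hom])

lemma pull_bracket:
  assumes "x \<in> carrier g" "y \<in> carrier g" "r \<in> carrier S" "s \<in> carrier S"
  shows "pull (r \<otimes>\<^bsub>S\<^esub> s) (bracket g x y) = bracket g (pull r x) (pull s y)"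
proof -
  note p = pure_closed[OF assms(1,3)] pure_closed[OF assms(2,4)]
  have "pull (r \<otimes>\<^bsub>S\<^esub> s) (bracket g x y) = ev \<chi> (\<sigma> (br (pure x r) (pure y s)))"
    unfolding pull_def using br_pure[OF assms(1,3,2,4)] by simp
  also have "\<dots> = ev \<chi> (br (\<sigma> (pure x r)) (\<sigma> (pure y s)))" using \<sigma>_br[OF p] by simp
  also have "\<dots> = bracket g (pull r x) (pull s y)"
    unfolding pull_def by (rule ev_br[OF \<chi> hom_closed[OF \<sigma> p(1)] hom_closed[OF \<sigma> p(2)]])
  finally show ?thesis .
qed

lemma pull_bracket_right:
  "\<lbrakk>x \<in> carrier g; y \<in> carrier g; s \<in> carrier S\<rbrakk>
    \<Longrightarrow> pull s (bracket g x y) = bracket g (pull \<one>\<^bsub>S\<^esub> x) (pull s y)"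
  using pull_bracket[of x y "\<one>\<^bsub>S\<^esub>" s] by simp

lemma pull_bracket_left:
  "\<lbrakk>x \<in> carrier g; y \<in> carrier g; s \<in> carrier S\<rbrakk>
    \<Longrightarrow> pull s (bracket g x y) = bracket g (pull s x) (pull \<one>\<^bsub>S\<^esub> y)"
  using pull_bracket[of x y s "\<one>\<^bsub>S\<^esub>"] by simp

lemma pull_one_not_zero:
  assumes "{x \<in> carrier g. pull \<one>\<^bsub>S\<^esub> x = \<zero>\<^bsub>g\<^esub>} = carrier g"
  shows False
proof -
  have zero: "pull s x = \<zero>\<^bsub>g\<^esub>" if s: "s \<in> carrier S" and x: "x \<in> carrier g" for s x
  proof -
    let ?I = "{x \<in> carrier g. pull s x = \<zero>\<^bsub>g\<^esub>}"
    have br: "bracket g x y \<in> ?I" if "x \<in> carrier g" "y \<in> carrier g" for x y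
    proof -
      have "pull \<one>\<^bsub>S\<^esub> y = \<zero>\<^bsub>g\<^esub>" using assms that by blast
      then show ?thesis
        using that s by (simp add: pull_bracket_left pull_closed bracket_zero_right g.bracket_closed)
    qed
    have "?I = {\<zero>\<^bsub>g\<^esub>} \<or> ?I = carrier g"
      by (rule g_ideal[OF submod_kernel[OF g_module g_module pull_Hom[OF s]]]) (use br in blast)
    moreover have "?I \<noteq> {\<zero>\<^bsub>g\<^esub>}" using g_nonabelian br by blast
    ultimately show ?thesis using x by blast
  qed
  have "ev \<chi> (\<sigma> z) = \<zero>\<^bsub>g\<^esub>" if "z \<in> carrier T" for z
    by (rule T_hom_eqI[OF g_module ev_\<sigma>_Hom hom_zero_map[OF g_module] _ that])
       (use zero in \<open>simp add: pull_def\<close>)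
  then have z: "ev \<chi> z = \<zero>\<^bsub>g\<^esub>" if "z \<in> carrier T" for z
    using that \<sigma>_surj by (metis imageE)
  have "x = \<zero>\<^bsub>g\<^esub>" if "x \<in> carrier g" for x
    using z[OF pure_closed[OF that S.one_closed]] ev_pure_one[OF \<chi> that] by simp
  then show False using g_nonzero g.M.zero_closed by blast
qed

lemma pull_one_inj: "inj_on (pull \<one>\<^bsub>S\<^esub>) (carrier g)"
proof -
  let ?I = "{x \<in> carrier g. pull \<one>\<^bsub>S\<^esub> x = \<zero>\<^bsub>g\<^esub>}"
  have h: "pull \<one>\<^bsub>S\<^esub> \<in> Hom K g g" by (rule pull_Hom) simp
  have "?I = {\<zero>\<^bsub>g\<^esub>} \<or> ?I = carrier g"
  proof (rule g_ideal[OF submod_kernel[OF g_module g_module h]])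
    fix x y assume "x \<in> carrier g" "y \<in> ?I"
    then show "bracket g x y \<in> ?I"
      by (auto simp: pull_bracket_right pull_closed bracket_zero_right g.bracket_closed)
  qed
  then have I: "?I = {\<zero>\<^bsub>g\<^esub>}" using pull_one_not_zero by blast
  show ?thesis
  proof (rule inj_onI)
    fix x y assume xy: "x \<in> carrier g" "y \<in> carrier g" "pull \<one>\<^bsub>S\<^esub> x = pull \<one>\<^bsub>S\<^esub> y"
    have "x \<ominus>\<^bsub>g\<^esub> y \<in> ?I"
      using xy by (simp add: hom_minus[OF g_module g_module h] pull_closed)
    then show "x = y" using I xy by simp
  qed
qed

lemma pull_scalar:
  assumes s: "s \<in> carrier S"
  shows "\<exists>c\<in>carrier K. \<forall>x\<in>carrier g. pull s x = c \<odot>\<^bsub>g\<^esub> pull \<one>\<^bsub>S\<^esub> x"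
proof -
  have h: "pull \<one>\<^bsub>S\<^esub> \<in> Hom K g g" by (rule pull_Hom) simp
  obtain c v where cv: "c \<in> carrier K" "v \<in> carrier g" "v \<noteq> \<zero>\<^bsub>g\<^esub>" "pull s v = c \<odot>\<^bsub>g\<^esub> pull \<one>\<^bsub>S\<^esub> v"
    using generalized_eigenvector_exists[OF K_closed g_vs g_fin_dim g_nonzero pull_Hom[OF s] h pull_one_inj] by blast
  let ?I = "{x \<in> carrier g. pull s x = c \<odot>\<^bsub>g\<^esub> pull \<one>\<^bsub>S\<^esub> x}"
  have "?I = {\<zero>\<^bsub>g\<^esub>} \<or> ?I = carrier g"
  proof (rule g_ideal[OF submod_equalizer[OF g_module g_module pull_Hom[OF s] hom_scale[OF g_module h cv(1)]]])
    fix x y assume "x \<in> carrier g" "y \<in> ?I"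
    then show "bracket g x y \<in> ?I"
      using s cv(1) by (auto simp: pull_bracket_right pull_closed g.bracket_closed g.bracket_smult_right)
  qed
  then have "?I = carrier g" using cv by blast
  then show ?thesis using cv(1) by blast
qed

definition pulled_character where
  "pulled_character s = (SOME c. c \<in> carrier K \<and> (\<forall>x\<in>carrier g. pull s x = c \<odot>\<^bsub>g\<^esub> pull \<one>\<^bsub>S\<^esub> x))"

lemma
  assumes "s \<in> carrier S"
  shows pulled_character_closed: "pulled_character s \<in> carrier K"
    and pull_eq: "x \<in> carrier g \<Longrightarrow> pull s x = pulled_character s \<odot>\<^bsub>g\<^esub> pull \<one>\<^bsub>S\<^esub> x"
proof -
  have "pulled_character s \<in> carrier K \<and> (\<forall>x\<in>carrier g. pull s x = pulled_character s \<odot>\<^bsub>g\<^esub> pull \<one>\<^bsub>S\<^esub> x)"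
    unfolding pulled_character_def
    by (rule someI_ex) (use pull_scalar[OF assms] in blast)
  then show "pulled_character s \<in> carrier K"
    "x \<in> carrier g \<Longrightarrow> pull s x = pulled_character s \<odot>\<^bsub>g\<^esub> pull \<one>\<^bsub>S\<^esub> x" by blast+
qed

lemma smult_cancel:
  assumes "a \<in> carrier K" "b \<in> carrier K" "x \<in> carrier g" "x \<noteq> \<zero>\<^bsub>g\<^esub>" "a \<odot>\<^bsub>g\<^esub> pull \<one>\<^bsub>S\<^esub> x = b \<odot>\<^bsub>g\<^esub> pull \<one>\<^bsub>S\<^esub> x"
  shows "a = b"
proof (rule ccontr)
  assume "a \<noteq> b"
  let ?p = "pull \<one>\<^bsub>S\<^esub> x" and ?d = "a \<ominus>\<^bsub>K\<^esub> b"
  have p: "?p \<in> carrier g" using assms by (simp add: pull_closed)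
  have d: "?d \<in> carrier K" "?d \<noteq> \<zero>\<^bsub>K\<^esub>" using assms \<open>a \<noteq> b\<close> by auto
  have "?d \<odot>\<^bsub>g\<^esub> ?p = \<zero>\<^bsub>g\<^esub>"
    using assms p by (simp add: K.minus_eq g.smult_l_distr g.smult_l_minus g.M.r_neg)
  then have "?p = inv\<^bsub>K\<^esub> ?d \<odot>\<^bsub>g\<^esub> \<zero>\<^bsub>g\<^esub>" by (rule g.mult_inverse[OF d(1) p _ d(2)])
  also have "\<dots> = \<zero>\<^bsub>g\<^esub>" using d K.field_Units by (intro g.smult_r_null K.Units_inv_closed) auto
  also have "\<dots> = pull \<one>\<^bsub>S\<^esub> \<zero>\<^bsub>g\<^esub>" by (rule hom_zero[OF g_module g_module pull_Hom, symmetric]) simp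
  finally have "x = \<zero>\<^bsub>g\<^esub>" using inj_onD[OF pull_one_inj _ assms(3)] by simp
  then show False using assms(4) by simp
qed

lemma pulled_character: "character K S pulled_character"
proof -
  obtain x y where xy: "x \<in> carrier g" "y \<in> carrier g" "bracket g x y \<noteq> \<zero>\<^bsub>g\<^esub>" using g_nonabelian by blast
  let ?e = "bracket g x y"
  have e: "?e \<in> carrier g" using xy by (simp add: g.bracket_closed)
  note cl = pulled_character_closed
  note cancel = smult_cancel[OF _ _ e xy(3)]
  have p1: "pull \<one>\<^bsub>S\<^esub> ?e \<in> carrier g" "pull \<one>\<^bsub>S\<^esub> x \<in> carrier g" "pull \<one>\<^bsub>S\<^esub> y \<in> carrier g"
    using e xy by (simp_all add: pull_closed)
  show ?thesis
    unfolding character_def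
  proof (intro conjI ballI ring_hom_memI)
    show "pulled_character s \<in> carrier K" if "s \<in> carrier S" for s by (rule cl[OF that])
    show "pulled_character (s \<otimes>\<^bsub>S\<^esub> t) = pulled_character s \<otimes>\<^bsub>K\<^esub> pulled_character t"
      if s: "s \<in> carrier S" and t: "t \<in> carrier S" for s t
    proof (rule cancel)
      have "pulled_character (s \<otimes>\<^bsub>S\<^esub> t) \<odot>\<^bsub>g\<^esub> pull \<one>\<^bsub>S\<^esub> ?e = pull (s \<otimes>\<^bsub>S\<^esub> t) ?e"
        using pull_eq[OF _ e, of "s \<otimes>\<^bsub>S\<^esub> t"] s t by simp
      also have "\<dots> = bracket g (pulled_character s \<odot>\<^bsub>g\<^esub> pull \<one>\<^bsub>S\<^esub> x) (pulled_character t \<odot>\<^bsub>g\<^esub> pull \<one>\<^bsub>S\<^esub> y)"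
        using pull_bracket[OF xy(1,2) s t] pull_eq[OF s xy(1)] pull_eq[OF t xy(2)] by simp
      also have "\<dots> = (pulled_character s \<otimes>\<^bsub>K\<^esub> pulled_character t) \<odot>\<^bsub>g\<^esub> bracket g (pull \<one>\<^bsub>S\<^esub> x) (pull \<one>\<^bsub>S\<^esub> y)"
        using cl[OF s] cl[OF t] p1
        by (simp add: g.bracket_smult_left g.bracket_smult_right g.smult_assoc1[symmetric] g.bracket_closed K.m_comm)
      also have "bracket g (pull \<one>\<^bsub>S\<^esub> x) (pull \<one>\<^bsub>S\<^esub> y) = pull \<one>\<^bsub>S\<^esub> ?e"
        using pull_bracket_left[OF xy(1,2) S.one_closed] by simp
      finally show "pulled_character (s \<otimes>\<^bsub>S\<^esub> t) \<odot>\<^bsub>g\<^esub> pull \<one>\<^bsub>S\<^esub> ?e =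
          (pulled_character s \<otimes>\<^bsub>K\<^esub> pulled_character t) \<odot>\<^bsub>g\<^esub> pull \<one>\<^bsub>S\<^esub> ?e" .
    qed (use s t cl in auto)
    show "pulled_character (s \<oplus>\<^bsub>S\<^esub> t) = pulled_character s \<oplus>\<^bsub>K\<^esub> pulled_character t"
      if s: "s \<in> carrier S" and t: "t \<in> carrier S" for s t
    proof (rule cancel)
      show "pulled_character (s \<oplus>\<^bsub>S\<^esub> t) \<odot>\<^bsub>g\<^esub> pull \<one>\<^bsub>S\<^esub> ?e =
          (pulled_character s \<oplus>\<^bsub>K\<^esub> pulled_character t) \<odot>\<^bsub>g\<^esub> pull \<one>\<^bsub>S\<^esub> ?e"
        using hom_add[OF pull_Hom_scalar[OF e] s t] pull_eq[OF s e] pull_eq[OF t e]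
          pull_eq[OF _ e, of "s \<oplus>\<^bsub>S\<^esub> t"] s t cl p1
        by (simp add: g.smult_l_distr)
    qed (use s t cl in auto)
    show "pulled_character \<one>\<^bsub>S\<^esub> = \<one>\<^bsub>K\<^esub>"
    proof (rule cancel)
      show "pulled_character \<one>\<^bsub>S\<^esub> \<odot>\<^bsub>g\<^esub> pull \<one>\<^bsub>S\<^esub> ?e = \<one>\<^bsub>K\<^esub> \<odot>\<^bsub>g\<^esub> pull \<one>\<^bsub>S\<^esub> ?e"
        using pull_eq[OF S.one_closed e] p1 by simp
    qed (use cl in auto)
    show "pulled_character (a \<odot>\<^bsub>S\<^esub> s) = a \<otimes>\<^bsub>K\<^esub> pulled_character s"
      if a: "a \<in> carrier K" and s: "s \<in> carrier S" for a s
    proof (rule cancel)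
      have "pulled_character (a \<odot>\<^bsub>S\<^esub> s) \<odot>\<^bsub>g\<^esub> pull \<one>\<^bsub>S\<^esub> ?e = pull (a \<odot>\<^bsub>S\<^esub> s) ?e"
        using pull_eq[OF _ e, of "a \<odot>\<^bsub>S\<^esub> s"] a s by simp
      also have "\<dots> = a \<odot>\<^bsub>g\<^esub> (pulled_character s \<odot>\<^bsub>g\<^esub> pull \<one>\<^bsub>S\<^esub> ?e)"
        using hom_smult[OF pull_Hom_scalar[OF e] a s] pull_eq[OF s e] by simp
      also have "\<dots> = (a \<otimes>\<^bsub>K\<^esub> pulled_character s) \<odot>\<^bsub>g\<^esub> pull \<one>\<^bsub>S\<^esub> ?e"
        using a cl[OF s] p1 by (simp add: g.smult_assoc1)
      finally show "pulled_character (a \<odot>\<^bsub>S\<^esub> s) \<odot>\<^bsub>g\<^esub> pull \<one>\<^bsub>S\<^esub> ?e =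
          (a \<otimes>\<^bsub>K\<^esub> pulled_character s) \<odot>\<^bsub>g\<^esub> pull \<one>\<^bsub>S\<^esub> ?e" .
    qed (use a s cl in auto)
  qed
qed

text \<open>The composite of the evaluation at \<open>\<chi>\<close> with \<open>\<sigma>\<close> is the evaluation at the pulled-back character, followed
  by the injective map \<open>pull 1\<close>.\<close>

lemma pullback_of_kernel:
  assumes z: "z \<in> carrier T"
  shows "\<sigma> z \<in> TI (ker \<chi>) \<longleftrightarrow> z \<in> TI (ker pulled_character)"
proof -
  note p = pulled_character
  have h: "pull \<one>\<^bsub>S\<^esub> \<in> Hom K g g" by (rule pull_Hom) simp
  have "ev \<chi> (\<sigma> z) = pull \<one>\<^bsub>S\<^esub> (ev pulled_character z)"
  proof (rule T_hom_eqI[OF g_module ev_\<sigma>_Hom hom_compose[OF h ev_Hom[OF p]] _ z])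
    fix x s assume xs: "x \<in> carrier g" "s \<in> carrier S"
    show "ev \<chi> (\<sigma> (pure x s)) = pull \<one>\<^bsub>S\<^esub> (ev pulled_character (pure x s))"
      using pull_eq[OF xs(2,1)] xs pulled_character_closed[OF xs(2)]
      by (simp add: ev_pure[OF p] hom_smult[OF h] pull_def[symmetric])
  qed
  moreover have "pull \<one>\<^bsub>S\<^esub> v = \<zero>\<^bsub>g\<^esub> \<longleftrightarrow> v = \<zero>\<^bsub>g\<^esub>" if "v \<in> carrier g" for v
    using hom_zero[OF g_module g_module h] inj_onD[OF pull_one_inj _ that, of "\<zero>\<^bsub>g\<^esub>"] by auto
  ultimately show ?thesis
    using z hom_closed[OF \<sigma> z] ev_closed[OF p z] by (simp add: TI_eq_kernel[OF \<chi>] TI_eq_kernel[OF p])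
qed

end

end

section \<open>Equivariant current algebras\<close>

locale equivariant = current K g S
  for K :: "('k, 'd) ring_scheme" and g :: "('k, 'g) lie_alg" and S :: "('k, 's, 'f) module_scheme" +
  fixes \<Gamma> :: "('c, 'h) monoid_scheme" and act
  assumes S_finite_type: "finite_type_algebra K S"
    and \<Gamma>_group: "group \<Gamma>" and \<Gamma>_finite: "finite (carrier \<Gamma>)"
    and action: "group_action \<Gamma> (carrier (current_algebra K g S)) act"
    and act_lie_hom:
      "\<gamma> \<in> carrier \<Gamma> \<Longrightarrow> act \<gamma> \<in> lie_hom K (current_algebra K g S) (current_algebra K g S)"
begin

sublocale \<Gamma>: group \<Gamma> by (rule \<Gamma>_group)
sublocale action: group_action \<Gamma> "carrier T" act using action by simp

lemma act_Hom: "\<gamma> \<in> carrier \<Gamma> \<Longrightarrow> act \<gamma> \<in> Hom K T T"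
  using act_lie_hom by (simp add: lie_hom_def Hom_current_algebra)

lemma act_closed: "\<lbrakk>\<gamma> \<in> carrier \<Gamma>; z \<in> carrier T\<rbrakk> \<Longrightarrow> act \<gamma> z \<in> carrier T"
  by (rule hom_closed[OF act_Hom])

lemma act_br:
  "\<lbrakk>\<gamma> \<in> carrier \<Gamma>; z \<in> carrier T; w \<in> carrier T\<rbrakk> \<Longrightarrow> act \<gamma> (br z w) = br (act \<gamma> z) (act \<gamma> w)"
  using act_lie_hom by (simp add: lie_hom_def)

lemma act_mult:
  "\<lbrakk>\<gamma> \<in> carrier \<Gamma>; \<delta> \<in> carrier \<Gamma>; z \<in> carrier T\<rbrakk> \<Longrightarrow> act (\<gamma> \<otimes>\<^bsub>\<Gamma>\<^esub> \<delta>) z = act \<gamma> (act \<delta> z)"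
  by (rule action.composition_rule)

lemma act_inv:
  assumes "\<gamma> \<in> carrier \<Gamma>" "z \<in> carrier T"
  shows "act \<gamma> (act (inv\<^bsub>\<Gamma>\<^esub> \<gamma>) z) = z" "act (inv\<^bsub>\<Gamma>\<^esub> \<gamma>) (act \<gamma> z) = z"
proof -
  have one: "act \<one>\<^bsub>\<Gamma>\<^esub> z = z" using action.id_eq_one assms(2) by (metis restrict_apply')
  show "act \<gamma> (act (inv\<^bsub>\<Gamma>\<^esub> \<gamma>) z) = z" "act (inv\<^bsub>\<Gamma>\<^esub> \<gamma>) (act \<gamma> z) = z"
    using assms one by (simp_all add: act_mult[symmetric])
qed

abbreviation res where "res M \<equiv> residue_at K S M"

lemma res_character: "maximalideal M S \<Longrightarrow> character K S (res M)"
  and res_ker: "maximalideal M S \<Longrightarrow> ker (res M) = M"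
  using residue_at_character[OF K_closed S_algebra S_finite_type] by blast+

lemma eval_at_TI:
  assumes "maximalideal M S" "z \<in> carrier T"
  shows "eval_at K g S M z = \<zero>\<^bsub>g\<^esub> \<longleftrightarrow> z \<in> TI M"
  using TI_eq_kernel[OF res_character[OF assms(1)]] assms(2) unfolding eval_at_eq res_ker[OF assms(1)] by blast

lemma eval_at_Hom: "maximalideal M S \<Longrightarrow> eval_at K g S M \<in> Hom K T g"
  unfolding eval_at_eq by (intro ev_Hom res_character)

lemma maximal_subset: "maximalideal M S \<Longrightarrow> M \<subseteq> carrier S"
  using res_ker by blast

text \<open>For a fixed nonzero \<open>x\<close>, membership of \<open>x \<otimes> s\<close> in \<open>g \<otimes> M\<close> decides whether \<open>s\<close> is in \<open>M\<close>.\<close>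

lemma TI_inj:
  assumes M: "maximalideal M S" and N: "maximalideal N S" and eq: "TI M = TI N"
  shows "M = N"
proof -
  obtain x where x: "x \<in> carrier g" "x \<noteq> \<zero>\<^bsub>g\<^esub>" using g_nonzero g.M.zero_closed by blast
  have mem: "s \<in> M \<longleftrightarrow> pure x s \<in> TI M" if M: "maximalideal M S" and s: "s \<in> carrier S" for M s
  proof
    show "pure x s \<in> TI M" if "s \<in> M" by (rule pure_in_TI[OF maximal_subset[OF M] x(1) that])
    assume "pure x s \<in> TI M"
    then have z: "res M s \<odot>\<^bsub>g\<^esub> x = \<zero>\<^bsub>g\<^esub>"
      using eval_at_TI[OF M pure_closed[OF x(1) s]] ev_pure[OF res_character[OF M] x(1) s]
      unfolding eval_at_eq by simp
    have rK: "res M s \<in> carrier K" by (rule characterD(1)[OF res_character[OF M] s])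
    have "res M s = \<zero>\<^bsub>K\<^esub>"
    proof (rule ccontr)
      assume nz: "res M s \<noteq> \<zero>\<^bsub>K\<^esub>"
      have "x = inv\<^bsub>K\<^esub> (res M s) \<odot>\<^bsub>g\<^esub> \<zero>\<^bsub>g\<^esub>" by (rule g.mult_inverse[OF rK x(1) z nz])
      also have "\<dots> = \<zero>\<^bsub>g\<^esub>" using nz rK K.field_Units by (intro g.smult_r_null K.Units_inv_closed) auto
      finally show False using x(2) by simp
    qed
    then show "s \<in> M" using res_ker[OF M] s by blast
  qed
  show ?thesis using mem[OF M] mem[OF N] eq maximal_subset[OF M] maximal_subset[OF N] by blast
qed

subsection \<open>The action on maximal ideals\<close>

abbreviation mact where "mact \<equiv> max_action K g S act"

lemma mact_eqI:
  assumes "maximalideal N S" "act \<gamma> ` TI M = TI N"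
  shows "mact \<gamma> M = N"
  unfolding max_action_def by (rule the_equality) (use assms TI_inj in auto)

text \<open>The ideal \<open>\<gamma> M\<close> is the kernel of the character at \<open>M\<close> pulled back along the inverse of \<open>\<gamma>\<close>.\<close>

lemma
  assumes \<gamma>: "\<gamma> \<in> carrier \<Gamma>" and M: "maximalideal M S"
  shows mact_maximal: "maximalideal (mact \<gamma> M) S"
    and mact_TI: "act \<gamma> ` TI M = TI (mact \<gamma> M)"
proof -
  let ?\<delta> = "inv\<^bsub>\<Gamma>\<^esub> \<gamma>"
  have \<delta>: "?\<delta> \<in> carrier \<Gamma>" using \<gamma> by simp
  have surj: "act ?\<delta> ` carrier T = carrier T" using action.surj_prop[OF \<delta>] .
  note * = res_character[OF M] act_Hom[OF \<delta>] surj act_br[OF \<delta>]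
  define N where "N = ker (pulled_character (res M) (act ?\<delta>))"
  have N: "maximalideal N S"
    unfolding N_def by (rule character_kernel_maximal[OF K.field_axioms S_algebra pulled_character[OF *]])
  have eq: "act ?\<delta> z \<in> TI M \<longleftrightarrow> z \<in> TI N" if "z \<in> carrier T" for z
    using pullback_of_kernel[OF * that] unfolding N_def res_ker[OF M] .
  note cM = submod_carrier[OF TI_submod[OF maximal_subset[OF M]]]
  note cN = submod_carrier[OF TI_submod[OF maximal_subset[OF N]]]
  have img: "act \<gamma> ` TI M = TI N"
  proof (intro equalityI subsetI)
    fix z assume "z \<in> act \<gamma> ` TI M"
    then obtain y where y: "y \<in> TI M" "z = act \<gamma> y" by blast
    then show "z \<in> TI N" using eq[OF act_closed[OF \<gamma> cM[OF y(1)]]] act_inv(2)[OF \<gamma> cM[OF y(1)]] by simp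
  next
    fix z assume z: "z \<in> TI N"
    then have "act ?\<delta> z \<in> TI M" using eq cN by blast
    then show "z \<in> act \<gamma> ` TI M" using act_inv(1)[OF \<gamma> cN[OF z]] by (metis imageI)
  qed
  from mact_eqI[OF N img] N img show "maximalideal (mact \<gamma> M) S" "act \<gamma> ` TI M = TI (mact \<gamma> M)" by simp_all
qed

lemma act_TI: "\<lbrakk>\<gamma> \<in> carrier \<Gamma>; maximalideal M S; z \<in> TI M\<rbrakk> \<Longrightarrow> act \<gamma> z \<in> TI (mact \<gamma> M)"
  using mact_TI by blast

lemma mact_mult:
  assumes "\<gamma> \<in> carrier \<Gamma>" "\<delta> \<in> carrier \<Gamma>" "maximalideal M S"
  shows "mact (\<gamma> \<otimes>\<^bsub>\<Gamma>\<^esub> \<delta>) M = mact \<gamma> (mact \<delta> M)"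
proof (rule mact_eqI)
  note N = mact_maximal[OF assms(2,3)]
  show "maximalideal (mact \<gamma> (mact \<delta> M)) S" by (rule mact_maximal[OF assms(1) N])
  have "act (\<gamma> \<otimes>\<^bsub>\<Gamma>\<^esub> \<delta>) ` TI M = act \<gamma> ` act \<delta> ` TI M"
    unfolding image_image
    using act_mult[OF assms(1,2)] submod_carrier[OF TI_submod[OF maximal_subset[OF assms(3)]]]
    by (intro image_cong) auto
  then show "act (\<gamma> \<otimes>\<^bsub>\<Gamma>\<^esub> \<delta>) ` TI M = TI (mact \<gamma> (mact \<delta> M))"
    using mact_TI[OF assms(2,3)] mact_TI[OF assms(1) N] by simp
qed

lemma mact_one: "maximalideal M S \<Longrightarrow> mact \<one>\<^bsub>\<Gamma>\<^esub> M = M"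
proof (rule mact_eqI)
  assume M: "maximalideal M S"
  have "act \<one>\<^bsub>\<Gamma>\<^esub> z = z" if "z \<in> TI M" for z
    using action.id_eq_one submod_carrier[OF TI_submod[OF maximal_subset[OF M]] that] by (metis restrict_apply')
  then show "act \<one>\<^bsub>\<Gamma>\<^esub> ` TI M = TI M" by simp
qed

lemma mact_inv:
  assumes "\<gamma> \<in> carrier \<Gamma>" "maximalideal M S"
  shows "mact \<gamma> (mact (inv\<^bsub>\<Gamma>\<^esub> \<gamma>) M) = M" "mact (inv\<^bsub>\<Gamma>\<^esub> \<gamma>) (mact \<gamma> M) = M"
  using assms mact_one[OF assms(2)] by (simp_all add: mact_mult[symmetric])

lemma orbit_mact:
  assumes "\<gamma> \<in> carrier \<Gamma>" "maximalideal M S"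
  shows "orbit \<Gamma> mact (mact \<gamma> M) = orbit \<Gamma> mact M"
proof (intro equalityI subsetI)
  fix N assume "N \<in> orbit \<Gamma> mact (mact \<gamma> M)"
  then obtain \<delta> where "\<delta> \<in> carrier \<Gamma>" "N = mact \<delta> (mact \<gamma> M)" by (auto simp: orbit_def)
  then show "N \<in> orbit \<Gamma> mact M"
    using assms mact_mult[of \<delta> \<gamma> M] by (auto simp: orbit_def intro!: exI[of _ "\<delta> \<otimes>\<^bsub>\<Gamma>\<^esub> \<gamma>"])
next
  fix N assume "N \<in> orbit \<Gamma> mact M"
  then obtain \<delta> where d: "\<delta> \<in> carrier \<Gamma>" "N = mact \<delta> M" by (auto simp: orbit_def)
  then have "N = mact \<delta> (mact (inv\<^bsub>\<Gamma>\<^esub> \<gamma>) (mact \<gamma> M))" using mact_inv(2)[OF assms] by simp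
  also have "\<dots> = mact (\<delta> \<otimes>\<^bsub>\<Gamma>\<^esub> inv\<^bsub>\<Gamma>\<^esub> \<gamma>) (mact \<gamma> M)"
    using mact_mult[OF d(1) _ mact_maximal[OF assms], of "inv\<^bsub>\<Gamma>\<^esub> \<gamma>"] assms(1) by simp
  finally show "N \<in> orbit \<Gamma> mact (mact \<gamma> M)" using d(1) assms(1) by (auto simp: orbit_def)
qed

lemma eval_at_cong:
  assumes M: "maximalideal M S" and z: "z \<in> carrier T" and w: "w \<in> carrier T" and "z \<ominus>\<^bsub>T\<^esub> w \<in> TI M"
  shows "eval_at K g S M z = eval_at K g S M w"
proof -
  note e = eval_at_Hom[OF M]
  have "eval_at K g S M (z \<ominus>\<^bsub>T\<^esub> w) = \<zero>\<^bsub>g\<^esub>"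
    using eval_at_TI[OF M] assms(4) z w by simp
  then have "eval_at K g S M z \<ominus>\<^bsub>g\<^esub> eval_at K g S M w = \<zero>\<^bsub>g\<^esub>"
    using hom_minus[OF T_module g_module e z w] by simp
  then show ?thesis using hom_closed[OF e z] hom_closed[OF e w] by simp
qed

text \<open>Modulo \<open>g \<otimes> M\<close>, which \<open>\<gamma>\<close> preserves, \<open>z\<close> is congruent to the constant element with the same value
  at \<open>M\<close>.\<close>

lemma eval_at_act:
  assumes M: "maximalideal M S" and \<gamma>: "\<gamma> \<in> carrier \<Gamma>" "mact \<gamma> M = M" and z: "z \<in> carrier T"
  shows "eval_at K g S M (act \<gamma> z) = twist_at K g S act \<gamma> M (eval_at K g S M z)"
proof -
  let ?c = "pure (eval_at K g S M z) \<one>\<^bsub>S\<^esub>"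
  have c: "?c \<in> carrier T" by (intro pure_closed hom_closed[OF eval_at_Hom[OF M] z]) simp
  have "z \<ominus>\<^bsub>T\<^esub> ?c \<in> TI M"
    using constant_mod_TI[OF res_character[OF M] z] unfolding eval_at_eq res_ker[OF M] .
  then have "act \<gamma> (z \<ominus>\<^bsub>T\<^esub> ?c) \<in> TI M" using act_TI[OF \<gamma>(1) M] \<gamma>(2) by metis
  then have "act \<gamma> z \<ominus>\<^bsub>T\<^esub> act \<gamma> ?c \<in> TI M"
    using hom_minus[OF T_module T_module act_Hom[OF \<gamma>(1)] z c] by simp
  then show ?thesis
    unfolding twist_at_def by (rule eval_at_cong[OF M act_closed[OF \<gamma>(1) z] act_closed[OF \<gamma>(1) c]])
qed

end

lemma (in Module.module) finsum_if_const:
  assumes "finite A" "v \<in> carrier M"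
  shows "(\<Oplus>\<^bsub>M\<^esub>i\<in>A. if Q i then v else \<zero>\<^bsub>M\<^esub>) = ([card {i \<in> A. Q i}] \<cdot>\<^bsub>R\<^esub> \<one>\<^bsub>R\<^esub>) \<odot>\<^bsub>M\<^esub> v"
  using assms(1)
proof (induction A rule: finite_induct)
  case empty
  then show ?case using assms(2) by simp
next
  case (insert x A)
  have n: "[n] \<cdot>\<^bsub>R\<^esub> \<one>\<^bsub>R\<^esub> \<in> carrier R" for n :: nat by simp
  have "(\<Oplus>\<^bsub>M\<^esub>i\<in>insert x A. if Q i then v else \<zero>\<^bsub>M\<^esub>)
      = (if Q x then v else \<zero>\<^bsub>M\<^esub>) \<oplus>\<^bsub>M\<^esub> ([card {i \<in> A. Q i}] \<cdot>\<^bsub>R\<^esub> \<one>\<^bsub>R\<^esub>) \<odot>\<^bsub>M\<^esub> v"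
    using insert assms(2) by (subst M.finsum_insert) auto
  also have "\<dots> = ([card {i \<in> insert x A. Q i}] \<cdot>\<^bsub>R\<^esub> \<one>\<^bsub>R\<^esub>) \<odot>\<^bsub>M\<^esub> v"
  proof (cases "Q x")
    case True
    have "{i \<in> insert x A. Q i} = insert x {i \<in> A. Q i}" using True by auto
    then have "card {i \<in> insert x A. Q i} = Suc (card {i \<in> A. Q i})"
      using insert by (simp add: card_insert_disjoint)
    then show ?thesis
      using True assms(2) n by (simp add: smult_l_distr M.a_comm)
  next
    case False
    then have "{i \<in> insert x A. Q i} = {i \<in> A. Q i}" by auto
    then show ?thesis using False assms(2) n by simp
  qed
  finally show ?case .
qed

context equivariant
begin

subsection \<open>Interpolation by invariant elements\<close>

abbreviation L where "L \<equiv> equivariant_algebra K g S \<Gamma> act"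
abbreviation fixed where "fixed M \<equiv> fixed_algebra_at K g S \<Gamma> act M"

lemma L_simps [simp]:
  "carrier L = {z \<in> carrier T. \<forall>\<gamma>\<in>carrier \<Gamma>. act \<gamma> z = z}"
  "zero L = zero T" "add L = add T" "smult L = smult T" "bracket L = br"
  by (simp_all add: equivariant_algebra_def)

lemma fixed_simps [simp]:
  "carrier (fixed M) = {x \<in> carrier g. \<forall>\<gamma>\<in>stabilizer \<Gamma> mact M. twist_at K g S act \<gamma> M x = x}"
  "zero (fixed M) = zero g" "add (fixed M) = add g" "smult (fixed M) = smult g"
  "bracket (fixed M) = bracket g"
  by (simp_all add: fixed_algebra_at_def)

lemma eval_at_fixed:
  assumes M: "maximalideal M S" and z: "z \<in> carrier L"
  shows "eval_at K g S M z \<in> carrier (fixed M)"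
proof -
  have zT: "z \<in> carrier T" and inv: "\<And>\<gamma>. \<gamma> \<in> carrier \<Gamma> \<Longrightarrow> act \<gamma> z = z" using z by auto
  have "twist_at K g S act \<gamma> M (eval_at K g S M z) = eval_at K g S M z" if "\<gamma> \<in> stabilizer \<Gamma> mact M" for \<gamma>
    using eval_at_act[OF M _ _ zT, of \<gamma>] inv that by (simp add: stabilizer_def)
  then show ?thesis using hom_closed[OF eval_at_Hom[OF M] zT] by simp
qed

lemma average_invariant:
  assumes z: "z \<in> carrier T"
  shows "(\<Oplus>\<^bsub>T\<^esub>\<gamma>\<in>carrier \<Gamma>. act \<gamma> z) \<in> carrier L"
proof -
  let ?y = "\<Oplus>\<^bsub>T\<^esub>\<gamma>\<in>carrier \<Gamma>. act \<gamma> z"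
  have y: "?y \<in> carrier T" using act_closed[OF _ z] by (intro T.M.finsum_closed) auto
  have "act \<delta> ?y = ?y" if d: "\<delta> \<in> carrier \<Gamma>" for \<delta>
  proof -
    have "act \<delta> ?y = (\<Oplus>\<^bsub>T\<^esub>\<gamma>\<in>carrier \<Gamma>. act \<delta> (act \<gamma> z))"
      by (rule hom_finsum[OF T_module T_module act_Hom[OF d]]) (rule act_closed[OF _ z])
    also have "\<dots> = (\<Oplus>\<^bsub>T\<^esub>\<gamma>\<in>carrier \<Gamma>. act (\<delta> \<otimes>\<^bsub>\<Gamma>\<^esub> \<gamma>) z)"
      using act_mult[OF d _ z] act_closed[OF d act_closed[OF _ z]] act_closed[OF _ z] d
      by (intro T.M.finsum_cong') auto
    also have "\<dots> = (\<Oplus>\<^bsub>T\<^esub>\<gamma>\<in>(\<lambda>\<gamma>. \<delta> \<otimes>\<^bsub>\<Gamma>\<^esub> \<gamma>) ` carrier \<Gamma>. act \<gamma> z)"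
      using act_closed[OF _ z] d
      by (intro T.M.add.finprod_reindex[symmetric] \<Gamma>.inj_on_cmult) auto
    also have "\<dots> = ?y" using \<Gamma>.surj_const_mult[OF d] by simp
    finally show ?thesis .
  qed
  then show ?thesis using y by simp
qed

lemma eval_at_average:
  assumes M: "maximalideal M S" and z: "z \<in> carrier T"
  shows "eval_at K g S M (\<Oplus>\<^bsub>T\<^esub>\<gamma>\<in>carrier \<Gamma>. act \<gamma> z) = (\<Oplus>\<^bsub>g\<^esub>\<gamma>\<in>carrier \<Gamma>. eval_at K g S M (act \<gamma> z))"
  by (rule hom_finsum[OF T_module g_module eval_at_Hom[OF M]]) (rule act_closed[OF _ z])

text \<open>A product of functions each of which vanishes at one of the other points but not at \<open>M\<close>.\<close>

lemma function_separating_point: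
  assumes "maximalideal M S" "finite \<N>" "\<And>N. N \<in> \<N> \<Longrightarrow> maximalideal N S \<and> N \<noteq> M"
  shows "\<exists>s\<in>carrier S. s \<notin> M \<and> (\<forall>N\<in>\<N>. s \<in> N)"
  using assms(2,3)
proof (induction \<N> rule: finite_induct)
  case empty
  interpret M: maximalideal M S by fact
  have "\<one>\<^bsub>S\<^esub> \<notin> M" using M.one_imp_carrier M.I_notcarr by blast
  then show ?case by auto
next
  case (insert N \<N>)
  interpret M: maximalideal M S by fact
  have "maximalideal N S" and NM: "N \<noteq> M" using insert.prems by auto
  then interpret N: maximalideal N S by simp
  obtain s where s: "s \<in> carrier S" "s \<notin> M" "\<forall>N\<in>\<N>. s \<in> N" using insert by blast
  have "\<not> N \<subseteq> M"
    using N.I_maximal[OF M.is_ideal] M.a_subset M.I_notcarr NM by blast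
  then obtain t where t: "t \<in> N" "t \<notin> M" by blast
  have tS: "t \<in> carrier S" using t N.a_subset by blast
  note \<chi> = characterD[OF res_character[OF assms(1)]]
  have in_M: "u \<in> M \<longleftrightarrow> res M u = \<zero>\<^bsub>K\<^esub>" if "u \<in> carrier S" for u using res_ker[OF assms(1)] that by blast
  have "s \<otimes>\<^bsub>S\<^esub> t \<notin> M"
    using in_M[OF s(1)] in_M[OF tS] in_M[of "s \<otimes>\<^bsub>S\<^esub> t"] s t tS \<chi> K.integral_iff by auto
  moreover have "s \<otimes>\<^bsub>S\<^esub> t \<in> N'" if "N' \<in> insert N \<N>" for N'
  proof (cases "N' = N")
    case True
    then show ?thesis using N.I_l_closed[OF t(1) s(1)] by simp
  next
    case False
    then interpret N': ideal N' S using insert.prems that by (auto simp: maximalideal_def)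
    show ?thesis using N'.I_r_closed[of s t] s(3) tS that False by auto
  qed
  ultimately show ?case using s(1) tS by blast
qed

text \<open>Average \<open>x \<otimes> s\<close>, where \<open>s\<close> vanishes at all points of the relevant orbits except \<open>M i\<close>. The value of
  \<open>\<gamma> (x \<otimes> s)\<close> at a point depends on \<open>s\<close> at the preimage of this point under \<open>\<gamma>\<close>. So at \<open>M i\<close> only
  the \<open>\<gamma>\<close> in the stabilizer contribute, each with the same multiple of \<open>x\<close>, and at the other points
  nothing is left.\<close>

lemma invariant_interpolation:
  assumes char0: "\<And>n::nat. n > 0 \<Longrightarrow> [n] \<cdot>\<^bsub>K\<^esub> \<one>\<^bsub>K\<^esub> \<noteq> \<zero>\<^bsub>K\<^esub>"
    and "finite J" and Ms: "\<And>j. j \<in> J \<Longrightarrow> maximalideal (M j) S"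
    and orbits: "\<And>i j. \<lbrakk>i \<in> J; j \<in> J; i \<noteq> j\<rbrakk> \<Longrightarrow> orbit \<Gamma> mact (M i) \<noteq> orbit \<Gamma> mact (M j)"
    and i: "i \<in> J" and x: "x \<in> carrier (fixed (M i))"
  shows "\<exists>z\<in>carrier L. eval_at K g S (M i) z = x \<and> (\<forall>j\<in>J - {i}. eval_at K g S (M j) z = \<zero>\<^bsub>g\<^esub>)"
proof -
  note Mi = Ms[OF i]
  have xg: "x \<in> carrier g" and x_fix: "\<And>\<gamma>. \<gamma> \<in> stabilizer \<Gamma> mact (M i) \<Longrightarrow> twist_at K g S act \<gamma> (M i) x = x"
    using x by auto
  (* the preimages under the group of the points involved; s is to vanish at those different from M i *)
  define N where "N \<gamma> j = mact (inv\<^bsub>\<Gamma>\<^esub> \<gamma>) (M j)" for \<gamma> j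
  have N: "maximalideal (N \<gamma> j) S" "mact \<gamma> (N \<gamma> j) = M j" if "\<gamma> \<in> carrier \<Gamma>" "j \<in> J" for \<gamma> j
    using that mact_maximal[OF _ Ms] mact_inv(1)[OF _ Ms] unfolding N_def by auto
  let ?\<N> = "{N \<gamma> j | \<gamma> j. \<gamma> \<in> carrier \<Gamma> \<and> j \<in> J} - {M i}"
  have "?\<N> \<subseteq> (\<lambda>(\<gamma>, j). N \<gamma> j) ` (carrier \<Gamma> \<times> J)" by auto
  then have "finite ?\<N>" using \<Gamma>_finite assms(2) by (meson finite_SigmaI finite_imageI finite_subset)
  moreover have "maximalideal N' S \<and> N' \<noteq> M i" if "N' \<in> ?\<N>" for N' using that N(1) by auto
  ultimately have "\<exists>s\<in>carrier S. s \<notin> M i \<and> (\<forall>N'\<in>?\<N>. s \<in> N')"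
    by (rule function_separating_point[OF Mi])
  then obtain s where s: "s \<in> carrier S" "s \<notin> M i" "\<forall>N'\<in>?\<N>. s \<in> N'" by (elim bexE conjE)
  define k where "k = res (M i) s"
  have k: "k \<in> carrier K" "k \<noteq> \<zero>\<^bsub>K\<^esub>"
    using characterD(1)[OF res_character[OF Mi] s(1)] res_ker[OF Mi] s(1,2) by (auto simp: k_def)
  let ?z = "pure x s"
  have z: "?z \<in> carrier T" by (rule pure_closed[OF xg s(1)])
  have z_val: "eval_at K g S (M i) ?z = k \<odot>\<^bsub>g\<^esub> x"
    unfolding eval_at_eq k_def by (rule ev_pure[OF res_character[OF Mi] xg s(1)])
  have off: "eval_at K g S (M j) (act \<gamma> ?z) = \<zero>\<^bsub>g\<^esub>"
    if \<gamma>: "\<gamma> \<in> carrier \<Gamma>" and j: "j \<in> J" and ne: "N \<gamma> j \<noteq> M i" for \<gamma> j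
  proof -
    have "s \<in> N \<gamma> j" using bspec[OF s(3), of "N \<gamma> j"] \<gamma> j ne by blast
    then have "?z \<in> TI (N \<gamma> j)" by (rule pure_in_TI[OF maximal_subset[OF N(1)[OF \<gamma> j]] xg])
    then have "act \<gamma> ?z \<in> TI (M j)" using act_TI[OF \<gamma> N(1)[OF \<gamma> j]] N(2)[OF \<gamma> j] by metis
    then show ?thesis using eval_at_TI[OF Ms[OF j] act_closed[OF \<gamma> z]] by simp
  qed
  have other_orbit: "N \<gamma> j \<noteq> M i" if \<gamma>: "\<gamma> \<in> carrier \<Gamma>" and j: "j \<in> J" and "j \<noteq> i" for \<gamma> j
  proof
    assume "N \<gamma> j = M i"
    then have "orbit \<Gamma> mact (M i) = orbit \<Gamma> mact (M j)"
      using orbit_mact[OF _ Ms[OF j], of "inv\<^bsub>\<Gamma>\<^esub> \<gamma>"] \<gamma> unfolding N_def by simp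
    then show False using orbits[OF i j] that by auto
  qed
  have on: "eval_at K g S (M i) (act \<gamma> ?z) = k \<odot>\<^bsub>g\<^esub> x" if \<gamma>: "\<gamma> \<in> carrier \<Gamma>" and eq: "N \<gamma> i = M i" for \<gamma>
  proof -
    have stays: "mact \<gamma> (M i) = M i" using N(2)[OF \<gamma> i] eq by simp
    then have st: "\<gamma> \<in> stabilizer \<Gamma> mact (M i)" using \<gamma> by (simp add: stabilizer_def)
    have "twist_at K g S act \<gamma> (M i) (k \<odot>\<^bsub>g\<^esub> x) = k \<odot>\<^bsub>g\<^esub> twist_at K g S act \<gamma> (M i) x"
      unfolding twist_at_def
      using hom_smult[OF hom_compose[OF eval_at_Hom[OF Mi] hom_compose[OF act_Hom[OF \<gamma>] pure_Hom_left[OF S.one_closed]]] k(1) xg]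
      by simp
    then show ?thesis using eval_at_act[OF Mi \<gamma> stays z] z_val x_fix[OF st] by simp
  qed
  let ?y = "\<Oplus>\<^bsub>T\<^esub>\<gamma>\<in>carrier \<Gamma>. act \<gamma> ?z"
  note y = average_invariant[OF z]
  let ?n = "card {\<gamma> \<in> carrier \<Gamma>. N \<gamma> i = M i}"
  have kx: "k \<odot>\<^bsub>g\<^esub> x \<in> carrier g" using k xg by simp
  have "eval_at K g S (M i) ?y = (\<Oplus>\<^bsub>g\<^esub>\<gamma>\<in>carrier \<Gamma>. if N \<gamma> i = M i then k \<odot>\<^bsub>g\<^esub> x else \<zero>\<^bsub>g\<^esub>)"
    unfolding eval_at_average[OF Mi z]
    using on off[OF _ i] kx by (intro g.M.finsum_cong') auto
  also have "\<dots> = ([?n] \<cdot>\<^bsub>K\<^esub> \<one>\<^bsub>K\<^esub>) \<odot>\<^bsub>g\<^esub> (k \<odot>\<^bsub>g\<^esub> x)" by (rule g.finsum_if_const[OF \<Gamma>_finite kx])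
  also have "\<dots> = (([?n] \<cdot>\<^bsub>K\<^esub> \<one>\<^bsub>K\<^esub>) \<otimes>\<^bsub>K\<^esub> k) \<odot>\<^bsub>g\<^esub> x" using k xg by (simp add: g.smult_assoc1)
  finally have y_i: "eval_at K g S (M i) ?y = (([?n] \<cdot>\<^bsub>K\<^esub> \<one>\<^bsub>K\<^esub>) \<otimes>\<^bsub>K\<^esub> k) \<odot>\<^bsub>g\<^esub> x" .
  have y_j: "eval_at K g S (M j) ?y = \<zero>\<^bsub>g\<^esub>" if j: "j \<in> J" "j \<noteq> i" for j
  proof -
    have "eval_at K g S (M j) ?y = (\<Oplus>\<^bsub>g\<^esub>\<gamma>\<in>carrier \<Gamma>. \<zero>\<^bsub>g\<^esub>)"
      unfolding eval_at_average[OF Ms[OF j(1)] z]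
      using off[OF _ j(1)] other_orbit[OF _ j] by (intro g.M.finsum_cong') auto
    then show ?thesis by simp
  qed
  let ?c = "([?n] \<cdot>\<^bsub>K\<^esub> \<one>\<^bsub>K\<^esub>) \<otimes>\<^bsub>K\<^esub> k"
  have "\<one>\<^bsub>\<Gamma>\<^esub> \<in> {\<gamma> \<in> carrier \<Gamma>. N \<gamma> i = M i}" using mact_one[OF Mi] by (simp add: N_def)
  then have "?n > 0" using \<Gamma>_finite by (auto simp: card_gt_0_iff)
  then have c: "?c \<in> carrier K" "?c \<noteq> \<zero>\<^bsub>K\<^esub>" using char0 k K.integral_iff by auto
  then have u: "?c \<in> Units K" using K.field_Units by auto
  then have cinv: "inv\<^bsub>K\<^esub> ?c \<in> carrier K" by simp
  (* the factor is the order of the stabilizer times the value of s at M i *)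
  let ?w = "inv\<^bsub>K\<^esub> ?c \<odot>\<^bsub>T\<^esub> ?y"
  have yT: "?y \<in> carrier T" and y_inv: "\<And>\<gamma>. \<gamma> \<in> carrier \<Gamma> \<Longrightarrow> act \<gamma> ?y = ?y" using y by auto
  have "?w \<in> carrier L" using yT cinv y_inv hom_smult[OF act_Hom cinv yT] by simp
  moreover have "eval_at K g S (M i) ?w = x"
    using hom_smult[OF eval_at_Hom[OF Mi] cinv yT] y_i cinv c(1) u xg
    by (simp add: g.smult_assoc1[symmetric])
  moreover have "eval_at K g S (M j) ?w = \<zero>\<^bsub>g\<^esub>" if "j \<in> J - {i}" for j
    using hom_smult[OF eval_at_Hom[OF Ms] cinv yT, of j] y_j[of j] that cinv by simp
  ultimately show ?thesis by blast
qed

lemma lie_module_eval_at: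
  assumes L: "lie_algebra K L" and M: "maximalideal M S" and V: "lie_module K (fixed M) V \<phi>"
  shows "lie_module K L V (\<phi> \<circ> eval_at K g S M)"
proof -
  note D = lie_moduleD[OF V]
  note ev_fixed = eval_at_fixed[OF M]
  have T: "z \<in> carrier T" if "z \<in> carrier L" for z using that by simp
  show ?thesis
  proof (intro lie_module.intro lie_module_axioms.intro)
    show "lie_algebra K L" by fact
    show "vectorspace K V" by (rule D(2))
    show "(\<phi> \<circ> eval_at K g S M) z \<in> Hom K V V" if "z \<in> carrier L" for z
      using D(3)[OF ev_fixed[OF that]] by simp
    show "(\<phi> \<circ> eval_at K g S M) (z \<oplus>\<^bsub>L\<^esub> w) v = (\<phi> \<circ> eval_at K g S M) z v \<oplus>\<^bsub>V\<^esub> (\<phi> \<circ> eval_at K g S M) w v"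
      if "z \<in> carrier L" "w \<in> carrier L" "v \<in> carrier V" for z w v
      using D(4)[OF ev_fixed[OF that(1)] ev_fixed[OF that(2)] that(3)] hom_add[OF eval_at_Hom[OF M] T[OF that(1)] T[OF that(2)]]
      by simp
    show "(\<phi> \<circ> eval_at K g S M) (a \<odot>\<^bsub>L\<^esub> z) v = a \<odot>\<^bsub>V\<^esub> (\<phi> \<circ> eval_at K g S M) z v"
      if "a \<in> carrier K" "z \<in> carrier L" "v \<in> carrier V" for a z v
      using D(5)[OF that(1) ev_fixed[OF that(2)] that(3)] hom_smult[OF eval_at_Hom[OF M] that(1) T[OF that(2)]] by simp
    show "(\<phi> \<circ> eval_at K g S M) (bracket L z w) v =
        (\<phi> \<circ> eval_at K g S M) z ((\<phi> \<circ> eval_at K g S M) w v) \<ominus>\<^bsub>V\<^esub>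
        (\<phi> \<circ> eval_at K g S M) w ((\<phi> \<circ> eval_at K g S M) z v)"
      if "z \<in> carrier L" "w \<in> carrier L" "v \<in> carrier V" for z w v
      using D(6)[OF ev_fixed[OF that(1)] ev_fixed[OF that(2)] that(3)]
        ev_br[OF res_character[OF M] T[OF that(1)] T[OF that(2)]] by (simp add: eval_at_eq)
  qed
qed

end

section \<open>Evaluation modules\<close>

lemma one_dim_generated:
  assumes "vectorspace K W" "vectorspace.fin_dim K W" "vectorspace.dim K W = 1"
  obtains w where "w \<in> carrier W" "w \<noteq> \<zero>\<^bsub>W\<^esub>" "\<And>v. v \<in> carrier W \<Longrightarrow> \<exists>k\<in>carrier K. v = k \<odot>\<^bsub>W\<^esub> w"
proof -
  interpret W: vectorspace K W by fact
  obtain B where B: "finite B" "W.basis B" using W.finite_basis_exists assms(2) by blast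
  then have "card B = 1" using W.dim_basis assms(3) by simp
  then obtain w where w: "B = {w}" by (metis card_1_singletonE)
  have wW: "w \<in> carrier W" and span: "W.span {w} = carrier W" and li: "W.lin_indpt {w}"
    using B w by (auto simp: W.basis_def)
  have "w \<noteq> \<zero>\<^bsub>W\<^esub>" using W.vs_zero_lin_dep[OF _ li] wW by auto
  moreover have "\<exists>k\<in>carrier K. v = k \<odot>\<^bsub>W\<^esub> w" if "v \<in> carrier W" for v
  proof -
    have "\<exists>a. a \<in> {w} \<rightarrow> carrier K \<and> W.lincomb a {w} = v"
      using W.finite_in_span[of "{w}" v] wW span that by blast
    then show ?thesis using wW by (auto simp: W.lincomb_def)
  qed
  ultimately show ?thesis using that wW by blast
qed

lemma simple_lie_moduleD:
  assumes "simple_lie_module K L V \<rho>"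
  shows "lie_module K L V \<rho>" "carrier V \<noteq> {\<zero>\<^bsub>V\<^esub>}"
    and "\<lbrakk>submod K U V; \<And>x. x \<in> carrier L \<Longrightarrow> \<rho> x ` U \<subseteq> U\<rbrakk> \<Longrightarrow> U = {\<zero>\<^bsub>V\<^esub>} \<or> U = carrier V"
  using assms by (auto simp: simple_lie_module_def)

lemma
  assumes "vectorspace K W" "vectorspace.fin_dim K W" "vectorspace.dim K W = 1"
  shows one_dim_nonzero: "carrier W \<noteq> {\<zero>\<^bsub>W\<^esub>}"
    and one_dim_endo_scalar:
      "f \<in> Hom K W W \<Longrightarrow> \<exists>k\<in>carrier K. \<forall>v\<in>carrier W. f v = k \<odot>\<^bsub>W\<^esub> v"
    and one_dim_submod: "submod K U W \<Longrightarrow> U = {\<zero>\<^bsub>W\<^esub>} \<or> U = carrier W"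
proof -
  interpret W: vectorspace K W by fact
  obtain w where w: "w \<in> carrier W" "w \<noteq> \<zero>\<^bsub>W\<^esub>" "\<And>v. v \<in> carrier W \<Longrightarrow> \<exists>k\<in>carrier K. v = k \<odot>\<^bsub>W\<^esub> w"
    using one_dim_generated[OF assms] by metis
  then show "carrier W \<noteq> {\<zero>\<^bsub>W\<^esub>}" by blast
  show "\<exists>k\<in>carrier K. \<forall>v\<in>carrier W. f v = k \<odot>\<^bsub>W\<^esub> v" if f: "f \<in> Hom K W W"
  proof -
    obtain k where k: "k \<in> carrier K" "f w = k \<odot>\<^bsub>W\<^esub> w" using w(3)[OF hom_closed[OF f w(1)]] by blast
    have "f v = k \<odot>\<^bsub>W\<^esub> v" if v: "v \<in> carrier W" for v
    proof -
      obtain l where l: "l \<in> carrier K" "v = l \<odot>\<^bsub>W\<^esub> w" using w(3)[OF v] by blast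
      have "f v = l \<odot>\<^bsub>W\<^esub> (k \<odot>\<^bsub>W\<^esub> w)" using hom_smult[OF f l(1) w(1)] l(2) k(2) by simp
      also have "\<dots> = k \<odot>\<^bsub>W\<^esub> v"
        using k(1) l w(1) by (simp add: W.smult_assoc1[symmetric] W.R.m_comm)
      finally show ?thesis .
    qed
    then show ?thesis using k(1) by blast
  qed
  show "U = {\<zero>\<^bsub>W\<^esub>} \<or> U = carrier W" if U: "submod K U W"
  proof (cases "U \<subseteq> {\<zero>\<^bsub>W\<^esub>}")
    case True
    then show ?thesis using submod_zero[OF U] by blast
  next
    case False
    then obtain u where u: "u \<in> U" "u \<noteq> \<zero>\<^bsub>W\<^esub>" by blast
    obtain k where k: "k \<in> carrier K" "u = k \<odot>\<^bsub>W\<^esub> w"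
      using w(3)[OF submod_carrier[OF U u(1)]] by blast
    have "k \<noteq> \<zero>\<^bsub>K\<^esub>" using u(2) k(2) w(1) by auto
    then have unit: "k \<in> Units K" using k(1) by (simp add: W.field_Units)
    have "inv\<^bsub>K\<^esub> k \<odot>\<^bsub>W\<^esub> u = w"
      using k w(1) unit by (simp add: W.smult_assoc1[symmetric])
    then have "w \<in> U" using submod_smult[OF U _ u(1), of "inv\<^bsub>K\<^esub> k"] unit by simp
    then have "v \<in> U" if "v \<in> carrier W" for v using w(3)[OF that] submod_smult[OF U] by metis
    then show ?thesis using submod_carrier[OF U] by blast
  qed
qed

text \<open>An element acting by scalars on all factors but the \<open>i\<close>-th acts on the tensor product by its
  operator in slot \<open>i\<close> plus a scalar, so an invariant subspace is stable under that slot operator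
  alone. Hence it suffices that each factor is simple under the elements of this kind.\<close>

theorem simple_lie_module_multi_tensor:
  fixes V :: "'i \<Rightarrow> ('k, 'v, 'e) module_scheme"
  assumes "algebraically_closed K" "finite I" "lie_algebra K L"
    and \<sigma>: "\<And>i. i \<in> I \<Longrightarrow> lie_module K L (V i) (\<sigma> i)"
    and fd: "\<And>i. i \<in> I \<Longrightarrow> vectorspace.fin_dim K (V i)"
    and nz: "\<And>i. i \<in> I \<Longrightarrow> carrier (V i) \<noteq> {\<zero>\<^bsub>V i\<^esub>}"
    and irr: "\<And>i W. \<lbrakk>i \<in> I; submod K W (V i);
        \<And>z. \<lbrakk>z \<in> carrier L;
              \<And>j. \<lbrakk>j \<in> I; j \<noteq> i\<rbrakk> \<Longrightarrow> \<exists>k\<in>carrier K. \<forall>v\<in>carrier (V j). \<sigma> j z v = k \<odot>\<^bsub>V j\<^esub> v\<rbrakk>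
            \<Longrightarrow> \<sigma> i z ` W \<subseteq> W\<rbrakk>
        \<Longrightarrow> W = {\<zero>\<^bsub>V i\<^esub>} \<or> W = carrier (V i)"
  shows "vectorspace.fin_dim K (multi_tensor K I V)"
    and "simple_lie_module K L (multi_tensor K I V) (multi_tensor_rep K I V \<sigma>)"
proof -
  interpret K: algebraically_closed K by fact
  note D = lie_moduleD[OF \<sigma>]
  have field: "field K" by (rule K.field_axioms)
  interpret multi_tensor_product K I V
    by (rule multi_tensor_product.intro[OF K.is_cring vs_module[OF D(2)]])
  have "\<forall>i\<in>I. \<exists>B c. dual_basis K (V i) B c" using dual_basis_exists D(2) fd by blast
  then obtain B c where B: "\<And>i. i \<in> I \<Longrightarrow> dual_basis K (V i) (B i) (c i)" by metis
  show "vectorspace.fin_dim K T" by (rule fin_dim_T[OF field assms(2) B])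
  have "B i \<noteq> {}" if i: "i \<in> I" for i
  proof
    interpret Vi: Module.module K "V i" by (rule V_module[OF i])
    assume "B i = {}"
    then have "v = \<zero>\<^bsub>V i\<^esub>" if "v \<in> carrier (V i)" for v
      using dual_basis_expand[OF B[OF i] that] by simp
    then show False using nz[OF i] Vi.M.zero_closed by blast
  qed
  then obtain b where b: "b \<in> (\<Pi>\<^sub>E i\<in>I. B i)" by (metis PiE_eq_empty_iff ex_in_conv)
  have bZ: "b \<in> Z" using b dual_basis_closed[OF B] by (auto simp: PiE_iff)
  have T_nz: "carrier T \<noteq> {\<zero>\<^bsub>T\<^esub>}"
    using pure_basis_nonzero[OF field assms(2) B b] pure_closed[OF bZ] by blast
  let ?rep = "multi_tensor_rep K I V \<sigma>"
  have full: "U = carrier T"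
    if U: "submod K U T" and inv: "\<forall>z\<in>carrier L. ?rep z ` U \<subseteq> U" and U_nz: "U \<noteq> {\<zero>\<^bsub>T\<^esub>}" for U
  proof (rule irreducible_tensor[OF assms(1,2) D(2) fd U U_nz])
    fix i W assume i: "i \<in> I" and W: "submod K W (V i)"
      and stable: "\<And>a. \<lbrakk>a \<in> End i; slot i a ` U \<subseteq> U\<rbrakk> \<Longrightarrow> a ` W \<subseteq> W"
    show "W = {\<zero>\<^bsub>V i\<^esub>} \<or> W = carrier (V i)"
    proof (rule irr[OF i W])
      fix z assume z: "z \<in> carrier L"
        and scal: "\<And>j. \<lbrakk>j \<in> I; j \<noteq> i\<rbrakk> \<Longrightarrow> \<exists>k\<in>carrier K. \<forall>v\<in>carrier (V j). \<sigma> j z v = k \<odot>\<^bsub>V j\<^esub> v"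
      show "\<sigma> i z ` W \<subseteq> W"
      proof (rule stable[OF D(3)[OF i z]])
        show "slot i (\<sigma> i z) ` U \<subseteq> U"
        proof (rule image_subsetI)
          fix u assume uU: "u \<in> U"
          have u: "u \<in> carrier T" by (rule submod_carrier[OF U uU])
          have slots: "slot j (\<sigma> j z) u \<in> carrier T" if "j \<in> I" for j
            by (rule slot_closed[OF that D(3)[OF that z] u])
          have others: "slot j (\<sigma> j z) u \<in> U" if j: "j \<in> I - {i}" for j
          proof -
            have jI: "j \<in> I" "j \<noteq> i" using j by auto
            obtain k where k: "k \<in> carrier K" and eq: "\<And>v. v \<in> carrier (V j) \<Longrightarrow> \<sigma> j z v = k \<odot>\<^bsub>V j\<^esub> v"
              using scal[OF jI] by blast
            have "slot j (\<sigma> j z) u = slot j (\<lambda>v. k \<odot>\<^bsub>V j\<^esub> v) u"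
              by (rule slot_cong[OF jI(1) D(3)[OF jI(1) z] hom_scale[OF V_module[OF jI(1)] hom_id k] eq u])
            also have "\<dots> = k \<odot>\<^bsub>T\<^esub> u"
              using slot_smult[OF jI(1) k hom_id u] slot_id[OF jI(1) u] by simp
            finally show ?thesis using submod_smult[OF U k uU] by simp
          qed
          let ?rest = "\<Oplus>\<^bsub>T\<^esub>j\<in>I - {i}. slot j (\<sigma> j z) u"
          have rest: "?rest \<in> U" by (rule submod_finsum[OF U others])
          have "?rep z u = (\<Oplus>\<^bsub>T\<^esub>j\<in>insert i (I - {i}). slot j (\<sigma> j z) u)"
            using multi_tensor_rep_eq[of \<sigma>, OF D(3)[OF _ z] u] i
            by (simp add: total_op_def insert_absorb)
          also have "\<dots> = slot i (\<sigma> i z) u \<oplus>\<^bsub>T\<^esub> ?rest"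
            using assms(2) slots i by (subst T.M.finsum_insert) auto
          finally have "slot i (\<sigma> i z) u = ?rep z u \<ominus>\<^bsub>T\<^esub> ?rest"
            using slots[OF i] submod_carrier[OF U rest] by (simp add: T.M.minus_eq T.M.a_assoc T.M.r_neg)
          moreover have "?rep z u \<in> U" using inv z uU by blast
          ultimately show "slot i (\<sigma> i z) u \<in> U" using submod_minus[OF U _ rest] by simp
        qed
      qed
    qed
  qed
  show "simple_lie_module K L T ?rep"
    unfolding simple_lie_module_def
    using lie_module_multi_tensor[of I K L V \<sigma>, OF assms(2,3) \<sigma>] T_nz full by blast
qed

theorem theorem3p2:
  fixes K :: "'k ring"
    and g :: "('k, 'g) lie_alg"
    and S :: "('k, 's) module"
    and \<Gamma> :: "'c monoid"
    and act :: "'c \<Rightarrow> ('g \<times> 's \<Rightarrow> 'k) set \<Rightarrow> ('g \<times> 's \<Rightarrow> 'k) set"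
    and r :: nat
    and M :: "nat \<Rightarrow> 's set"
    and V :: "nat \<Rightarrow> ('k, 'v) module"
    and \<phi> :: "nat \<Rightarrow> 'g \<Rightarrow> 'v \<Rightarrow> 'v"
    and W :: "('k, 'v) module"
    and \<rho> :: "('g \<times> 's \<Rightarrow> 'k) set \<Rightarrow> 'v \<Rightarrow> 'v"
  assumes "algebraically_closed K"
    and "\<And>n::nat. n > 0 \<Longrightarrow> [n] \<cdot>\<^bsub>K\<^esub> \<one>\<^bsub>K\<^esub> \<noteq> \<zero>\<^bsub>K\<^esub>"
    and "simple_lie_algebra K g"
    and "vectorspace.fin_dim K g"
    and "algebra K S"
    and "finite_type_algebra K S"
    and "reduced_ring S"
    and "group \<Gamma>"
    and "finite (carrier \<Gamma>)"
    and "group_action \<Gamma> (carrier (current_algebra K g S)) act"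
    and "\<And>\<gamma>. \<gamma> \<in> carrier \<Gamma> \<Longrightarrow>
           act \<gamma> \<in> lie_hom K (current_algebra K g S) (current_algebra K g S)"
    and "\<And>i. i \<in> {1..r} \<Longrightarrow> maximalideal (M i) S"
    and "\<And>i j. \<lbrakk>i \<in> {1..r}; j \<in> {1..r}; i \<noteq> j\<rbrakk> \<Longrightarrow>
           orbit \<Gamma> (max_action K g S act) (M i) \<noteq> orbit \<Gamma> (max_action K g S act) (M j)"
    and "\<And>i. i \<in> {1..r} \<Longrightarrow>
           simple_lie_module K (fixed_algebra_at K g S \<Gamma> act (M i)) (V i) (\<phi> i)"
    and "\<And>i. i \<in> {1..r} \<Longrightarrow> vectorspace.fin_dim K (V i)"
    and "lie_module K (equivariant_algebra K g S \<Gamma> act) W \<rho>"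
    and "vectorspace.fin_dim K W"
    and "vectorspace.dim K W = 1"
  shows "vectorspace.fin_dim K (multi_tensor K {0..r} (V(0 := W))) \<and>
         simple_lie_module K (equivariant_algebra K g S \<Gamma> act)
           (multi_tensor K {0..r} (V(0 := W)))
           (multi_tensor_rep K {0..r} (V(0 := W))
             ((\<lambda>i. \<phi> i \<circ> eval_at K g S (M i))(0 := \<rho>)))"
proof -
  interpret equivariant K g S \<Gamma> act
    by (intro equivariant.intro current.intro equivariant_axioms.intro) (rule assms; assumption?)+
  let ?V = "V(0 := W)" and ?\<sigma> = "(\<lambda>i. \<phi> i \<circ> eval_at K g S (M i))(0 := \<rho>)"
  note W = assms(16)
  note LW = lie_moduleD(1)[OF W]
  have ideals: "maximalideal (M i) S" if "i \<in> {1..r}" for i using assms(12)[OF that] .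
  note simple = simple_lie_moduleD[OF assms(14)]
  have W_scalars: "\<exists>k\<in>carrier K. \<forall>v\<in>carrier W. \<rho> z v = k \<odot>\<^bsub>W\<^esub> v" if z: "z \<in> carrier L" for z
    by (rule one_dim_endo_scalar[OF lie_moduleD(2)[OF W] assms(17,18) lie_moduleD(3)[OF W z]])
  have modules: "lie_module K L (?V i) (?\<sigma> i)" if "i \<in> {0..r}" for i
    using W lie_module_eval_at[OF LW ideals simple(1)] that by (cases "i = 0") auto
  have dims: "vectorspace.fin_dim K (?V i)" if "i \<in> {0..r}" for i
    using assms(15,17) that by (cases "i = 0") auto
  have nonzero: "carrier (?V i) \<noteq> {\<zero>\<^bsub>?V i\<^esub>}" if "i \<in> {0..r}" for i
    using one_dim_nonzero[OF lie_moduleD(2)[OF W] assms(17,18)] simple(2) that by (cases "i = 0") auto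
  have irr: "U = {\<zero>\<^bsub>?V i\<^esub>} \<or> U = carrier (?V i)"
    if i: "i \<in> {0..r}" and U: "submod K U (?V i)"
      and stable: "\<And>z. \<lbrakk>z \<in> carrier L; \<And>j. \<lbrakk>j \<in> {0..r}; j \<noteq> i\<rbrakk> \<Longrightarrow>
          \<exists>k\<in>carrier K. \<forall>v\<in>carrier (?V j). ?\<sigma> j z v = k \<odot>\<^bsub>?V j\<^esub> v\<rbrakk> \<Longrightarrow> ?\<sigma> i z ` U \<subseteq> U" for i U
  proof (cases "i = 0")
    case True
    then show ?thesis using one_dim_submod[OF lie_moduleD(2)[OF W] assms(17,18)] U by simp
  next
    case False
    then have i: "i \<in> {1..r}" and Vi: "?V i = V i" using i by auto
    (* x is the value at M i of an invariant element z that vanishes at the other M j, hence acts by zero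
       on V j; on the one-dimensional W it acts by a scalar anyway *)
    have "\<phi> i x ` U \<subseteq> U" if x: "x \<in> carrier (fixed (M i))" for x
    proof -
      obtain z where z: "z \<in> carrier L" "eval_at K g S (M i) z = x"
          "\<And>j. j \<in> {1..r} - {i} \<Longrightarrow> eval_at K g S (M j) z = \<zero>\<^bsub>g\<^esub>"
        using invariant_interpolation[of "{1..r}" M i x, OF assms(2) finite_atLeastAtMost ideals assms(13) i x] by blast
      have "?\<sigma> i z ` U \<subseteq> U"
      proof (rule stable[OF z(1)])
        fix j assume j: "j \<in> {0..r}" "j \<noteq> i"
        show "\<exists>k\<in>carrier K. \<forall>v\<in>carrier (?V j). ?\<sigma> j z v = k \<odot>\<^bsub>?V j\<^esub> v"
        proof (cases "j = 0")
          case True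
          then show ?thesis using W_scalars[OF z(1)] by simp
        next
          case False
          then have j: "j \<in> {1..r}" and z_j: "eval_at K g S (M j) z = \<zero>\<^bsub>g\<^esub>" using j z(3) by auto
          interpret Vj: Module.module K "V j" by (rule vs_module[OF lie_moduleD(2)[OF simple(1)[OF j]]])
          have fx: "\<zero>\<^bsub>g\<^esub> \<in> carrier (fixed (M j))" using eval_at_fixed[OF ideals[OF j] z(1)] z_j by simp
          have "\<phi> j \<zero>\<^bsub>g\<^esub> v = \<zero>\<^bsub>K\<^esub> \<odot>\<^bsub>V j\<^esub> v" if v: "v \<in> carrier (V j)" for v
            using lie_moduleD(5)[OF simple(1)[OF j] K.zero_closed fx v]
              hom_closed[OF lie_moduleD(3)[OF simple(1)[OF j] fx] v] v by simp
          then show ?thesis using False z_j by (intro bexI[of _ "\<zero>\<^bsub>K\<^esub>"]) auto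
        qed
      qed
      then show ?thesis using False z(2) by simp
    qed
    then show ?thesis using simple(3)[OF i] U unfolding Vi by blast
  qed
  note tensor = simple_lie_module_multi_tensor[of K "{0..r}" L ?V ?\<sigma>, OF assms(1) finite_atLeastAtMost LW modules dims nonzero irr]
  show ?thesis using tensor by blast
qed

end
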